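(* Let $\gamma<0$ and $1<p<3$. Then for any $\tilde m>0$ there exists $L^{**}=L^{**}(\tilde m)>0$ such that for any $L>L^{**}$, every real-valued and positive minimizer of $$e_{m,\gamma}=\inf\{E_\gamma(u): u\in H^1(\mathbb S_L),\ M(u)=m\}\qquad\text{with } m=\tilde m L$$ depends on the transverse variable $y$ in a nontrivial way (i.e. is not a function of $x$ alone).
   Context: For $L>0$, $\mathbb S_L=\mathbb R\times[0,L]$ with variables $(x,y)$, and $H^1(\mathbb S_L)$ is the usual Sobolev space of complex-valued functions; $u(0,y)$ denotes the trace of $u$ on $\{x=0\}$, which belongs to $L^2(0,L)$. The energy and mass are $$E_\gamma(u)=\tfrac12\|\nabla u\|_{L^2(\mathbb S_L)}^2+\tfrac{\gamma}{2}\int_0^L|u(0,y)|^2dy-\tfrac1{p+1}\|u\|_{L^{p+1}(\mathbb S_L)}^{p+1},\qquad M(u)=\|u\|_{L^2(\mathbb S_L)}^2.$$ (For $\gamma<0$, $1<p<3$ and every $m>0$, the paper shows that such a real-valued positive minimizer exists.) *)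

theory Defs
  imports "HOL-Analysis.Analysis"
begin

section \<open>Square-integrable functions\<close>

text \<open>Elements of \<open>L\<^sup>2\<close> and of the Sobolev space are represented by functions; equality of
  elements is equality almost everywhere.\<close>

definition L2_space :: "'a measure \<Rightarrow> ('a \<Rightarrow> complex) set" where
  "L2_space M = {u \<in> borel_measurable M. integrable M (\<lambda>z. (cmod (u z))\<^sup>2)}"

definition L2_norm :: "'a measure \<Rightarrow> ('a \<Rightarrow> complex) \<Rightarrow> real" where
  "L2_norm M u = sqrt (\<integral>z. (cmod (u z))\<^sup>2 \<partial>M)"


section \<open>Smooth functions and test functions on the plane\<close>

definition partial :: "real \<times> real \<Rightarrow> (real \<times> real \<Rightarrow> complex) \<Rightarrow> real \<times> real \<Rightarrow> complex" where
  "partial e f z = frechet_derivative f (at z) e"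

primrec C_k :: "nat \<Rightarrow> (real \<times> real \<Rightarrow> complex) \<Rightarrow> bool" where
  "C_k 0 f \<longleftrightarrow> continuous_on UNIV f"
| "C_k (Suc k) f \<longleftrightarrow>
     (\<forall>z. f differentiable (at z)) \<and> C_k k (partial (1, 0) f) \<and> C_k k (partial (0, 1) f)"

definition test_functions :: "(real \<times> real) set \<Rightarrow> (real \<times> real \<Rightarrow> complex) set" where
  "test_functions \<Omega> =
     {\<phi>. (\<forall>k. C_k k \<phi>) \<and> compact (closure {z. \<phi> z \<noteq> 0}) \<and> closure {z. \<phi> z \<noteq> 0} \<subseteq> \<Omega>}"


section \<open>The Sobolev space on the strip\<close>

definition strip :: "real \<Rightarrow> (real \<times> real) set" where
  "strip L = UNIV \<times> {0..L}"

abbreviation strip_measure :: "real \<Rightarrow> (real \<times> real) measure" where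
  "strip_measure L \<equiv> lebesgue_on (strip L)"

text \<open>Test functions vanish near the boundary of the strip, so no boundary condition is imposed
  on the elements of the Sobolev space.\<close>

definition is_weak_partial ::
    "real \<Rightarrow> real \<times> real \<Rightarrow> (real \<times> real \<Rightarrow> complex) \<Rightarrow> (real \<times> real \<Rightarrow> complex) \<Rightarrow> bool" where
  "is_weak_partial L e u g \<longleftrightarrow>
     g \<in> L2_space (strip_measure L) \<and>
     (\<forall>\<phi> \<in> test_functions (interior (strip L)).
        (\<integral>z. u z * partial e \<phi> z \<partial>strip_measure L) = - (\<integral>z. g z * \<phi> z \<partial>strip_measure L))"

definition H1 :: "real \<Rightarrow> (real \<times> real \<Rightarrow> complex) set" where
  "H1 L = {u \<in> L2_space (strip_measure L).
             (\<exists>g. is_weak_partial L (1, 0) u g) \<and> (\<exists>g. is_weak_partial L (0, 1) u g)}"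

text \<open>For elements of the Sobolev space the weak derivative is unique almost everywhere, so the
  choice of a representative does not affect any integral.\<close>

definition weak_partial ::
    "real \<Rightarrow> real \<times> real \<Rightarrow> (real \<times> real \<Rightarrow> complex) \<Rightarrow> real \<times> real \<Rightarrow> complex" where
  "weak_partial L e u = (SOME g. is_weak_partial L e u g)"

definition grad_norm :: "real \<Rightarrow> (real \<times> real \<Rightarrow> complex) \<Rightarrow> real" where
  "grad_norm L u =
     sqrt ((L2_norm (strip_measure L) (weak_partial L (1, 0) u))\<^sup>2 +
           (L2_norm (strip_measure L) (weak_partial L (0, 1) u))\<^sup>2)"

definition H1_norm :: "real \<Rightarrow> (real \<times> real \<Rightarrow> complex) \<Rightarrow> real" where
  "H1_norm L u = sqrt ((L2_norm (strip_measure L) u)\<^sup>2 + (grad_norm L u)\<^sup>2)"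


section \<open>The trace on the line \<open>x = 0\<close>\<close>

text \<open>The trace operator is the continuous extension to \<open>H1 L\<close>, with values in \<open>L\<^sup>2(0,L)\<close>, of the
  map taking \<open>\<phi>\<close> to \<open>\<phi>(0, \<cdot>)\<close>, defined on the dense subspace of restrictions to the strip of
  smooth functions with compact support in the plane. The trace is unique almost everywhere.\<close>

definition is_trace :: "real \<Rightarrow> (real \<times> real \<Rightarrow> complex) \<Rightarrow> (real \<Rightarrow> complex) \<Rightarrow> bool" where
  "is_trace L u t \<longleftrightarrow>
     u \<in> H1 L \<and> t \<in> L2_space (lebesgue_on {0..L}) \<and>
     (\<exists>\<phi>. (\<forall>n. \<phi> n \<in> test_functions UNIV) \<and>
          (\<lambda>n. H1_norm L (\<lambda>z. \<phi> n z - u z)) \<longlonglongrightarrow> 0 \<and>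
          (\<lambda>n. L2_norm (lebesgue_on {0..L}) (\<lambda>y. \<phi> n (0, y) - t y)) \<longlonglongrightarrow> 0)"

definition trace0 :: "real \<Rightarrow> (real \<times> real \<Rightarrow> complex) \<Rightarrow> real \<Rightarrow> complex" where
  "trace0 L u = (SOME t. is_trace L u t)"


section \<open>Energy, mass and minimizers\<close>

definition energy :: "real \<Rightarrow> real \<Rightarrow> real \<Rightarrow> (real \<times> real \<Rightarrow> complex) \<Rightarrow> real" where
  "energy \<gamma> p L u =
     1 / 2 * (grad_norm L u)\<^sup>2
     + \<gamma> / 2 * (\<integral>y. (cmod (trace0 L u y))\<^sup>2 \<partial>lebesgue_on {0..L})
     - 1 / (p + 1) * (\<integral>z. cmod (u z) powr (p + 1) \<partial>strip_measure L)"

definition mass :: "real \<Rightarrow> (real \<times> real \<Rightarrow> complex) \<Rightarrow> real" where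
  "mass L u = (L2_norm (strip_measure L) u)\<^sup>2"

text \<open>The infimum is taken in the extended reals, so that it is meaningful without knowing
  beforehand that the energy is bounded below.\<close>

definition min_energy :: "real \<Rightarrow> real \<Rightarrow> real \<Rightarrow> real \<Rightarrow> ereal" where
  "min_energy \<gamma> p L m = (INF u \<in> {u \<in> H1 L. mass L u = m}. ereal (energy \<gamma> p L u))"

definition is_minimizer ::
    "real \<Rightarrow> real \<Rightarrow> real \<Rightarrow> real \<Rightarrow> (real \<times> real \<Rightarrow> complex) \<Rightarrow> bool" where
  "is_minimizer \<gamma> p L m u \<longleftrightarrow>
     u \<in> H1 L \<and> mass L u = m \<and> ereal (energy \<gamma> p L u) = min_energy \<gamma> p L m"

definition real_positive :: "real \<Rightarrow> (real \<times> real \<Rightarrow> complex) \<Rightarrow> bool" where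
  "real_positive L u \<longleftrightarrow> (AE z in strip_measure L. u z \<in> \<real> \<and> 0 < Re (u z))"

definition function_of_x_alone :: "real \<Rightarrow> (real \<times> real \<Rightarrow> complex) \<Rightarrow> bool" where
  "function_of_x_alone L u \<longleftrightarrow> (\<exists>f. AE z in strip_measure L. u z = f (fst z))"

end

(*
  Suppose that a minimizer u on the strip of width L is a function f of x alone. Then f has mass m'
  on the line.  Put q = (p + 1) / 2 and compare u with w(x,y) = sqrt 3 (y / L) f(x): the weight
  3 y^2 / L^2 has mean 1, so w has the same mass, the same trace term and the same x-derivative
  term as u, while the integral of |u|^(p+1) gets multiplied by 3^q / (2q + 1) > 1 and the
  y-derivative costs only 3 m' / (2 L). Hence L^2 times the integral of |f|^(p+1) is bounded.

  That integral is bounded below independently of L. With k = -gamma / 2, the sharp trace inequality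
  k |f(0)|^2 <= (k^2 / 2) |f|^2 + (1/2) |f'|^2 bounds the quadratic part of the energy per unit
  length below by -k^2 m' / 2, and exp (-k |x|) attains this bound. Comparing u with the multiple
  of exp (-k |x|) of mass m' shows that the integral of |f|^(p+1) is at least the corresponding
  integral for that multiple.
*)
theory Submission
  imports Defs "HOL-Computational_Algebra.Polynomial"
begin


section \<open>Square-integrable functions\<close>

text \<open>The comparison is short; the obstacle is to compute with \<open>weak_partial\<close> and
  \<open>trace0\<close>, which are picked by \<open>SOME\<close>. Weak derivatives and traces must
  be unique almost everywhere before explicit ones can be substituted, and a Sobolev function that
  happens to depend on x alone must be given a continuous profile with square-integrable derivative
  before f(0) has a meaning. After that, u and both competitors are products f(x) b(y) with b
  smooth, and their energies factor through norms in one variable. The trace inequality must be used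
  with its sharp constant. The exponential and u are compared at the level of the quadratic energy
  per unit length; only when these bounds agree exactly does the comparison isolate the nonlinear
  terms. Any loss would leave a term of the same order in L as those terms. The linear weight works
  for large L because its y-derivative costs a total of order 1 / L, while the nonlinear gain grows
  like L.\<close>

abbreviation strip_L2 :: "real \<Rightarrow> (real \<times> real \<Rightarrow> complex) set" where
  "strip_L2 L \<equiv> L2_space (strip_measure L)"

abbreviation strip_norm :: "real \<Rightarrow> (real \<times> real \<Rightarrow> complex) \<Rightarrow> real" where
  "strip_norm L \<equiv> L2_norm (strip_measure L)"

abbreviation line_L2 :: "(real \<Rightarrow> complex) set" where
  "line_L2 \<equiv> L2_space lborel"

abbreviation line_norm :: "(real \<Rightarrow> complex) \<Rightarrow> real" where
  "line_norm \<equiv> L2_norm lborel"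

lemma L2_spaceI:
  assumes "u \<in> borel_measurable M" "integrable M (\<lambda>z. (cmod (u z))\<^sup>2)"
  shows "u \<in> L2_space M"
  using assms by (simp add: L2_space_def)

lemma L2_spaceD:
  assumes "u \<in> L2_space M"
  shows "u \<in> borel_measurable M" "integrable M (\<lambda>z. (cmod (u z))\<^sup>2)"
  using assms by (simp_all add: L2_space_def)

lemma L2_norm_nonneg [simp]: "0 \<le> L2_norm M u"
  by (simp add: L2_norm_def)

lemma L2_norm_power2: "(L2_norm M u)\<^sup>2 = (\<integral>z. (cmod (u z))\<^sup>2 \<partial>M)"
  by (simp add: L2_norm_def)

lemma L2_norm_eqI:
  assumes "AE z in M. cmod (u z) = cmod (v z)" "u \<in> borel_measurable M" "v \<in> borel_measurable M"
  shows "L2_norm M u = L2_norm M v"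
proof -
  have "(\<integral>z. (cmod (u z))\<^sup>2 \<partial>M) = (\<integral>z. (cmod (v z))\<^sup>2 \<partial>M)"
    by (rule integral_cong_AE) (use assms in auto)
  then show ?thesis by (simp add: L2_norm_def)
qed

lemma L2_norm_diff_commute: "L2_norm M (\<lambda>z. u z - v z) = L2_norm M (\<lambda>z. v z - u z)"
  by (simp add: L2_norm_def norm_minus_commute)

lemma L2_space_bound:
  assumes v: "v \<in> L2_space M" and u: "u \<in> borel_measurable M"
    and le: "AE z in M. cmod (u z) \<le> C * cmod (v z)"
  shows "u \<in> L2_space M"
proof (rule L2_spaceI)
  show "integrable M (\<lambda>z. (cmod (u z))\<^sup>2)"
  proof (rule Bochner_Integration.integrable_bound)
    show "integrable M (\<lambda>z. C\<^sup>2 * (cmod (v z))\<^sup>2)" using L2_spaceD[OF v] by simp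
    show "AE z in M. norm ((cmod (u z))\<^sup>2) \<le> norm (C\<^sup>2 * (cmod (v z))\<^sup>2)"
      using le
    proof eventually_elim
      case (elim z)
      then have "(cmod (u z))\<^sup>2 \<le> (C * cmod (v z))\<^sup>2" by (intro power_mono) auto
      then show ?case by (simp add: power_mult_distrib)
    qed
  qed (use u in measurable)
qed (fact u)

lemma L2_norm_bound:
  assumes v: "v \<in> L2_space M" and u: "u \<in> borel_measurable M" and "0 \<le> C"
    and le: "AE z in M. cmod (u z) \<le> C * cmod (v z)"
  shows "L2_norm M u \<le> C * L2_norm M v"
proof -
  have "(\<integral>z. (cmod (u z))\<^sup>2 \<partial>M) \<le> (\<integral>z. C\<^sup>2 * (cmod (v z))\<^sup>2 \<partial>M)"
  proof (rule integral_mono_AE)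
    show "integrable M (\<lambda>z. (cmod (u z))\<^sup>2)" using L2_space_bound[OF v u le] by (rule L2_spaceD)
    show "integrable M (\<lambda>z. C\<^sup>2 * (cmod (v z))\<^sup>2)" using L2_spaceD[OF v] by simp
    show "AE z in M. (cmod (u z))\<^sup>2 \<le> C\<^sup>2 * (cmod (v z))\<^sup>2"
      using le
    proof eventually_elim
      case (elim z)
      then have "(cmod (u z))\<^sup>2 \<le> (C * cmod (v z))\<^sup>2" by (intro power_mono) auto
      then show ?case by (simp add: power_mult_distrib)
    qed
  qed
  then have "(L2_norm M u)\<^sup>2 \<le> (C * L2_norm M v)\<^sup>2"
    by (simp add: L2_norm_power2 power_mult_distrib)
  then show ?thesis using \<open>0 \<le> C\<close> by (auto intro: power2_le_imp_le)
qed

lemma L2_space_cmult: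
  assumes "v \<in> L2_space M"
  shows "(\<lambda>z. c * v z) \<in> L2_space M"
  by (rule L2_space_bound[OF assms, where C = "cmod c"])
     (use L2_spaceD[OF assms] in \<open>auto simp: norm_mult\<close>)

lemma L2_norm_cmult: "L2_norm M (\<lambda>z. c * v z) = cmod c * L2_norm M v"
  by (simp add: L2_norm_def norm_mult power_mult_distrib real_sqrt_mult)

lemma L2_space_zero [simp]: "(\<lambda>z. 0) \<in> L2_space M"
  by (simp add: L2_space_def)

lemma L2_norm_zero [simp]: "L2_norm M (\<lambda>z. 0) = 0"
  by (simp add: L2_norm_def)

lemma norm_add_power2_le: "(cmod (a + b))\<^sup>2 \<le> 2 * (cmod a)\<^sup>2 + 2 * (cmod b)\<^sup>2"
proof -
  have "(cmod (a + b))\<^sup>2 \<le> (cmod a + cmod b)\<^sup>2" by (intro power_mono norm_triangle_ineq) auto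
  also have "\<dots> \<le> 2 * (cmod a)\<^sup>2 + 2 * (cmod b)\<^sup>2"
    using sum_squares_bound[of "cmod a" "cmod b"] by (simp add: power2_sum)
  finally show ?thesis .
qed

lemma L2_space_add:
  assumes u: "u \<in> L2_space M" and v: "v \<in> L2_space M"
  shows "(\<lambda>z. u z + v z) \<in> L2_space M"
proof (rule L2_spaceI)
  note [measurable] = L2_spaceD(1)[OF u] L2_spaceD(1)[OF v]
  show "(\<lambda>z. u z + v z) \<in> borel_measurable M" by measurable
  show "integrable M (\<lambda>z. (cmod (u z + v z))\<^sup>2)"
  proof (rule Bochner_Integration.integrable_bound)
    show "integrable M (\<lambda>z. 2 * (cmod (u z))\<^sup>2 + 2 * (cmod (v z))\<^sup>2)"
      using L2_spaceD(2)[OF u] L2_spaceD(2)[OF v] by simp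
    show "AE z in M. norm ((cmod (u z + v z))\<^sup>2) \<le> norm (2 * (cmod (u z))\<^sup>2 + 2 * (cmod (v z))\<^sup>2)"
      using norm_add_power2_le by auto
  qed measurable
qed

lemma L2_space_diff:
  assumes u: "u \<in> L2_space M" and v: "v \<in> L2_space M"
  shows "(\<lambda>z. u z - v z) \<in> L2_space M"
  using L2_space_add[OF u L2_space_cmult[OF v, of "-1"]] by simp

text \<open>Young's inequality, from the square of \<open>s * a - b\<close>. The weight
  \<open>s\<close> stays free: it is balanced in the proof of the Cauchy-Schwarz inequality and
  becomes the parameter of the trace inequality.\<close>

lemma weighted_arith_geo_le: "a * b \<le> s / 2 * a\<^sup>2 + 1 / (2 * s) * b\<^sup>2" if "0 < s" for a b s :: real
proof -
  have "0 \<le> (s * a - b)\<^sup>2" by simp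
  then have "2 * s * (a * b) \<le> s\<^sup>2 * a\<^sup>2 + b\<^sup>2" by (simp add: power2_diff power_mult_distrib algebra_simps)
  then show ?thesis using that by (simp add: field_simps power2_eq_square)
qed

lemma L2_mult_integrable:
  assumes u: "u \<in> L2_space M" and v: "v \<in> L2_space M"
  shows "integrable M (\<lambda>z. u z * v z)" "integrable M (\<lambda>z. cmod (u z) * cmod (v z))"
proof -
  note [measurable] = L2_spaceD(1)[OF u] L2_spaceD(1)[OF v]
  have *: "cmod a * cmod b \<le> (cmod a)\<^sup>2 + (cmod b)\<^sup>2" for a b
    using weighted_arith_geo_le[of 1 "cmod a" "cmod b"] mult_nonneg_nonneg[of "cmod a" "cmod b"]
    by (simp add: field_simps del: mult_nonneg_nonneg)
  have i: "integrable M (\<lambda>z. (cmod (u z))\<^sup>2 + (cmod (v z))\<^sup>2)"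
    using L2_spaceD(2)[OF u] L2_spaceD(2)[OF v] by simp
  show "integrable M (\<lambda>z. u z * v z)"
    by (rule Bochner_Integration.integrable_bound[OF i]) (use * in \<open>auto simp: norm_mult\<close>)
  show "integrable M (\<lambda>z. cmod (u z) * cmod (v z))"
    by (rule Bochner_Integration.integrable_bound[OF i]) (use * in \<open>auto simp: norm_mult\<close>)
qed

lemma L2_norm_eq_0_iff:
  assumes "u \<in> L2_space M"
  shows "L2_norm M u = 0 \<longleftrightarrow> (AE z in M. u z = 0)"
proof -
  have "L2_norm M u = 0 \<longleftrightarrow> (\<integral>z. (cmod (u z))\<^sup>2 \<partial>M) = 0" by (simp add: L2_norm_def)
  also have "\<dots> \<longleftrightarrow> (AE z in M. (cmod (u z))\<^sup>2 = 0)"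
    by (rule integral_nonneg_eq_0_iff_AE) (use L2_spaceD[OF assms] in auto)
  finally show ?thesis by simp
qed

text \<open>If a norm vanishes, the product vanishes almost everywhere. Otherwise Young's inequality
  is used with the ratio \<open>b / a\<close> of the norms as weight, which makes each of its two
  terms equal to half of \<open>a * b\<close>.\<close>

lemma Cauchy_Schwarz_L2:
  assumes u: "u \<in> L2_space M" and v: "v \<in> L2_space M"
  shows "(\<integral>z. cmod (u z) * cmod (v z) \<partial>M) \<le> L2_norm M u * L2_norm M v"
proof (cases "L2_norm M u = 0 \<or> L2_norm M v = 0")
  case True
  then have "AE z in M. cmod (u z) * cmod (v z) = 0"
    using L2_norm_eq_0_iff[OF u] L2_norm_eq_0_iff[OF v] by auto
  then have "(\<integral>z. cmod (u z) * cmod (v z) \<partial>M) = 0"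
    by (rule integral_eq_zero_AE)
  then show ?thesis by simp
next
  case False
  define a b where "a = L2_norm M u" and "b = L2_norm M v"
  have ab: "0 < a" "0 < b" using False by (auto simp: a_def b_def less_le)
  have "(\<integral>z. cmod (u z) * cmod (v z) \<partial>M)
      \<le> (\<integral>z. (b / a) / 2 * (cmod (u z))\<^sup>2 + 1 / (2 * (b / a)) * (cmod (v z))\<^sup>2 \<partial>M)"
    using L2_mult_integrable(2)[OF u v] L2_spaceD(2)[OF u] L2_spaceD(2)[OF v] ab
    by (intro integral_mono weighted_arith_geo_le) auto
  also have "\<dots> = (b / a) / 2 * a\<^sup>2 + 1 / (2 * (b / a)) * b\<^sup>2"
    using L2_spaceD(2)[OF u] L2_spaceD(2)[OF v] by (simp add: a_def b_def L2_norm_power2)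
  also have "\<dots> = a * b" using ab by (simp add: field_simps power2_eq_square)
  finally show ?thesis by (simp add: a_def b_def)
qed

lemma norm_integral_mult_le:
  assumes u: "u \<in> L2_space M" and v: "v \<in> L2_space M"
  shows "cmod (\<integral>z. u z * v z \<partial>M) \<le> L2_norm M u * L2_norm M v"
proof -
  have "cmod (\<integral>z. u z * v z \<partial>M) \<le> (\<integral>z. cmod (u z * v z) \<partial>M)" by (rule integral_norm_bound)
  also have "\<dots> \<le> L2_norm M u * L2_norm M v"
    using Cauchy_Schwarz_L2[OF u v] by (simp add: norm_mult)
  finally show ?thesis .
qed

lemma L2_norm_triangle:
  assumes u: "u \<in> L2_space M" and v: "v \<in> L2_space M"
  shows "L2_norm M (\<lambda>z. u z + v z) \<le> L2_norm M u + L2_norm M v"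
proof -
  have "(\<integral>z. (cmod (u z + v z))\<^sup>2 \<partial>M)
      \<le> (\<integral>z. (cmod (u z))\<^sup>2 + 2 * (cmod (u z) * cmod (v z)) + (cmod (v z))\<^sup>2 \<partial>M)"
  proof (rule integral_mono)
    show "(cmod (u z + v z))\<^sup>2 \<le> (cmod (u z))\<^sup>2 + 2 * (cmod (u z) * cmod (v z)) + (cmod (v z))\<^sup>2" for z
    proof -
      have "(cmod (u z + v z))\<^sup>2 \<le> (cmod (u z) + cmod (v z))\<^sup>2"
        by (intro power_mono norm_triangle_ineq) auto
      then show ?thesis by (simp add: power2_sum)
    qed
  qed (use L2_spaceD(2)[OF L2_space_add[OF u v]] L2_spaceD(2)[OF u] L2_spaceD(2)[OF v]
         L2_mult_integrable(2)[OF u v] in auto)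
  also have "\<dots> = (L2_norm M u)\<^sup>2 + 2 * (\<integral>z. cmod (u z) * cmod (v z) \<partial>M) + (L2_norm M v)\<^sup>2"
    using L2_spaceD(2)[OF u] L2_spaceD(2)[OF v] L2_mult_integrable(2)[OF u v]
    by (simp add: L2_norm_power2)
  also have "\<dots> \<le> (L2_norm M u + L2_norm M v)\<^sup>2"
    using Cauchy_Schwarz_L2[OF u v] by (simp add: power2_sum)
  finally have "(L2_norm M (\<lambda>z. u z + v z))\<^sup>2 \<le> (L2_norm M u + L2_norm M v)\<^sup>2"
    by (simp add: L2_norm_power2)
  then show ?thesis by (rule power2_le_imp_le) simp
qed

lemma L2_norm_triangle_diff:
  assumes "u \<in> L2_space M" "v \<in> L2_space M" "w \<in> L2_space M"
  shows "L2_norm M (\<lambda>z. u z - w z) \<le> L2_norm M (\<lambda>z. u z - v z) + L2_norm M (\<lambda>z. v z - w z)"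
  using L2_norm_triangle[OF L2_space_diff[OF assms(1,2)] L2_space_diff[OF assms(2,3)]] by simp

lemma L2_norm_diff_ge:
  assumes u: "u \<in> L2_space M" and v: "v \<in> L2_space M"
  shows "\<bar>L2_norm M u - L2_norm M v\<bar> \<le> L2_norm M (\<lambda>z. u z - v z)"
  using L2_norm_triangle_diff[OF u v L2_space_zero] L2_norm_triangle_diff[OF v u L2_space_zero]
    L2_norm_diff_commute[of M u v] by simp

lemma L2_norm_tendsto:
  assumes "\<And>n. u n \<in> L2_space M" "v \<in> L2_space M" "(\<lambda>n. L2_norm M (\<lambda>z. u n z - v z)) \<longlonglongrightarrow> 0"
  shows "(\<lambda>n. L2_norm M (u n)) \<longlonglongrightarrow> L2_norm M v"
proof -
  have "(\<lambda>n. L2_norm M (u n) - L2_norm M v) \<longlonglongrightarrow> 0"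
    by (rule Lim_null_comparison[OF _ assms(3)]) (use L2_norm_diff_ge[OF assms(1,2)] in auto)
  then show ?thesis by (simp add: LIM_zero_iff)
qed

text \<open>Pairing with a fixed \<open>w\<close> is continuous in the norm by the Cauchy-Schwarz
  inequality. This carries integral identities from smooth approximants to their limits.\<close>

lemma L2_integral_tendsto:
  assumes "\<And>n. u n \<in> L2_space M" "v \<in> L2_space M" "w \<in> L2_space M"
    and lim: "(\<lambda>n. L2_norm M (\<lambda>z. u n z - v z)) \<longlonglongrightarrow> 0"
  shows "(\<lambda>n. \<integral>z. u n z * w z \<partial>M) \<longlonglongrightarrow> (\<integral>z. v z * w z \<partial>M)"
proof -
  have "(\<lambda>n. (\<integral>z. u n z * w z \<partial>M) - (\<integral>z. v z * w z \<partial>M)) \<longlonglongrightarrow> 0"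
  proof (rule Lim_null_comparison)
    show "\<forall>\<^sub>F n in sequentially. norm ((\<integral>z. u n z * w z \<partial>M) - (\<integral>z. v z * w z \<partial>M))
        \<le> L2_norm M (\<lambda>z. u n z - v z) * L2_norm M w"
    proof (rule always_eventually, rule allI)
      fix n
      have "(\<integral>z. u n z * w z \<partial>M) - (\<integral>z. v z * w z \<partial>M) = (\<integral>z. (u n z - v z) * w z \<partial>M)"
        using L2_mult_integrable(1)[OF assms(1)[of n] assms(3)] L2_mult_integrable(1)[OF assms(2,3)]
        by (simp add: algebra_simps)
      then show "norm ((\<integral>z. u n z * w z \<partial>M) - (\<integral>z. v z * w z \<partial>M))
        \<le> L2_norm M (\<lambda>z. u n z - v z) * L2_norm M w"
        using norm_integral_mult_le[OF L2_space_diff[OF assms(1)[of n] assms(2)] assms(3)] by simp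
    qed
    show "(\<lambda>n. L2_norm M (\<lambda>z. u n z - v z) * L2_norm M w) \<longlonglongrightarrow> 0"
      using tendsto_mult_right[OF lim, of "L2_norm M w"] by simp
  qed
  then show ?thesis by (simp add: LIM_zero_iff)
qed

lemma L2_space_cong_AE:
  assumes "u \<in> L2_space M" "AE z in M. u z = v z" "v \<in> borel_measurable M"
  shows "v \<in> L2_space M"
  by (rule L2_space_bound[OF assms(1,3), where C = 1]) (use assms(2) in auto)


section \<open>Smooth functions of one variable\<close>

text \<open>The derivative is existentially quantified, so closure properties follow by exhibiting
  one. Differentiability at every point of the line makes it unique.\<close>

primrec C_k_line :: "nat \<Rightarrow> (real \<Rightarrow> complex) \<Rightarrow> bool" where
  "C_k_line 0 f \<longleftrightarrow> continuous_on UNIV f"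
| "C_k_line (Suc k) f \<longleftrightarrow>
     (\<exists>f'. (\<forall>x. (f has_vector_derivative f' x) (at x)) \<and> C_k_line k f')"

definition smooth_line :: "(real \<Rightarrow> complex) \<Rightarrow> bool" where
  "smooth_line f \<longleftrightarrow> (\<forall>k. C_k_line k f)"

lemma C_k_line_Suc_imp: "C_k_line (Suc k) f \<Longrightarrow> C_k_line k f"
proof (induction k arbitrary: f)
  case 0
  then obtain f' where "\<forall>x. (f has_vector_derivative f' x) (at x)" by auto
  then have "continuous_on UNIV f"
    by (intro continuous_at_imp_continuous_on ballI has_vector_derivative_continuous) blast
  then show ?case by simp
next
  case (Suc k)
  then show ?case by (metis C_k_line.simps(2))
qed

lemma C_k_line_const: "C_k_line k (\<lambda>x. c)"
proof (induction k arbitrary: c)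
  case (Suc k)
  then show ?case by (auto intro!: exI[of _ "\<lambda>x. 0"])
qed simp

lemma C_k_line_add: "C_k_line k f \<Longrightarrow> C_k_line k g \<Longrightarrow> C_k_line k (\<lambda>x. f x + g x)"
proof (induction k arbitrary: f g)
  case 0
  then show ?case by (auto intro: continuous_intros)
next
  case (Suc k)
  then obtain f' g' where "\<forall>x. (f has_vector_derivative f' x) (at x)" "C_k_line k f'"
    "\<forall>x. (g has_vector_derivative g' x) (at x)" "C_k_line k g'" by auto
  then show ?case
    using Suc.IH by (auto intro!: exI[of _ "\<lambda>x. f' x + g' x"] has_vector_derivative_add)
qed

lemma C_k_line_mult: "C_k_line k f \<Longrightarrow> C_k_line k g \<Longrightarrow> C_k_line k (\<lambda>x. f x * g x)"
proof (induction k arbitrary: f g)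
  case 0
  then show ?case by (auto intro: continuous_intros)
next
  case (Suc k)
  then obtain f' g' where *: "\<forall>x. (f has_vector_derivative f' x) (at x)" "C_k_line k f'"
    "\<forall>x. (g has_vector_derivative g' x) (at x)" "C_k_line k g'" by auto
  have "C_k_line k f" "C_k_line k g" using Suc.prems by (auto dest: C_k_line_Suc_imp simp del: C_k_line.simps)
  then have "C_k_line k (\<lambda>x. f x * g' x + f' x * g x)"
    using Suc.IH * by (auto intro!: C_k_line_add)
  then show ?case
    using * by (auto intro!: exI[of _ "\<lambda>x. f x * g' x + f' x * g x"] has_vector_derivative_mult)
qed

lemma C_k_line_affine: "C_k_line k f \<Longrightarrow> C_k_line k (\<lambda>x. f (a * x + b))"
proof (induction k arbitrary: f)
  case 0
  then show ?case
    by (auto intro!: continuous_on_compose2[of UNIV f] continuous_intros)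
next
  case (Suc k)
  then obtain f' where *: "\<forall>x. (f has_vector_derivative f' x) (at x)" "C_k_line k f'" by auto
  have "C_k_line k (\<lambda>x. of_real a * f' (a * x + b))"
    using Suc.IH[OF *(2)] by (intro C_k_line_mult C_k_line_const)
  moreover have "((\<lambda>x. f (a * x + b)) has_vector_derivative (of_real a * f' (a * x + b))) (at x)" for x
  proof -
    have "((\<lambda>x. a * x + b) has_vector_derivative a) (at x)"
      by (auto intro!: derivative_eq_intros simp: has_real_derivative_iff_has_vector_derivative[symmetric])
    from vector_diff_chain_at[OF this, of f "f' (a * x + b)"] * show ?thesis
      by (simp add: o_def scaleR_conv_of_real)
  qed
  ultimately show ?case unfolding C_k_line.simps by (intro exI conjI allI)
qed

lemma smooth_line_const [intro]: "smooth_line (\<lambda>x. c)"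
  by (simp add: smooth_line_def C_k_line_const)

lemma smooth_line_add [intro]: "smooth_line f \<Longrightarrow> smooth_line g \<Longrightarrow> smooth_line (\<lambda>x. f x + g x)"
  by (simp add: smooth_line_def C_k_line_add)

lemma smooth_line_mult [intro]: "smooth_line f \<Longrightarrow> smooth_line g \<Longrightarrow> smooth_line (\<lambda>x. f x * g x)"
  by (simp add: smooth_line_def C_k_line_mult)

lemma smooth_line_diff [intro]: "smooth_line f \<Longrightarrow> smooth_line g \<Longrightarrow> smooth_line (\<lambda>x. f x - g x)"
  using smooth_line_add[OF _ smooth_line_mult[OF smooth_line_const[of "-1"]], of f g] by simp

lemma smooth_line_affine: "smooth_line f \<Longrightarrow> smooth_line (\<lambda>x. f (a * x + b))"
  by (simp add: smooth_line_def C_k_line_affine)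

lemma smooth_line_antiderivative:
  assumes "smooth_line f" "\<And>x. (F has_vector_derivative f x) (at x)"
  shows "smooth_line F"
  unfolding smooth_line_def
proof
  fix k
  have "C_k_line (Suc k) F" using assms by (auto simp: smooth_line_def)
  then show "C_k_line k F" by (rule C_k_line_Suc_imp)
qed

lemma smooth_line_has_derivative:
  assumes "smooth_line f"
  shows "(f has_vector_derivative (vector_derivative f (at x))) (at x)"
proof -
  have "C_k_line (Suc 0) f" using assms by (simp add: smooth_line_def del: C_k_line.simps)
  then show ?thesis using vector_derivative_works differentiableI_vector by fastforce
qed

lemma smooth_line_vector_derivative:
  assumes "smooth_line f"
  shows "smooth_line (\<lambda>x. vector_derivative f (at x))"
  unfolding smooth_line_def
proof
  fix k
  have "C_k_line (Suc k) f" using assms by (simp add: smooth_line_def del: C_k_line.simps)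
  then obtain f' where f': "\<forall>x. (f has_vector_derivative f' x) (at x)" "C_k_line k f'" by auto
  then have "(\<lambda>x. vector_derivative f (at x)) = f'" by (auto simp: vector_derivative_at)
  with f' show "C_k_line k (\<lambda>x. vector_derivative f (at x))" by simp
qed

lemma smooth_line_continuous: "smooth_line f \<Longrightarrow> continuous_on S f"
  using continuous_on_subset[of UNIV f S] by (auto simp: smooth_line_def dest: spec[of _ 0])

lemma smooth_line_polynomial:
  assumes "polynomial_function f"
  shows "smooth_line f"
proof -
  have "C_k_line k f" for k
    using assms
  proof (induction k arbitrary: f)
    case 0
    then show ?case by (simp add: continuous_on_polymonial_function)
  next
    case (Suc k)
    obtain f' where "polynomial_function f'" "\<And>x. (f has_vector_derivative f' x) (at x)"
      using has_vector_derivative_polynomial_function[OF Suc.prems] by metis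
    with Suc.IH[of f'] show ?case unfolding C_k_line.simps by (intro exI conjI allI)
  qed
  then show ?thesis by (simp add: smooth_line_def)
qed

section \<open>Flat functions and smooth bumps\<close>

lemma poly_exp_tendsto_0:
  fixes q :: "real poly"
  shows "((\<lambda>t. t ^ k * poly q t * exp (- t)) \<longlongrightarrow> 0) at_top"
proof (induction q arbitrary: k)
  case 0
  then show ?case by simp
next
  case (pCons a q)
  \<comment> \<open>The factor t of the higher coefficients moves into the power, which is why
    \<open>k\<close> stays arbitrary in the induction.\<close>
  have "((\<lambda>t. a * (t ^ k / exp t) + t ^ Suc k * poly q t * exp (- t)) \<longlongrightarrow> a * 0 + 0) at_top"
    by (intro tendsto_intros tendsto_power_div_exp_0 pCons.IH)
  then show ?case by (simp add: algebra_simps exp_minus divide_inverse)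
qed

text \<open>The functions q(1/x) exp (-1/x), extended by 0. Carrying a polynomial q makes the family
  closed under differentiation.\<close>

definition flat :: "real poly \<Rightarrow> real \<Rightarrow> complex" where
  "flat q x = (if 0 < x then of_real (poly q (1 / x) * exp (- (1 / x))) else 0)"

text \<open>With t = 1/x the chain rule turns q(t) exp (-t) into t^2 (q(t) - q'(t)) exp (-t), which
  explains the new polynomial. At 0 the exponential beats every polynomial.\<close>

lemma flat_has_derivative:
  "(flat q has_vector_derivative flat ([:0, 0, 1:] * (q - pderiv q)) x) (at x)"
proof -
  let ?r = "[:0, 0, 1:] * (q - pderiv q)"
  consider "x < 0" | "0 < x" | "x = 0" by linarith
  then show ?thesis
  proof cases
    case 1
    have "((\<lambda>x. 0) has_vector_derivative flat ?r x) (at x)" using 1 by (simp add: flat_def)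
    then show ?thesis
      by (rule has_vector_derivative_transform_within_open[where S = "{..<0}"]) (use 1 in \<open>auto simp: flat_def\<close>)
  next
    case 2
    have "((\<lambda>x. poly q (1 / x) * exp (- (1 / x))) has_real_derivative
        poly ?r (1 / x) * exp (- (1 / x))) (at x)"
      using 2 by (auto intro!: derivative_eq_intros simp: field_simps power2_eq_square)
    then have "((\<lambda>x. of_real (poly q (1 / x) * exp (- (1 / x)))) has_vector_derivative
        of_real (poly ?r (1 / x) * exp (- (1 / x)))) (at x)"
      by (intro has_vector_derivative_of_real)
        (auto simp: has_real_derivative_iff_has_vector_derivative)
    then have "((\<lambda>x. of_real (poly q (1 / x) * exp (- (1 / x)))) has_vector_derivative flat ?r x) (at x)"
      using 2 unfolding flat_def by (simp only: if_True)
    then show ?thesis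
      by (rule has_vector_derivative_transform_within_open[where S = "{0<..}"]) (use 2 in \<open>auto simp: flat_def\<close>)
  next
    case 3
    \<comment> \<open>The right difference quotient at 0 is t q(t) exp (-t) for t = 1/h, so the
      limit at infinity applies with power 1.\<close>
    have right_real: "((\<lambda>h. (1 / h) * poly q (1 / h) * exp (- (1 / h))) \<longlongrightarrow> 0) (at_right (0::real))"
      using filterlim_compose[OF poly_exp_tendsto_0[of 1 q] filterlim_inverse_at_top_right]
      by (simp add: inverse_eq_divide)
    then have right: "((\<lambda>h. complex_of_real ((1 / h) * poly q (1 / h) * exp (- (1 / h)))) \<longlongrightarrow> 0) (at_right (0::real))"
      using tendsto_of_real[OF right_real, where 'a = complex] by (simp only: of_real_0)
    have r: "((\<lambda>h. flat q h /\<^sub>R h) \<longlongrightarrow> 0) (at_right 0)"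
      by (rule Lim_transform_eventually[OF right])
         (auto simp: eventually_at_filter flat_def scaleR_conv_of_real divide_inverse)
    have l: "((\<lambda>h. flat q h /\<^sub>R h) \<longlongrightarrow> 0) (at_left 0)"
      by (rule Lim_transform_eventually[OF tendsto_const])
         (auto simp: eventually_at_filter flat_def)
    have "((\<lambda>h. flat q h /\<^sub>R h) \<longlongrightarrow> 0) (at 0)"
      using filterlim_split_at[OF l r] .
    from tendsto_norm[OF this] have "(flat q has_vector_derivative 0) (at 0)"
      by (simp add: has_vector_derivative_def has_derivative_iff_norm flat_def divide_inverse mult.commute)
    then show ?thesis using 3 by (simp add: flat_def)
  qed
qed

lemma smooth_line_flat: "smooth_line (flat q)"
proof -
  have "C_k_line k (flat q)" for k
  proof (induction k arbitrary: q)
    case 0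
    have "continuous_on UNIV (flat q)"
      by (intro continuous_at_imp_continuous_on ballI has_vector_derivative_continuous[OF flat_has_derivative])
    then show ?case by simp
  next
    case (Suc k)
    then show ?case unfolding C_k_line.simps using flat_has_derivative by blast
  qed
  then show ?thesis by (simp add: smooth_line_def)
qed

text \<open>Two one-sided flat factors. Nonvanishing on the whole open interval matters: a product
  with a bump can vanish there only where the other factor does.\<close>

definition bump :: "real \<Rightarrow> real \<Rightarrow> real \<Rightarrow> complex" where
  "bump a b x = flat 1 (x - a) * flat 1 (b - x)"

lemma smooth_line_bump [intro]: "smooth_line (bump a b)"
  using smooth_line_mult[OF smooth_line_affine[of "flat 1" 1 "-a"] smooth_line_affine[of "flat 1" "-1" b]]
  by (simp add: bump_def[abs_def] smooth_line_flat algebra_simps)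

lemma bump_eq_0: "x \<notin> {a<..<b} \<Longrightarrow> bump a b x = 0"
  by (auto simp: bump_def flat_def)

lemma Re_bump_pos: "x \<in> {a<..<b} \<Longrightarrow> 0 < Re (bump a b x)"
  by (auto simp: bump_def flat_def)

lemma bump_nonzero: "x \<in> {a<..<b} \<Longrightarrow> bump a b x \<noteq> 0"
  using Re_bump_pos[of x a b] by auto


section \<open>Smooth functions and test functions on the plane\<close>

lemma smooth_line_antiderivative_exists:
  assumes "smooth_line p"
  shows "\<exists>P. smooth_line P \<and> (\<forall>x. (P has_vector_derivative p x) (at x)) \<and> P a = c"
proof -
  have "\<exists>F. \<forall>x::real. -\<infinity> < ereal x \<longrightarrow> ereal x < \<infinity> \<longrightarrow> (F has_vector_derivative p x) (at x)"
    using smooth_line_continuous[OF assms, of UNIV]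
    by (intro einterval_antiderivative) (auto simp: continuous_on_eq_continuous_at)
  then obtain F where F: "\<And>x. (F has_vector_derivative p x) (at x)" by auto
  define P where "P x = F x + (c - F a)" for x
  have P: "(P has_vector_derivative p x) (at x)" for x
    unfolding P_def using has_vector_derivative_add[OF F[of x] has_vector_derivative_const] by simp
  with smooth_line_antiderivative[OF assms P] show ?thesis by (auto simp: P_def)
qed

lemma FTC_smooth_line:
  assumes "smooth_line p" "\<And>x. (P has_vector_derivative p x) (at x)" "a \<le> b"
  shows "P b - P a = (LINT x:{a..b}|lborel. p x)"
  unfolding set_lebesgue_integral_def
  by (rule integral_FTC_Icc[symmetric, OF assms(3)])
     (use assms in \<open>auto intro: has_vector_derivative_at_within smooth_line_continuous\<close>)

lemma integral_compact_support_eq_0: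
  assumes "smooth_line p" "\<And>x. (P has_vector_derivative p x) (at x)"
    and "\<And>x. x \<notin> {a..b} \<Longrightarrow> P x = 0" "\<And>x. x \<notin> {a..b} \<Longrightarrow> p x = 0"
  shows "integrable lborel p" "(\<integral>x. p x \<partial>lborel) = 0"
proof -
  \<comment> \<open>The hypotheses say nothing about \<open>P\<close> at \<open>a\<close> and
    \<open>b\<close> themselves, so the endpoints are moved outside. The maximum also covers an
    empty interval \<open>{a..b}\<close>.\<close>
  have 1: "p x = indicator {a - 1..max a b + 1} x *\<^sub>R p x" for x using assms(4)[of x] by (auto simp: indicator_def max_def split: if_splits)
  have "set_integrable lborel {a - 1..max a b + 1} p"
    by (intro borel_integrable_atLeastAtMost' smooth_line_continuous assms(1))
  then show "integrable lborel p"
    unfolding set_integrable_def using 1 by simp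
  have "(LINT x:{a - 1..max a b + 1}|lborel. p x) = 0"
    using FTC_smooth_line[OF assms(1,2), of "a - 1" "max a b + 1"] assms(3)[of "a - 1"] assms(3)[of "max a b + 1"]
    by (simp add: max_def split: if_splits)
  then show "(\<integral>x. p x \<partial>lborel) = 0"
    unfolding set_lebesgue_integral_def using 1 by simp
qed

text \<open>A primitive of the bump has strictly increasing real part, so its values at the two
  endpoints differ.\<close>

lemma bump_integral_nonzero:
  assumes "a < b"
  shows "(LINT x:{a..b}|lborel. bump a b x) \<noteq> 0"
proof -
  obtain B where B: "smooth_line B" "\<And>x. (B has_vector_derivative bump a b x) (at x)"
    using smooth_line_antiderivative_exists[of "bump a b" 1 0] by blast
  have "Re (B a) < Re (B b)"
  proof (rule DERIV_pos_imp_increasing_open[where f = "\<lambda>x. Re (B x)", OF assms])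
    fix x :: real assume "a < x" "x < b"
    then have "((\<lambda>x. Re (B x)) has_real_derivative Re (bump a b x)) (at x)" "0 < Re (bump a b x)"
      using has_field_derivative_Re[OF B(2)[of x]] Re_bump_pos[of x a b] by auto
    then show "\<exists>y. ((\<lambda>x. Re (B x)) has_real_derivative y) (at x) \<and> 0 < y" by blast
  next
    show "continuous_on {a..b} (\<lambda>x. Re (B x))"
      by (intro continuous_intros smooth_line_continuous B)
  qed
  then show ?thesis
    using FTC_smooth_line[OF smooth_line_bump B(2), of a b] assms by auto
qed

lemma cutoff_exists:
  "\<exists>\<eta>. smooth_line \<eta> \<and> (\<forall>x\<in>{-1..1}. \<eta> x = 1) \<and> (\<forall>x. x \<notin> {-2<..<2} \<longrightarrow> \<eta> x = 0)"
proof -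
  let ?p = "bump 1 2"
  obtain B where B: "smooth_line B" "\<And>x. (B has_vector_derivative ?p x) (at x)" "B 1 = 0"
    using smooth_line_antiderivative_exists[of ?p 1 0] by blast
  have flat: "B x = B y" if "x \<le> y" "{x..y} \<inter> {1<..<2} = {}" for x y
  proof -
    have "(LINT t:{x..y}|lborel. ?p t) = (LINT t:{x..y}|lborel. 0)"
      using that(2) by (intro set_lebesgue_integral_cong) (auto intro!: bump_eq_0)
    then have "(LINT t:{x..y}|lborel. ?p t) = 0" by simp
    then show ?thesis using FTC_smooth_line[OF smooth_line_bump B(2) that(1)] by simp
  qed
  have B0: "B x = 0" if "x \<le> 1" for x
  proof -
    have "{x..1} \<inter> {1<..<2} = {}" by auto
    then show ?thesis using flat[OF that] B(3) by simp
  qed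
  have B2: "B x = B 2" if "2 \<le> x" for x
  proof -
    have "{2..x} \<inter> {1<..<2} = {}" by auto
    then show ?thesis using flat[OF that] by simp
  qed
  have A: "B 2 \<noteq> 0"
    using FTC_smooth_line[OF smooth_line_bump B(2), of 1 2] bump_integral_nonzero[of 1 2] B(3) by simp
  \<comment> \<open>\<open>B\<close> is a smooth step: 0 before 1 and constantly \<open>B 2\<close>
    after 2. Subtracting the normalised step and its reflection from 1 leaves the plateau. The
    trivial coefficients match the shape of \<open>smooth_line_affine\<close>.\<close>
  define \<eta> where "\<eta> x = 1 - (B (1 * x + 0) + B ((-1) * x + 0)) * inverse (B 2)" for x
  have "smooth_line \<eta>"
    unfolding \<eta>_def using smooth_line_affine[OF B(1)]
    by (intro smooth_line_diff smooth_line_mult smooth_line_add smooth_line_const)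
  moreover have "\<forall>x\<in>{-1..1}. \<eta> x = 1" by (auto simp: \<eta>_def B0)
  moreover have "\<eta> x = 0" if "x \<notin> {-2<..<2}" for x
  proof -
    have "2 \<le> x \<or> 2 \<le> - x" using that by auto
    then show ?thesis using A B2[of x] B0[of x] B2[of "-x"] B0[of "-x"] by (auto simp: \<eta>_def)
  qed
  ultimately show ?thesis by blast
qed

section \<open>Calculus of smooth functions of two variables\<close>

definition smooth :: "(real \<times> real \<Rightarrow> complex) \<Rightarrow> bool" where
  "smooth \<phi> \<longleftrightarrow> (\<forall>k. C_k k \<phi>)"

lemma partialI: "(f has_derivative D) (at z) \<Longrightarrow> partial e f z = D e"
  unfolding partial_def using frechet_derivative_at by metis

lemma C_k_Suc_imp: "C_k (Suc k) f \<Longrightarrow> C_k k f"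
proof (induction k arbitrary: f)
  case 0
  then show ?case
    by (auto intro!: continuous_at_imp_continuous_on differentiable_imp_continuous_within)
next
  case (Suc k)
  then show ?case by (metis C_k.simps(2))
qed

lemma C_k_const: "C_k k (\<lambda>z. c)"
proof (induction k arbitrary: c)
  case (Suc k)
  have "partial e (\<lambda>z. c) = (\<lambda>z. 0)" for e
    by (auto intro!: partialI)
  then show ?case using Suc by simp
qed simp

lemma partial_add:
  "f differentiable (at z) \<Longrightarrow> g differentiable (at z) \<Longrightarrow>
    partial e (\<lambda>z. f z + g z) z = partial e f z + partial e g z"
  using partialI[OF has_derivative_add[of f "frechet_derivative f (at z)" "at z" g "frechet_derivative g (at z)"]]
  by (simp add: frechet_derivative_works partial_def)

lemma partial_mult:
  fixes f g :: "real \<times> real \<Rightarrow> complex"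
  shows "f differentiable (at z) \<Longrightarrow> g differentiable (at z) \<Longrightarrow>
    partial e (\<lambda>z. f z * g z) z = f z * partial e g z + partial e f z * g z"
  using partialI[OF has_derivative_mult[of f "frechet_derivative f (at z)" z UNIV g "frechet_derivative g (at z)"]]
  by (simp add: frechet_derivative_works partial_def)

lemma C_k_add: "C_k k f \<Longrightarrow> C_k k g \<Longrightarrow> C_k k (\<lambda>z. f z + g z)"
proof (induction k arbitrary: f g)
  case 0
  then show ?case by (auto intro: continuous_intros)
next
  case (Suc k)
  then have "partial e (\<lambda>z. f z + g z) = (\<lambda>z. partial e f z + partial e g z)" for e
    by (auto intro!: partial_add)
  then show ?case using Suc by (auto intro: differentiable_add)
qed

lemma C_k_mult: "C_k k f \<Longrightarrow> C_k k g \<Longrightarrow> C_k k (\<lambda>z. f z * g z)"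
proof (induction k arbitrary: f g)
  case 0
  then show ?case by (auto intro: continuous_intros)
next
  case (Suc k)
  have "partial e (\<lambda>z. f z * g z) = (\<lambda>z. f z * partial e g z + partial e f z * g z)" for e
    using Suc.prems by (auto intro!: partial_mult)
  moreover have "C_k k f" "C_k k g" using Suc.prems by (auto dest: C_k_Suc_imp simp del: C_k.simps)
  ultimately show ?case using Suc by (auto intro!: differentiable_mult C_k_add)
qed

lemma smooth_const [intro]: "smooth (\<lambda>z. c)"
  by (simp add: smooth_def C_k_const)

lemma smooth_add [intro]: "smooth f \<Longrightarrow> smooth g \<Longrightarrow> smooth (\<lambda>z. f z + g z)"
  by (simp add: smooth_def C_k_add)

lemma smooth_mult [intro]: "smooth f \<Longrightarrow> smooth g \<Longrightarrow> smooth (\<lambda>z. f z * g z)"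
  by (simp add: smooth_def C_k_mult)

lemma smooth_diff [intro]: "smooth f \<Longrightarrow> smooth g \<Longrightarrow> smooth (\<lambda>z. f z - g z)"
  using smooth_add[OF _ smooth_mult[OF smooth_const[of "-1"]], of f g] by simp

lemma smooth_differentiable: "smooth f \<Longrightarrow> f differentiable (at z)"
  unfolding smooth_def using C_k.simps(2)[of 0 f] by blast

lemma smooth_continuous: "smooth f \<Longrightarrow> continuous_on S f"
  using continuous_on_subset[of UNIV f S] by (auto simp: smooth_def dest: spec[of _ 0])

lemma smooth_partial: "smooth f \<Longrightarrow> e \<in> {(1, 0), (0, 1)} \<Longrightarrow> smooth (partial e f)"
  unfolding smooth_def by (metis C_k.simps(2) empty_iff insertE)

lemma has_derivative_fst_line:
  assumes "(f has_vector_derivative f') (at (fst z))"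
  shows "((\<lambda>z. f (fst z)) has_derivative (\<lambda>h. fst h *\<^sub>R f')) (at z)"
  using has_derivative_compose[of fst fst z UNIV f "\<lambda>h. h *\<^sub>R f'"] assms
  by (simp add: has_vector_derivative_def has_derivative_fst)

lemma has_derivative_snd_line:
  assumes "(f has_vector_derivative f') (at (snd z))"
  shows "((\<lambda>z. f (snd z)) has_derivative (\<lambda>h. snd h *\<^sub>R f')) (at z)"
  using has_derivative_compose[of snd snd z UNIV f "\<lambda>h. h *\<^sub>R f'"] assms
  by (simp add: has_vector_derivative_def has_derivative_snd)

lemma C_k_fst_line: "C_k_line k f \<Longrightarrow> C_k k (\<lambda>z. f (fst z))"
proof (induction k arbitrary: f)
  case 0
  then show ?case by (auto intro!: continuous_on_compose2[of UNIV f] continuous_intros)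
next
  case (Suc k)
  then obtain f' where f': "\<And>x. (f has_vector_derivative f' x) (at x)" "C_k_line k f'" by auto
  have "partial (1, 0) (\<lambda>z. f (fst z)) = (\<lambda>z. f' (fst z))" "partial (0, 1) (\<lambda>z. f (fst z)) = (\<lambda>z. 0)"
    using partialI[OF has_derivative_fst_line[OF f'(1)]] by auto
  then show ?case
    using has_derivative_fst_line[OF f'(1)] Suc.IH[OF f'(2)] by (auto simp: C_k_const differentiable_def)
qed

lemma C_k_snd_line: "C_k_line k f \<Longrightarrow> C_k k (\<lambda>z. f (snd z))"
proof (induction k arbitrary: f)
  case 0
  then show ?case by (auto intro!: continuous_on_compose2[of UNIV f] continuous_intros)
next
  case (Suc k)
  then obtain f' where f': "\<And>x. (f has_vector_derivative f' x) (at x)" "C_k_line k f'" by auto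
  have "partial (0, 1) (\<lambda>z. f (snd z)) = (\<lambda>z. f' (snd z))" "partial (1, 0) (\<lambda>z. f (snd z)) = (\<lambda>z. 0)"
    using partialI[OF has_derivative_snd_line[OF f'(1)]] by auto
  then show ?case
    using has_derivative_snd_line[OF f'(1)] Suc.IH[OF f'(2)] by (auto simp: C_k_const differentiable_def)
qed

lemma smooth_product:
  assumes "smooth_line f" "smooth_line g"
  shows "smooth (\<lambda>z. f (fst z) * g (snd z))"
  using assms by (auto simp: smooth_def smooth_line_def intro!: C_k_mult C_k_fst_line C_k_snd_line)

lemma partial_product:
  assumes f: "(f has_vector_derivative f') (at (fst z))" and g: "(g has_vector_derivative g') (at (snd z))"
  shows "partial (1, 0) (\<lambda>z. f (fst z) * g (snd z)) z = f' * g (snd z)"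
    and "partial (0, 1) (\<lambda>z. f (fst z) * g (snd z)) z = f (fst z) * g'"
  using partialI[OF has_derivative_mult[OF has_derivative_fst_line[OF f] has_derivative_snd_line[OF g]]]
  by simp_all

lemma smooth_of_real_polynomial:
  assumes "real_polynomial_function p"
  shows "smooth (\<lambda>z. of_real (p z))"
  using assms
proof induction
  case (linear f)
  \<comment> \<open>A linear map has constant partial derivatives, so all orders of smoothness
    reduce to \<open>C_k_const\<close>.\<close>
  have "partial e (\<lambda>z. of_real (f z)) = (\<lambda>z. of_real (f e))" for e
    by (intro ext partialI has_derivative_of_real bounded_linear_imp_has_derivative linear)
  moreover have "(\<lambda>z. complex_of_real (f z)) differentiable (at z)" for z
    using has_derivative_of_real[OF bounded_linear_imp_has_derivative[OF linear]] differentiableI by metis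
  ultimately have "C_k (Suc k) (\<lambda>z. of_real (f z))" for k
    unfolding C_k.simps by (simp only: C_k_const simp_thms)
  then show ?case unfolding smooth_def using C_k_Suc_imp by blast
qed auto

lemma smooth_polynomial:
  assumes "polynomial_function p"
  shows "smooth p"
proof -
  have "real_polynomial_function (\<lambda>z. Re (p z))" "real_polynomial_function (\<lambda>z. Im (p z))"
    using assms bounded_linear_Re bounded_linear_Im by (auto simp: polynomial_function_def o_def)
  then have "smooth (\<lambda>z. of_real (Re (p z)) + \<i> * of_real (Im (p z)))"
    by (intro smooth_add smooth_mult smooth_const smooth_of_real_polynomial)
  then show ?thesis by (simp add: complex_eq[symmetric])
qed

text \<open>Any compact \<open>K\<close> outside which the function vanishes will do: the closure of
  the nonvanishing set, awkward to compute for products and derivatives, is a closed subset of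
  \<open>K\<close>.\<close>

lemma test_functionsI:
  assumes "smooth \<phi>" "compact K" "K \<subseteq> \<Omega>" "\<And>z. z \<notin> K \<Longrightarrow> \<phi> z = 0"
  shows "\<phi> \<in> test_functions \<Omega>"
proof -
  have "closure {z. \<phi> z \<noteq> 0} \<subseteq> K"
    using assms(2,4) by (intro closure_minimal compact_imp_closed) auto
  moreover from this have "compact (closure {z. \<phi> z \<noteq> 0})"
    using compact_Int_closed[OF assms(2) closed_closure, of "{z. \<phi> z \<noteq> 0}"] by (simp add: Int_absorb1)
  ultimately show ?thesis using assms by (auto simp: test_functions_def smooth_def)
qed

lemma test_functionsD:
  assumes "\<phi> \<in> test_functions \<Omega>"
  obtains K where "compact K" "K \<subseteq> \<Omega>" "\<And>z. z \<notin> K \<Longrightarrow> \<phi> z = 0"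
proof
  show "compact (closure {z. \<phi> z \<noteq> 0})" "closure {z. \<phi> z \<noteq> 0} \<subseteq> \<Omega>"
    using assms by (auto simp: test_functions_def)
  show "\<phi> z = 0" if "z \<notin> closure {z. \<phi> z \<noteq> 0}" for z
    using that closure_subset[of "{z. \<phi> z \<noteq> 0}"] by auto
qed

lemma test_functions_smooth: "\<phi> \<in> test_functions \<Omega> \<Longrightarrow> smooth \<phi>"
  by (simp add: test_functions_def smooth_def)

lemma test_functions_mult:
  assumes "smooth \<psi>" "\<phi> \<in> test_functions \<Omega>"
  shows "(\<lambda>z. \<psi> z * \<phi> z) \<in> test_functions \<Omega>"
proof (rule test_functionsD[OF assms(2)])
  fix K assume "compact K" "K \<subseteq> \<Omega>" "\<And>z. z \<notin> K \<Longrightarrow> \<phi> z = 0"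
  then show ?thesis
    using assms test_functions_smooth by (intro test_functionsI[of _ K]) auto
qed

lemma test_functions_diff:
  assumes "\<phi> \<in> test_functions \<Omega>" "\<psi> \<in> test_functions \<Omega>"
  shows "(\<lambda>z. \<phi> z - \<psi> z) \<in> test_functions \<Omega>"
proof (rule test_functionsD[OF assms(1)], rule test_functionsD[OF assms(2)])
  fix K K' assume "compact K" "K \<subseteq> \<Omega>" "\<And>z. z \<notin> K \<Longrightarrow> \<phi> z = 0"
    "compact K'" "K' \<subseteq> \<Omega>" "\<And>z. z \<notin> K' \<Longrightarrow> \<psi> z = 0"
  then show ?thesis
    using assms test_functions_smooth by (intro test_functionsI[of _ "K \<union> K'"]) auto
qed

text \<open>The complement of \<open>K\<close> is open and the function vanishes on it, so its
  derivatives vanish there too and the same \<open>K\<close> confines them.\<close>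

lemma test_functions_partial:
  assumes "\<phi> \<in> test_functions \<Omega>" "e \<in> {(1, 0), (0, 1)}"
  shows "partial e \<phi> \<in> test_functions \<Omega>"
proof (rule test_functionsD[OF assms(1)])
  fix K assume K: "compact K" "K \<subseteq> \<Omega>" "\<And>z. z \<notin> K \<Longrightarrow> \<phi> z = 0"
  have "partial e \<phi> z = 0" if "z \<notin> K" for z
  proof -
    have "open (- K)" using K(1) by (simp add: compact_imp_closed open_Compl)
    have "(\<phi> has_derivative (\<lambda>h. 0)) (at z)"
      by (rule has_derivative_transform_within_open[of "\<lambda>z. 0" _ _ _ "- K"])
        (use K that \<open>open (- K)\<close> in auto)
    then show ?thesis by (rule partialI)
  qed
  then show ?thesis
    using K smooth_partial[OF test_functions_smooth[OF assms(1)] assms(2)] by (intro test_functionsI[of _ K])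
qed

lemma test_functions_product:
  assumes "smooth_line f" "smooth_line g"
    and "\<And>x. x \<notin> {a..b} \<Longrightarrow> f x = 0" "\<And>y. y \<notin> {c..d} \<Longrightarrow> g y = 0" "{a..b} \<times> {c..d} \<subseteq> \<Omega>"
  shows "(\<lambda>z. f (fst z) * g (snd z)) \<in> test_functions \<Omega>"
proof (rule test_functionsI[OF smooth_product[OF assms(1,2)] _ assms(5)])
  show "compact ({a..b} \<times> {c..d})" by (intro compact_Times compact_Icc)
  show "f (fst z) * g (snd z) = 0" if "z \<notin> {a..b} \<times> {c..d}" for z
    using assms(3)[of "fst z"] assms(4)[of "snd z"] that by (cases z) auto
qed

text \<open>A box bounds the support of every slice in either variable, uniformly in the other
  one.\<close>

lemma test_functions_box:
  assumes "\<phi> \<in> test_functions \<Omega>"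
  obtains R where "0 < R" "\<And>z. z \<notin> {-R..R} \<times> {-R..R} \<Longrightarrow> \<phi> z = 0"
proof (rule test_functionsD[OF assms])
  fix K assume K: "compact K" "K \<subseteq> \<Omega>" "\<And>z. z \<notin> K \<Longrightarrow> \<phi> z = 0"
  then obtain R where R: "0 < R" "\<And>z. z \<in> K \<Longrightarrow> norm z \<le> R"
    using bounded_pos compact_imp_bounded by metis
  have "z \<in> {-R..R} \<times> {-R..R}" if "z \<in> K" for z
    using R(2)[OF that] norm_fst_le[of "fst z" "snd z"] norm_snd_le[of "snd z" "fst z"]
    by (cases z) (auto simp: abs_le_iff)
  then show ?thesis using that[OF R(1)] K(3) by blast
qed


section \<open>Integration on the strip and density of polynomials\<close>

text \<open>Elements of the Sobolev space are only Lebesgue measurable, whereas Fubini's theorem on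
  \<open>lborel \<Otimes>\<^sub>M lborel\<close> needs Borel representatives.\<close>

lemma borel_version:
  fixes f :: "'a::euclidean_space \<Rightarrow> complex"
  assumes f: "f \<in> borel_measurable (lebesgue_on S)" and S: "S \<in> sets borel"
  shows "\<exists>g\<in>borel_measurable borel. AE z in lebesgue_on S. f z = g z"
proof -
  have "f \<in> borel_measurable (lebesgue_on S) \<longleftrightarrow> (\<lambda>x. if x \<in> S then f x else 0) \<in> borel_measurable lebesgue"
    using S by (intro borel_measurable_if[symmetric]) auto
  with f have *: "(\<lambda>x. if x \<in> S then f x else 0) \<in> borel_measurable (completion lborel)" by simp
  let ?f = "\<lambda>x. if x \<in> S then f x else 0"
  obtain u where u: "u \<in> borel_measurable lborel" "AE x in lborel. Re (?f x) = u x"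
    using completion_ex_borel_measurable_real[of "\<lambda>x. Re (?f x)" lborel] * by auto
  obtain v where v: "v \<in> borel_measurable lborel" "AE x in lborel. Im (?f x) = v x"
    using completion_ex_borel_measurable_real[of "\<lambda>x. Im (?f x)" lborel] * by auto
  have "AE x in lborel. ?f x = of_real (u x) + \<i> * of_real (v x)"
    using u(2) v(2)
  proof eventually_elim
    case (elim x)
    then show ?case using complex_eq[of "?f x"] by simp
  qed
  then have "AE x in lebesgue. ?f x = of_real (u x) + \<i> * of_real (v x)"
    by (rule AE_completion)
  then have "AE x in lebesgue. x \<in> S \<longrightarrow> f x = of_real (u x) + \<i> * of_real (v x)"
  proof eventually_elim
    case (elim x)
    show ?case
    proof
      assume "x \<in> S"
      with elim show "f x = of_real (u x) + \<i> * of_real (v x)" by (simp only: if_True)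
    qed
  qed
  moreover have "S \<inter> space lebesgue \<in> sets lebesgue" using S by simp
  ultimately have "AE x in lebesgue_on S. f x = of_real (u x) + \<i> * of_real (v x)"
    by (simp only: AE_restrict_space_iff)
  moreover have "(\<lambda>x. of_real (u x) + \<i> * of_real (v x)) \<in> borel_measurable borel"
    using u(1) v(1) by simp
  ultimately show ?thesis by (rule bexI)
qed

lemma borel_imp_lebesgue_on:
  fixes f :: "'a::euclidean_space \<Rightarrow> 'b::topological_space"
  shows "f \<in> borel_measurable borel \<Longrightarrow> f \<in> borel_measurable (lebesgue_on S)"
  by (intro measurable_restrict_space1 measurable_completion) simp

lemma integral_lebesgue_on_borel:
  fixes f :: "'a::euclidean_space \<Rightarrow> 'b::{banach, second_countable_topology}"
  assumes [measurable]: "f \<in> borel_measurable borel" "S \<in> sets borel"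
  shows "(\<integral>x. f x \<partial>lebesgue_on S) = (LINT x:S|lborel. f x)"
    and "integrable (lebesgue_on S) f \<longleftrightarrow> set_integrable lborel S f"
proof -
  have "(\<lambda>x. indicator S x *\<^sub>R f x) \<in> borel_measurable lborel" by measurable
  moreover have "S \<inter> space lebesgue \<in> sets lebesgue" by simp
  ultimately show "(\<integral>x. f x \<partial>lebesgue_on S) = (LINT x:S|lborel. f x)"
    and "integrable (lebesgue_on S) f \<longleftrightarrow> set_integrable lborel S f"
    by (simp_all add: integral_restrict_space integrable_restrict_space set_integrable_def
        set_lebesgue_integral_def integral_completion integrable_completion)
qed

lemma AE_lebesgue_on_borel:
  assumes "AE x in lborel. x \<in> S \<longrightarrow> P x" "S \<in> sets borel"
  shows "AE x in lebesgue_on S. P x"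
  using AE_completion[OF assms(1)] assms(2) by (subst AE_restrict_space_iff) auto

lemma sets_strip [measurable]: "strip L \<in> sets borel"
  unfolding strip_def by (intro borel_closed closed_Times) auto

lemma indicator_strip: "indicator (strip L) (x, y) = (indicator {0..L} y :: real)"
  by (simp add: strip_def indicator_def)

text \<open>Fubini's theorem, with the indicator of \<open>{0..L}\<close> absorbed into the second
  factor so that the integrand is a pure product on the whole plane.\<close>

lemma integral_strip_product:
  fixes F G :: "real \<Rightarrow> 'b::{real_normed_field, banach, second_countable_topology}"
  assumes F: "integrable lborel F" and G: "set_integrable lborel {0..L} G" "G \<in> borel_measurable borel"
  shows "integrable (strip_measure L) (\<lambda>z. F (fst z) * G (snd z))"
    and "(\<integral>z. F (fst z) * G (snd z) \<partial>strip_measure L) = (\<integral>x. F x \<partial>lborel) * (LINT y:{0..L}|lborel. G y)"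
proof -
  have Fm [measurable]: "F \<in> borel_measurable borel" using F by auto
  note [measurable] = G(2)
  let ?h = "\<lambda>(x, y). F x * (indicator {0..L} y *\<^sub>R G y)"
  have m: "?h \<in> borel_measurable (lborel \<Otimes>\<^sub>M lborel)" by measurable
  have G': "integrable lborel (\<lambda>y. indicator {0..L} y *\<^sub>R G y)" using G(1) by (simp add: set_integrable_def)
  have "integrable lborel (\<lambda>x. norm (F x) * (\<integral>y. norm (indicator {0..L} y *\<^sub>R G y) \<partial>lborel))"
    using F by (intro integrable_mult_left integrable_norm)
  moreover have "norm (F x) * (\<integral>y. norm (indicator {0..L} y *\<^sub>R G y) \<partial>lborel)
      = (\<integral>y. norm (?h (x, y)) \<partial>lborel)" for x
    by (simp add: norm_mult mult.left_commute[of "indicator _ _"])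
  ultimately have norm_i: "integrable lborel (\<lambda>x. \<integral>y. norm (?h (x, y)) \<partial>lborel)"
    by (simp only:)
  have i: "integrable (lborel \<Otimes>\<^sub>M lborel) ?h"
  proof (rule lborel_pair.Fubini_integrable[OF m norm_i])
    show "AE x in lborel. integrable lborel (\<lambda>y. ?h (x, y))"
      using integrable_mult_right[OF G'] by simp
  qed
  have mb: "(\<lambda>z. F (fst z) * G (snd z)) \<in> borel_measurable (borel :: (real \<times> real) measure)"
    unfolding borel_prod[symmetric] by measurable
  have eq: "?h = (\<lambda>z. indicator (strip L) z *\<^sub>R (F (fst z) * G (snd z)))"
    by (auto simp: fun_eq_iff indicator_strip)
  show "integrable (strip_measure L) (\<lambda>z. F (fst z) * G (snd z))"
    using i mb unfolding eq lborel_prod by (simp add: integral_lebesgue_on_borel(2) set_integrable_def)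
  have "(\<integral>z. F (fst z) * G (snd z) \<partial>strip_measure L) = (\<integral>z. ?h z \<partial>(lborel \<Otimes>\<^sub>M lborel))"
    using mb unfolding eq lborel_prod by (simp add: integral_lebesgue_on_borel(1) set_lebesgue_integral_def)
  also have "\<dots> = (\<integral>x. (\<integral>y. ?h (x, y) \<partial>lborel) \<partial>lborel)"
    by (rule lborel_pair.integral_fst'[symmetric, OF i])
  also have "\<dots> = (\<integral>x. F x \<partial>lborel) * (LINT y:{0..L}|lborel. G y)"
    by (simp add: set_lebesgue_integral_def del: mult_scaleR_right)
  finally show "(\<integral>z. F (fst z) * G (snd z) \<partial>strip_measure L) = (\<integral>x. F x \<partial>lborel) * (LINT y:{0..L}|lborel. G y)" .
qed

lemma L2_strip_product:
  assumes F: "F \<in> line_L2" and G: "continuous_on UNIV G"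
  shows "(\<lambda>z. F (fst z) * G (snd z)) \<in> strip_L2 L"
    and "strip_norm L (\<lambda>z. F (fst z) * G (snd z)) = line_norm F * L2_norm (lebesgue_on {0..L}) G"
proof -
  have [measurable]: "F \<in> borel_measurable borel" using L2_spaceD(1)[OF F] by simp
  have Gm [measurable]: "G \<in> borel_measurable borel" using G by (rule borel_measurable_continuous_onI)
  have "(\<lambda>z. F (fst z) * G (snd z)) \<in> borel_measurable (borel :: (real \<times> real) measure)"
    unfolding borel_prod[symmetric] by measurable
  then have m: "(\<lambda>z. F (fst z) * G (snd z)) \<in> borel_measurable (strip_measure L)"
    by (rule borel_imp_lebesgue_on)
  have G2: "set_integrable lborel {0..L} (\<lambda>y. (cmod (G y))\<^sup>2)"
    by (intro borel_integrable_atLeastAtMost' continuous_intros continuous_on_subset[OF G]) auto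
  note * = integral_strip_product[OF L2_spaceD(2)[OF F] G2]
  show "(\<lambda>z. F (fst z) * G (snd z)) \<in> strip_L2 L"
    using m * by (intro L2_spaceI) (auto simp: norm_mult power_mult_distrib)
  show "strip_norm L (\<lambda>z. F (fst z) * G (snd z)) = line_norm F * L2_norm (lebesgue_on {0..L}) G"
    using * by (simp add: L2_norm_def norm_mult power_mult_distrib integral_lebesgue_on_borel real_sqrt_mult)
qed

lemma L2_compact_support:
  fixes f :: "'a::euclidean_space \<Rightarrow> complex"
  assumes "continuous_on UNIV f" "compact K" "\<And>z. z \<notin> K \<Longrightarrow> f z = 0" "S \<in> sets borel"
  shows "f \<in> L2_space lborel" "f \<in> L2_space (lebesgue_on S)"
proof -
  have m: "f \<in> borel_measurable borel" using assms(1) by (rule borel_measurable_continuous_onI)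
  have eq: "(\<lambda>z. (cmod (f z))\<^sup>2) = (\<lambda>z. indicator K z *\<^sub>R (cmod (f z))\<^sup>2)"
  proof
    fix z show "(cmod (f z))\<^sup>2 = indicator K z *\<^sub>R (cmod (f z))\<^sup>2"
      using assms(3)[of z] by (cases "z \<in> K") auto
  qed
  have "integrable lborel (\<lambda>z. indicator K z *\<^sub>R (cmod (f z))\<^sup>2)"
    by (rule borel_integrable_compact[OF assms(2)])
      (intro continuous_intros continuous_on_subset[OF assms(1)], auto)
  then have i: "integrable lborel (\<lambda>z. (cmod (f z))\<^sup>2)" using eq by simp
  with m show "f \<in> L2_space lborel" by (intro L2_spaceI) auto
  have "integrable lebesgue (\<lambda>z. (cmod (f z))\<^sup>2)" using i m by (subst integrable_completion) auto
  then have "integrable (lebesgue_on S) (\<lambda>z. (cmod (f z))\<^sup>2)"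
    using assms(4) integrable_mult_indicator[of S lebesgue "\<lambda>z. (cmod (f z))\<^sup>2"]
    by (simp add: integrable_restrict_space)
  with m show "f \<in> L2_space (lebesgue_on S)" by (intro L2_spaceI borel_imp_lebesgue_on)
qed

section \<open>Density of polynomials in L^2 of a box\<close>

lemma L2_norm_tendsto_0:
  assumes "((\<lambda>n. \<integral>z. (cmod (u n z))\<^sup>2 \<partial>M) \<longlongrightarrow> 0) F"
  shows "((\<lambda>n. L2_norm M (u n)) \<longlongrightarrow> 0) F"
  using tendsto_real_sqrt[OF assms] by (simp add: L2_norm_def)

text \<open>Three approximations, each with error below e / 3: truncate the large values, replace
  the bounded function by a continuous one, and apply the Stone-Weierstrass theorem on the compact
  box.\<close>

lemma polynomial_dense_L2:
  fixes g :: "'a::euclidean_space \<Rightarrow> complex"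
  assumes g: "g \<in> L2_space (lebesgue_on (cbox a b))" and e: "0 < e"
  shows "\<exists>p. polynomial_function p \<and> L2_norm (lebesgue_on (cbox a b)) (\<lambda>x. g x - p x) < e"
proof -
  let ?M = "lebesgue_on (cbox a b)"
  interpret finite_measure ?M by (rule finite_measure_lebesgue_on) simp
  note [measurable] = L2_spaceD(1)[OF g]
  have cont_L2: "h \<in> L2_space ?M" if h: "continuous_on (cbox a b) h" for h :: "'a \<Rightarrow> complex"
  proof (rule L2_spaceI)
    show m: "h \<in> borel_measurable ?M" using h by (intro continuous_imp_measurable_on_sets_lebesgue) auto
    obtain B where B: "\<And>x. x \<in> cbox a b \<Longrightarrow> norm (h x) \<le> B"
      using compact_imp_bounded[OF compact_continuous_image[OF h compact_cbox]] unfolding bounded_iff by auto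
    show "integrable ?M (\<lambda>z. (cmod (h z))\<^sup>2)"
      by (rule integrable_const_bound[where B = "B\<^sup>2"])
         (use m B in \<open>auto intro!: AE_I2 power_mono\<close>)
  qed
  define t where "t n x = (if cmod (g x) \<le> real n then g x else 0)" for n x
  have tm [measurable]: "t n \<in> borel_measurable ?M" for n unfolding t_def by measurable
  have t_le: "cmod (t n x) \<le> cmod (g x)" "cmod (t n x) \<le> real n" for n x by (auto simp: t_def)
  have tL2: "t n \<in> L2_space ?M" for n
    by (rule L2_space_bound[OF g tm, where C = 1]) (use t_le in auto)
  have "(\<lambda>n. \<integral>x. (cmod (g x - t n x))\<^sup>2 \<partial>?M) \<longlonglongrightarrow> (\<integral>x. 0 \<partial>?M)"
  proof (rule integral_dominated_convergence[where w = "\<lambda>x. (cmod (g x))\<^sup>2"])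
    show "integrable ?M (\<lambda>x. (cmod (g x))\<^sup>2)" using L2_spaceD[OF g] by simp
    show "AE x in ?M. (\<lambda>n. (cmod (g x - t n x))\<^sup>2) \<longlonglongrightarrow> 0"
    proof (rule AE_I2)
      fix x
      have "\<forall>\<^sub>F n in sequentially. (cmod (g x - t n x))\<^sup>2 = 0"
        using eventually_ge_at_top[of "nat \<lceil>cmod (g x)\<rceil>"]
        by eventually_elim (auto simp: t_def nat_le_iff ceiling_le_iff)
      then show "(\<lambda>n. (cmod (g x - t n x))\<^sup>2) \<longlonglongrightarrow> 0" by (rule tendsto_eventually)
    qed
    show "AE x in ?M. norm ((cmod (g x - t n x))\<^sup>2) \<le> (cmod (g x))\<^sup>2" for n
      by (auto simp: t_def)
  qed auto
  then have "(\<lambda>n. L2_norm ?M (\<lambda>x. g x - t n x)) \<longlonglongrightarrow> 0"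
    by (intro L2_norm_tendsto_0) simp
  then have "\<forall>\<^sub>F n in sequentially. L2_norm ?M (\<lambda>x. g x - t n x) < e / 3"
    using e by (intro order_tendstoD) auto
  then have "\<forall>\<^sub>F n in sequentially. L2_norm ?M (\<lambda>x. g x - t n x) < e / 3 \<and> 1 \<le> n"
    using eventually_ge_at_top[of 1] by eventually_elim auto
  then obtain n where n: "L2_norm ?M (\<lambda>x. g x - t n x) < e / 3" "1 \<le> n"
    using eventually_happens'[OF sequentially_bot] by blast
  have "(\<lambda>x. if x \<in> cbox a b then t n x else 0) \<in> borel_measurable lebesgue"
    using tm[of n] borel_measurable_if[of "cbox a b" "t n"] by simp
  then have "(\<lambda>x. if x \<in> cbox a b then t n x else 0) measurable_on (cbox a b)"
    by (rule lebesgue_measurable_imp_measurable_on) simp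
  \<comment> \<open>The definition of \<open>measurable_on\<close> supplies continuous functions
    converging off a negligible set, but no common bound for them.\<close>
  then obtain N h where N: "negligible N" and h: "\<And>k. continuous_on UNIV (h k)"
    and lim: "\<And>x. x \<notin> N \<Longrightarrow> x \<in> cbox a b \<Longrightarrow> (\<lambda>k. h k x) \<longlonglongrightarrow> t n x"
    unfolding measurable_on_def by (auto split: if_splits)
  \<comment> \<open>Radial clipping to the disc of radius \<open>n\<close> preserves continuity,
    gives the bound for dominated convergence and leaves the limit \<open>t n x\<close> unchanged.
    The denominator is positive because \<open>1 \<le> n\<close>.\<close>
  define c where "c k x = h k x * of_real (real n / max (real n) (cmod (h k x)))" for k x
  have c_cont: "continuous_on S (c k)" for k S
    unfolding c_def using n(2)
    by (intro continuous_intros continuous_on_subset[OF h]) auto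
  have c_le: "cmod (c k x) \<le> real n" for k x
    using n(2) by (auto simp: c_def norm_mult norm_divide max_def field_simps)
  have c_lim: "(\<lambda>k. c k x) \<longlonglongrightarrow> t n x" if "x \<notin> N" "x \<in> cbox a b" for x
  proof -
    have "(\<lambda>k. c k x) \<longlonglongrightarrow> t n x * of_real (real n / max (real n) (cmod (t n x)))"
      unfolding c_def using n(2) by (intro tendsto_intros lim that) auto
    then show ?thesis using n(2) t_le(2)[of n x] by (simp add: max_def split: if_splits)
  qed
  have cL2: "c k \<in> L2_space ?M" for k by (rule cont_L2[OF c_cont])
  have [measurable]: "c k \<in> borel_measurable ?M" for k using L2_spaceD(1)[OF cL2] .
  have "(\<lambda>k. \<integral>x. (cmod (t n x - c k x))\<^sup>2 \<partial>?M) \<longlonglongrightarrow> (\<integral>x. 0 \<partial>?M)"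
  proof (rule integral_dominated_convergence[where w = "\<lambda>x. (2 * real n)\<^sup>2"])
    have "AE x in lebesgue. x \<notin> N"
      using N by (simp add: negligible_iff_null_sets AE_not_in)
    then have "AE x in ?M. x \<notin> N \<and> x \<in> cbox a b"
      by (subst AE_restrict_space_iff) auto
    then show "AE x in ?M. (\<lambda>k. (cmod (t n x - c k x))\<^sup>2) \<longlonglongrightarrow> 0"
    proof eventually_elim
      case (elim x)
      then have "(\<lambda>k. (cmod (t n x - c k x))\<^sup>2) \<longlonglongrightarrow> (cmod (t n x - t n x))\<^sup>2"
        by (intro tendsto_intros c_lim) auto
      then show ?case by simp
    qed
    show "AE x in ?M. norm ((cmod (t n x - c k x))\<^sup>2) \<le> (2 * real n)\<^sup>2" for k
    proof (rule AE_I2)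
      fix x
      have "cmod (t n x - c k x) \<le> 2 * real n"
        using norm_triangle_ineq4[of "t n x" "c k x"] t_le(2)[of n x] c_le[of k x] by linarith
      then have "(cmod (t n x - c k x))\<^sup>2 \<le> (2 * real n)\<^sup>2" by (rule power_mono) simp
      then show "norm ((cmod (t n x - c k x))\<^sup>2) \<le> (2 * real n)\<^sup>2" by simp
    qed
  qed auto
  then have "(\<lambda>k. L2_norm ?M (\<lambda>x. t n x - c k x)) \<longlonglongrightarrow> 0"
    by (intro L2_norm_tendsto_0) simp
  then have "\<forall>\<^sub>F k in sequentially. L2_norm ?M (\<lambda>x. t n x - c k x) < e / 3"
    using e by (intro order_tendstoD) auto
  then obtain k where k: "L2_norm ?M (\<lambda>x. t n x - c k x) < e / 3"
    using eventually_happens'[OF sequentially_bot] by blast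
  \<comment> \<open>The summand 1 keeps \<open>V\<close> positive on a box of measure zero and makes
    the norm of the constant 1 strictly smaller than \<open>V\<close>.\<close>
  define V where "V = sqrt (measure ?M (space ?M)) + 1"
  have V: "0 < V" by (simp add: V_def add_nonneg_pos)
  obtain p where p: "polynomial_function p" "\<And>x. x \<in> cbox a b \<Longrightarrow> norm (c k x - p x) < e / (3 * V)"
    using Stone_Weierstrass_polynomial_function[OF compact_cbox c_cont, of "e / (3 * V)" a b k] e V by auto
  have pL2: "p \<in> L2_space ?M" by (intro cont_L2 continuous_on_polymonial_function p(1))
  have "L2_norm ?M (\<lambda>x. c k x - p x) \<le> (e / (3 * V)) * L2_norm ?M (\<lambda>x. 1)"
  proof (rule L2_norm_bound)
    show "(\<lambda>x. 1) \<in> L2_space ?M" by (intro cont_L2 continuous_intros)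
    show "(\<lambda>x. c k x - p x) \<in> borel_measurable ?M" using L2_spaceD(1)[OF L2_space_diff[OF cL2 pL2]] .
    show "AE x in ?M. cmod (c k x - p x) \<le> e / (3 * V) * cmod 1"
      using p(2) by (intro AE_I2) (auto intro: less_imp_le)
  qed (use e V in auto)
  also have "L2_norm ?M (\<lambda>x. 1) < V" by (simp add: L2_norm_def V_def)
  finally have "L2_norm ?M (\<lambda>x. c k x - p x) < e / 3" using e V by (simp add: field_simps)
  then have "L2_norm ?M (\<lambda>x. g x - p x) < e"
    using L2_norm_triangle_diff[OF g tL2[of n] pL2] L2_norm_triangle_diff[OF tL2[of n] cL2[of k] pL2] n(1) k
    by linarith
  then show ?thesis using p(1) by blast
qed


section \<open>Weak partial derivatives\<close>

text \<open>Polynomials converge in norm to the conjugate of \<open>v\<close>. Their pairings with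
  \<open>v\<close> vanish, and tend to the squared norm of \<open>v\<close>.\<close>

lemma polynomial_orthogonal_imp_AE_0:
  fixes v :: "'a::euclidean_space \<Rightarrow> complex"
  assumes v: "v \<in> L2_space (lebesgue_on (cbox a b))"
    and orth: "\<And>p. polynomial_function p \<Longrightarrow> (\<integral>x. v x * p x \<partial>lebesgue_on (cbox a b)) = 0"
  shows "AE x in lebesgue_on (cbox a b). v x = 0"
proof -
  let ?M = "lebesgue_on (cbox a b)"
  have m [measurable]: "v \<in> borel_measurable ?M" using L2_spaceD(1)[OF v] .
  have cnj_m: "(\<lambda>x. cnj (v x)) \<in> borel_measurable ?M"
    by (intro borel_measurable_continuous_on[OF continuous_on_cnj] m continuous_on_id)
  have w: "(\<lambda>x. cnj (v x)) \<in> L2_space ?M"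
    by (rule L2_space_bound[OF v cnj_m, where C = 1]) auto
  have "\<exists>p. \<forall>n. polynomial_function (p n) \<and>
      L2_norm ?M (\<lambda>x. cnj (v x) - p n x) < inverse (real (Suc n))"
    by (intro choice allI polynomial_dense_L2[OF w]) simp
  then obtain p where p: "\<And>n. polynomial_function (p n)"
      "\<And>n. L2_norm ?M (\<lambda>x. cnj (v x) - p n x) < inverse (real (Suc n))" by blast
  have pL2: "p n \<in> L2_space ?M" for n
  proof (rule L2_spaceI)
    have c: "continuous_on S (p n)" for S by (intro continuous_on_polymonial_function p(1))
    show mp: "p n \<in> borel_measurable ?M"
      by (intro borel_imp_lebesgue_on borel_measurable_continuous_onI c)
    show "integrable ?M (\<lambda>x. (cmod (p n x))\<^sup>2)"
    proof (subst integral_lebesgue_on_borel(2))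
      show "set_integrable lborel (cbox a b) (\<lambda>x. (cmod (p n x))\<^sup>2)"
        unfolding set_integrable_def by (intro borel_integrable_compact compact_cbox continuous_intros c)
      show "(\<lambda>x. (cmod (p n x))\<^sup>2) \<in> borel_measurable borel"
        by (intro borel_measurable_continuous_onI continuous_intros c)
    qed simp
  qed
  have lim: "(\<lambda>n. L2_norm ?M (\<lambda>x. p n x - cnj (v x))) \<longlonglongrightarrow> 0"
  proof (rule Lim_null_comparison[OF _ LIMSEQ_inverse_real_of_nat])
    show "\<forall>\<^sub>F n in sequentially. norm (L2_norm ?M (\<lambda>x. p n x - cnj (v x))) \<le> inverse (real (Suc n))"
      using p(2) by (auto simp: L2_norm_diff_commute[of ?M "p _"] less_imp_le)
  qed
  have "(\<lambda>n. \<integral>x. p n x * v x \<partial>?M) \<longlonglongrightarrow> (\<integral>x. cnj (v x) * v x \<partial>?M)"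
    by (rule L2_integral_tendsto[OF pL2 w v lim])
  moreover have "(\<integral>x. p n x * v x \<partial>?M) = 0" for n
    using orth[OF p(1)[of n]] by (simp add: mult.commute)
  ultimately have "(\<integral>x. cnj (v x) * v x \<partial>?M) = 0" by (simp add: LIMSEQ_const_iff)
  moreover have "cnj (v x) * v x = of_real ((cmod (v x))\<^sup>2)" for x
    using complex_norm_square[of "v x"] by (simp add: mult.commute)
  ultimately have "complex_of_real (\<integral>x. (cmod (v x))\<^sup>2 \<partial>?M) = 0"
    by (simp only: integral_complex_of_real)
  then have "L2_norm ?M v = 0" by (simp add: L2_norm_def)
  then show ?thesis using L2_norm_eq_0_iff[OF v] by simp
qed

section \<open>Slices, and integration by parts against test functions\<close>

lemma slice_has_vector_derivative:
  assumes "f differentiable (at (x, y))"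
  shows "((\<lambda>x. f (x, y)) has_vector_derivative partial (1, 0) f (x, y)) (at x)"
    and "((\<lambda>y. f (x, y)) has_vector_derivative partial (0, 1) f (x, y)) (at y)"
proof -
  let ?D = "frechet_derivative f (at (x, y))"
  have D: "(f has_derivative ?D) (at (x, y))" using assms by (simp add: frechet_derivative_works)
  interpret bounded_linear ?D using D by (rule has_derivative_bounded_linear)
  have s: "(\<lambda>h. ?D (h, 0)) = (\<lambda>h. h *\<^sub>R ?D (1, 0))" "(\<lambda>h. ?D (0, h)) = (\<lambda>h. h *\<^sub>R ?D (0, 1))"
  proof -
    have "?D (h, 0) = h *\<^sub>R ?D (1, 0)" "?D (0, h) = h *\<^sub>R ?D (0, 1)" for h
      using scaleR[of h "(1, 0)"] scaleR[of h "(0, 1)"] by (simp_all only: scaleR_Pair real_scaleR_def mult_zero_right mult_1_right)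
    then show "(\<lambda>h. ?D (h, 0)) = (\<lambda>h. h *\<^sub>R ?D (1, 0))" "(\<lambda>h. ?D (0, h)) = (\<lambda>h. h *\<^sub>R ?D (0, 1))"
      by blast+
  qed
  have "((\<lambda>x. f (x, y)) has_derivative (\<lambda>h. ?D (h, 0))) (at x)"
    using D by (intro has_derivative_compose[of "\<lambda>x. (x, y)" "\<lambda>h. (h, 0)" x UNIV f ?D])
      (auto intro!: derivative_eq_intros)
  then show "((\<lambda>x. f (x, y)) has_vector_derivative partial (1, 0) f (x, y)) (at x)"
    by (simp only: has_vector_derivative_def partial_def s)
  have "((\<lambda>y. f (x, y)) has_derivative (\<lambda>h. ?D (0, h))) (at y)"
    using D by (intro has_derivative_compose[of "\<lambda>y. (x, y)" "\<lambda>h. (0, h)" y UNIV f ?D])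
      (auto intro!: derivative_eq_intros)
  then show "((\<lambda>y. f (x, y)) has_vector_derivative partial (0, 1) f (x, y)) (at y)"
    by (simp only: has_vector_derivative_def partial_def s)
qed

lemma C_k_slice: "C_k k f \<Longrightarrow> C_k_line k (\<lambda>x. f (x, y)) \<and> C_k_line k (\<lambda>y. f (x, y))"
proof (induction k arbitrary: f)
  case 0
  then show ?case by (auto intro!: continuous_on_compose2[of UNIV f] continuous_intros)
next
  case (Suc k)
  then have "\<And>z. f differentiable (at z)" "C_k k (partial (1, 0) f)" "C_k k (partial (0, 1) f)" by auto
  then show ?case
    unfolding C_k_line.simps using Suc.IH slice_has_vector_derivative by meson
qed

lemma smooth_slice:
  assumes "smooth f"
  shows "smooth_line (\<lambda>x. f (x, y))" "smooth_line (\<lambda>y. f (x, y))"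
  using assms C_k_slice by (auto simp: smooth_def smooth_line_def)

lemma test_functions_integrable:
  assumes "\<phi> \<in> test_functions \<Omega>"
  shows "integrable lborel \<phi>"
proof (rule test_functionsD[OF assms])
  fix K assume K: "compact K" "\<And>z. z \<notin> K \<Longrightarrow> \<phi> z = 0"
  have "integrable lborel (\<lambda>z. indicator K z *\<^sub>R \<phi> z)"
    by (intro borel_integrable_compact K smooth_continuous test_functions_smooth[OF assms])
  moreover have "indicator K z *\<^sub>R \<phi> z = \<phi> z" for z using K(2)[of z] by (cases "z \<in> K") auto
  ultimately show ?thesis by simp
qed

lemma test_functions_L2:
  assumes "\<phi> \<in> test_functions \<Omega>"
  shows "\<phi> \<in> strip_L2 L"
  by (rule test_functionsD[OF assms])
     (intro L2_compact_support smooth_continuous test_functions_smooth[OF assms], auto simp: sets_strip)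

text \<open>Each slice in the direction of differentiation integrates to zero by the fundamental
  theorem of calculus; Fubini's theorem collects the slices.\<close>

lemma integral_partial_eq_0:
  assumes \<phi>: "\<phi> \<in> test_functions \<Omega>" and e: "e \<in> {(1, 0), (0, 1)}"
  shows "(\<integral>z. partial e \<phi> z \<partial>lborel) = 0"
proof (rule test_functions_box[OF \<phi>])
  fix R :: real assume R: "\<And>z. z \<notin> {-R..R} \<times> {-R..R} \<Longrightarrow> \<phi> z = 0"
  have sm: "smooth (partial e \<phi>)"
    by (intro smooth_partial test_functions_smooth[OF \<phi>] e)
  have d: "\<phi> differentiable (at z)" for z
    using smooth_differentiable[OF test_functions_smooth[OF \<phi>]] .
  have int: "integrable (lborel \<Otimes>\<^sub>M lborel) (partial e \<phi>)"
    using test_functions_integrable[OF test_functions_partial[OF \<phi> e]] by (simp add: lborel_prod)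
  obtain S where S: "\<And>z. z \<notin> {-S..S} \<times> {-S..S} \<Longrightarrow> partial e \<phi> z = 0"
    using test_functions_box[OF test_functions_partial[OF \<phi> e]] by metis
  let ?T = "max R S"
  have T: "\<phi> (x, y) = 0" "partial e \<phi> (x, y) = 0" if "x \<notin> {-?T..?T} \<or> y \<notin> {-?T..?T}" for x y
    using that R[of "(x, y)"] S[of "(x, y)"] by (auto simp: max_def split: if_splits)
  consider "e = (1, 0)" | "e = (0, 1)" using e by auto
  then show ?thesis
  proof cases
    case 1
    have "(\<integral>x. partial e \<phi> (x, y) \<partial>lborel) = 0" for y
    proof (rule integral_compact_support_eq_0(2)[OF smooth_slice(1)[OF sm]])
      show "((\<lambda>x. \<phi> (x, y)) has_vector_derivative partial e \<phi> (x, y)) (at x)" for x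
        using slice_has_vector_derivative(1)[OF d] 1 by simp
    qed (use T in auto)
    then show ?thesis
      using lborel_pair.integral_snd[of "\<lambda>x y. partial e \<phi> (x, y)"] int by (simp add: lborel_prod)
  next
    case 2
    have "(\<integral>y. partial e \<phi> (x, y) \<partial>lborel) = 0" for x
    proof (rule integral_compact_support_eq_0(2)[OF smooth_slice(2)[OF sm]])
      show "((\<lambda>y. \<phi> (x, y)) has_vector_derivative partial e \<phi> (x, y)) (at y)" for y
        using slice_has_vector_derivative(2)[OF d] 2 by simp
    qed (use T in auto)
    then show ?thesis
      using lborel_pair.integral_fst'[of "partial e \<phi>"] int by (simp add: lborel_prod)
  qed
qed

lemma integral_strip_eq_lborel:
  assumes "f \<in> borel_measurable borel" "\<And>z. z \<notin> strip L \<Longrightarrow> f z = 0"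
  shows "(\<integral>z. f z \<partial>strip_measure L) = (\<integral>z. (f z :: complex) \<partial>lborel)"
proof -
  have "indicator (strip L) z *\<^sub>R f z = f z" for z using assms(2)[of z] by (cases "z \<in> strip L") auto
  then show ?thesis
    using assms(1) by (simp add: integral_lebesgue_on_borel sets_strip set_lebesgue_integral_def)
qed

text \<open>The product with a test function is again a test function, so its partial derivative has
  integral zero. Expanded by the product rule, this is the weak identity.\<close>

lemma is_weak_partial_smooth:
  assumes \<phi>: "smooth \<phi>" and L2: "partial e \<phi> \<in> strip_L2 L" and e: "e \<in> {(1, 0), (0, 1)}"
  shows "is_weak_partial L e \<phi> (partial e \<phi>)"
  unfolding is_weak_partial_def
proof (intro conjI ballI L2)
  fix \<psi> assume \<psi>: "\<psi> \<in> test_functions (interior (strip L))"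
  have sm: "smooth \<psi>" using test_functions_smooth[OF \<psi>] .
  have *: "partial e (\<lambda>z. \<phi> z * \<psi> z) = (\<lambda>z. \<phi> z * partial e \<psi> z + partial e \<phi> z * \<psi> z)"
    using partial_mult smooth_differentiable[OF \<phi>] smooth_differentiable[OF sm] by blast
  have i: "integrable lborel (\<lambda>z. \<phi> z * partial e \<psi> z)"
    by (rule test_functions_integrable[OF test_functions_mult[OF \<phi> test_functions_partial[OF \<psi> e]]])
  have i': "integrable lborel (\<lambda>z. partial e \<phi> z * \<psi> z)"
    by (rule test_functions_integrable[OF test_functions_mult[OF smooth_partial[OF \<phi> e] \<psi>]])
  have "(\<integral>z. \<phi> z * partial e \<psi> z + partial e \<phi> z * \<psi> z \<partial>lborel) = 0"
    using integral_partial_eq_0[OF test_functions_mult[OF \<phi> \<psi>] e] by (simp only: *)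
  then have "(\<integral>z. \<phi> z * partial e \<psi> z \<partial>lborel) = - (\<integral>z. partial e \<phi> z * \<psi> z \<partial>lborel)"
    using i i' by (simp add: add_eq_0_iff2)
  moreover have out: "\<psi> z = 0" "partial e \<psi> z = 0" if "z \<notin> strip L" for z
    using that interior_subset[of "strip L"] test_functionsD[OF \<psi>]
      test_functionsD[OF test_functions_partial[OF \<psi> e]] by (metis subsetD)+
  moreover have "(\<integral>z. \<phi> z * partial e \<psi> z \<partial>strip_measure L) = (\<integral>z. \<phi> z * partial e \<psi> z \<partial>lborel)"
    using i out by (intro integral_strip_eq_lborel) auto
  moreover have "(\<integral>z. partial e \<phi> z * \<psi> z \<partial>strip_measure L) = (\<integral>z. partial e \<phi> z * \<psi> z \<partial>lborel)"
    using i' out by (intro integral_strip_eq_lborel) auto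
  ultimately show "(\<integral>z. \<phi> z * partial e \<psi> z \<partial>strip_measure L) = - (\<integral>z. partial e \<phi> z * \<psi> z \<partial>strip_measure L)"
    by simp
qed

lemma interior_strip: "interior (strip L) = UNIV \<times> {0<..<L}"
  by (simp add: strip_def interior_Times)

lemma integral_lebesgue_on_indicator:
  fixes f :: "'a::euclidean_space \<Rightarrow> complex"
  assumes "S \<in> sets lebesgue"
  shows "(\<integral>x. f x \<partial>lebesgue_on S) = (\<integral>x. indicator S x *\<^sub>R f x \<partial>lebesgue)"
  using assms by (simp add: integral_restrict_space)

text \<open>Testing with a bump times a polynomial reduces the claim to the density of polynomials.\<close>

lemma fundamental_lemma_strip:
  assumes g: "g \<in> strip_L2 L"
    and orth: "\<And>\<phi>. \<phi> \<in> test_functions (interior (strip L)) \<Longrightarrow> (\<integral>z. g z * \<phi> z \<partial>strip_measure L) = 0"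
  shows "AE z in strip_measure L. g z = 0"
proof -
  have S: "strip L \<in> sets lebesgue" using sets_strip by auto
  have gm: "g \<in> borel_measurable (strip_measure L)" using L2_spaceD[OF g] by simp
  \<comment> \<open>These boxes exhaust the open strip as \<open>n\<close> grows, and on the
    interior of each the product of bumps does not vanish. For small \<open>n\<close> the box may be
    empty, which is harmless.\<close>
  have *: "AE z in lebesgue. fst z \<in> {-real n<..<real n} \<and> snd z \<in> {1 / real n<..<L - 1 / real n} \<longrightarrow> g z = 0"
    if n: "0 < n" for n
  proof -
    let ?K = "cbox (-real n, 1 / real n) (real n, L - 1 / real n)"
    let ?b = "\<lambda>z. bump (-real n) (real n) (fst z) * bump (1 / real n) (L - 1 / real n) (snd z)"
    have Keq: "?K = {-real n..real n} \<times> {1 / real n..L - 1 / real n}"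
      by (simp add: cbox_Pair_eq)
    have "{d..L - d} \<subseteq> {0<..<L}" if "0 < d" for d using that by auto
    then have Kint: "?K \<subseteq> interior (strip L)" using n unfolding Keq interior_strip by (intro Sigma_mono) auto
    then have Ksub: "?K \<subseteq> strip L" using interior_subset by blast
    have Km: "?K \<in> sets lebesgue" by auto
    have b: "?b \<in> test_functions (interior (strip L))"
      using Kint unfolding Keq
      by (intro test_functions_product[of _ _ "-real n" "real n" "1 / real n" "L - 1 / real n"])
        (auto intro: bump_eq_0)
    have out: "?b z = 0" if "z \<notin> ?K" for z
      using that bump_eq_0[of "fst z" "-real n" "real n"] bump_eq_0[of "snd z" "1 / real n" "L - 1 / real n"]
      unfolding Keq by (cases z) auto
    have bm: "?b \<in> borel_measurable borel"
      by (intro borel_measurable_continuous_onI smooth_continuous test_functions_smooth[OF b])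
    have "compact (?b ` ?K)"
      by (intro compact_continuous_image smooth_continuous test_functions_smooth[OF b] compact_cbox)
    then have "bounded (?b ` ?K)" by (rule compact_imp_bounded)
    then obtain C where C: "\<And>z. z \<in> ?K \<Longrightarrow> cmod (?b z) \<le> C"
      unfolding bounded_iff ball_simps by blast
    have gK: "g \<in> borel_measurable (lebesgue_on ?K)"
      using gm measurable_restrict_mono[OF _ Ksub] by blast
    have gK2: "g \<in> L2_space (lebesgue_on ?K)"
    proof (rule L2_spaceI[OF gK])
      have "set_integrable lebesgue (strip L) (\<lambda>z. (cmod (g z))\<^sup>2)"
        using L2_spaceD(2)[OF g] S by (simp add: integrable_restrict_space set_integrable_def)
      then have "set_integrable lebesgue ?K (\<lambda>z. (cmod (g z))\<^sup>2)"
        by (rule set_integrable_subset) (use Ksub in auto)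
      then show "integrable (lebesgue_on ?K) (\<lambda>z. (cmod (g z))\<^sup>2)"
        by (simp add: integrable_restrict_space set_integrable_def)
    qed
    have v: "(\<lambda>z. g z * ?b z) \<in> L2_space (lebesgue_on ?K)"
    proof (rule L2_space_bound[OF gK2, where C = C])
      show "(\<lambda>z. g z * ?b z) \<in> borel_measurable (lebesgue_on ?K)"
        by (intro borel_measurable_times gK borel_imp_lebesgue_on bm)
      show "AE z in lebesgue_on ?K. cmod (g z * ?b z) \<le> C * cmod (g z)"
      proof (rule AE_I2)
        fix z assume "z \<in> space (lebesgue_on ?K)"
        then have "cmod (?b z) \<le> C" using C by simp
        then show "cmod (g z * ?b z) \<le> C * cmod (g z)"
          unfolding norm_mult[of "g z"] by (subst mult.commute) (intro mult_right_mono, auto)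
      qed
    qed
    have "AE z in lebesgue_on ?K. g z * ?b z = 0"
    proof (rule polynomial_orthogonal_imp_AE_0[OF v])
      fix p :: "real \<times> real \<Rightarrow> complex" assume p: "polynomial_function p"
      have "indicator ?K z *\<^sub>R (g z * ?b z * p z) = indicator (strip L) z *\<^sub>R (g z * (p z * ?b z))" for z
        using out[of z] Ksub by (cases "z \<in> ?K") auto
      then have "(\<integral>z. g z * ?b z * p z \<partial>lebesgue_on ?K) = (\<integral>z. g z * (p z * ?b z) \<partial>strip_measure L)"
        by (simp only: integral_lebesgue_on_indicator[OF S] integral_lebesgue_on_indicator[OF Km])
      also have "\<dots> = 0"
        by (intro orth test_functions_mult b smooth_polynomial p)
      finally show "(\<integral>z. g z * ?b z * p z \<partial>lebesgue_on ?K) = 0" .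
    qed
    then have "AE z in lebesgue. z \<in> ?K \<longrightarrow> g z * ?b z = 0"
      by (simp add: AE_restrict_space_iff)
    then show ?thesis
    proof eventually_elim
      case (elim z)
      then show ?case
        using bump_nonzero[of "fst z" "-real n" "real n"] bump_nonzero[of "snd z" "1 / real n" "L - 1 / real n"]
        unfolding Keq by (cases z) auto
    qed
  qed
  have "AE z in lebesgue. \<forall>n. 0 < n \<longrightarrow>
      fst z \<in> {-real n<..<real n} \<and> snd z \<in> {1 / real n<..<L - 1 / real n} \<longrightarrow> g z = 0"
    unfolding AE_all_countable using * by auto
  then have "AE z in lebesgue. z \<in> interior (strip L) \<longrightarrow> g z = 0"
  proof eventually_elim
    case (elim z)
    show ?case
    proof
      assume "z \<in> interior (strip L)"
      then have y: "0 < snd z" "snd z < L" by (auto simp: interior_strip)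
      obtain n where n: "max \<bar>fst z\<bar> (max (1 / snd z) (1 / (L - snd z))) < real n"
        using reals_Archimedean2 by blast
      moreover from this have "0 < n" by (auto intro!: gr0I)
      ultimately have "fst z \<in> {-real n<..<real n}" "snd z \<in> {1 / real n<..<L - 1 / real n}"
        using y by (auto simp: field_simps)
      with elim \<open>0 < n\<close> show "g z = 0" by blast
    qed
  qed
  \<comment> \<open>The strip is convex, so its frontier is negligible and the result on the open
    strip extends to the closed one.\<close>
  moreover have "AE z in lebesgue. z \<notin> frontier (strip L)"
    using negligible_convex_frontier[of "strip L"]
    by (intro AE_not_in) (auto simp: negligible_iff_null_sets strip_def intro!: convex_Times)
  ultimately have "AE z in lebesgue. z \<in> strip L \<longrightarrow> g z = 0"
  proof eventually_elim
    case (elim z)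
    then show ?case using closure_subset[of "strip L"] by (auto simp: frontier_def)
  qed
  then show ?thesis using S by (simp add: AE_restrict_space_iff)
qed

lemma is_weak_partial_diff:
  assumes u: "u \<in> strip_L2 L" "is_weak_partial L e u g"
    and v: "v \<in> strip_L2 L" "is_weak_partial L e v h" and e: "e \<in> {(1, 0), (0, 1)}"
  shows "is_weak_partial L e (\<lambda>z. u z - v z) (\<lambda>z. g z - h z)"
  unfolding is_weak_partial_def
proof (intro conjI ballI)
  have gh: "g \<in> strip_L2 L" "h \<in> strip_L2 L"
    using u v by (auto simp: is_weak_partial_def)
  then show "(\<lambda>z. g z - h z) \<in> strip_L2 L" by (rule L2_space_diff)
  fix \<phi> assume \<phi>: "\<phi> \<in> test_functions (interior (strip L))"
  note i = L2_mult_integrable(1)[OF _ test_functions_L2[OF \<phi>, of L]]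
    L2_mult_integrable(1)[OF _ test_functions_L2[OF test_functions_partial[OF \<phi> e], of L]]
  show "(\<integral>z. (u z - v z) * partial e \<phi> z \<partial>strip_measure L) = - (\<integral>z. (g z - h z) * \<phi> z \<partial>strip_measure L)"
    using \<phi> u v i[OF gh(1)] i[OF gh(2)] i[OF u(1)] i[OF v(1)]
    by (simp add: left_diff_distrib is_weak_partial_def)
qed

text \<open>The difference of two weak derivatives is a weak derivative of zero, hence orthogonal to
  all test functions.\<close>

lemma is_weak_partial_unique:
  assumes u: "u \<in> strip_L2 L" "is_weak_partial L e u g" "is_weak_partial L e u h"
    and e: "e \<in> {(1, 0), (0, 1)}"
  shows "AE z in strip_measure L. g z = h z"
proof -
  have "is_weak_partial L e (\<lambda>z. u z - u z) (\<lambda>z. g z - h z)"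
    using u e by (intro is_weak_partial_diff)
  then have "AE z in strip_measure L. g z - h z = 0"
    by (intro fundamental_lemma_strip) (auto simp: is_weak_partial_def)
  then show ?thesis by simp
qed

text \<open>Any known weak derivative may stand in for the one picked by
  \<open>SOME\<close>.\<close>

lemma weak_partial_AE_eq:
  assumes "u \<in> strip_L2 L" "is_weak_partial L e u g" "e \<in> {(1, 0), (0, 1)}"
  shows "AE z in strip_measure L. weak_partial L e u z = g z"
    and "weak_partial L e u \<in> strip_L2 L"
proof -
  have w: "is_weak_partial L e u (weak_partial L e u)"
    unfolding weak_partial_def by (rule someI[of "is_weak_partial L e u", OF assms(2)])
  show "AE z in strip_measure L. weak_partial L e u z = g z"
    by (rule is_weak_partial_unique[OF assms(1) w assms(2,3)])
  show "weak_partial L e u \<in> strip_L2 L" using w by (simp add: is_weak_partial_def)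
qed


section \<open>Primitives of square-integrable functions\<close>

lemma L2_indicator_Icc:
  assumes "a \<le> b"
  shows "(\<lambda>x. of_real (indicator {a..b} x)) \<in> line_L2"
    and "line_norm (\<lambda>x. of_real (indicator {a..b} x)) = sqrt (b - a)"
proof -
  have eq: "(\<lambda>x. (cmod (of_real (indicator {a..b} x)))\<^sup>2) = (indicator {a..b} :: real \<Rightarrow> real)"
    by (auto simp: indicator_def)
  show "(\<lambda>x. of_real (indicator {a..b} x)) \<in> line_L2"
    unfolding L2_space_def mem_Collect_eq eq
    by (intro conjI integrable_real_indicator) (auto simp: emeasure_lborel_Icc_eq)
  show "line_norm (\<lambda>x. of_real (indicator {a..b} x)) = sqrt (b - a)"
    using assms unfolding L2_norm_def eq by simp
qed

lemma L2_set_integral_Icc: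
  assumes h: "h \<in> line_L2" and "a \<le> b"
  shows "set_integrable lborel {a..b} h"
    and "cmod (LINT t:{a..b}|lborel. h t) \<le> sqrt (b - a) * line_norm h"
proof -
  note i = L2_indicator_Icc[OF assms(2)]
  show "set_integrable lborel {a..b} h"
    using L2_mult_integrable(1)[OF i(1) h] by (simp add: set_integrable_def scaleR_conv_of_real)
  show "cmod (LINT t:{a..b}|lborel. h t) \<le> sqrt (b - a) * line_norm h"
    using norm_integral_mult_le[OF i(1) h] i(2) by (simp add: set_lebesgue_integral_def scaleR_conv_of_real)
qed

text \<open>Absolute continuity with derivative \<open>h\<close>, stated through integrals so that
  no pointwise derivative of a primitive of an L^2 function is needed. The additive constant is left
  free.\<close>

definition is_primitive :: "(real \<Rightarrow> complex) \<Rightarrow> (real \<Rightarrow> complex) \<Rightarrow> bool" where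
  "is_primitive H h \<longleftrightarrow> (\<forall>a b. a \<le> b \<longrightarrow> H b - H a = (LINT t:{a..b}|lborel. h t))"

lemma is_primitiveD: "is_primitive H h \<Longrightarrow> a \<le> b \<Longrightarrow> H b - H a = (LINT t:{a..b}|lborel. h t)"
  by (simp add: is_primitive_def)

lemma is_primitive_exists:
  assumes h: "h \<in> line_L2"
  shows "\<exists>H. is_primitive H h"
proof
  show "is_primitive (\<lambda>x. LBINT t=0..ereal x. h t) h"
    unfolding is_primitive_def
  proof (intro allI impI)
    fix a b :: real assume ab: "a \<le> b"
    \<comment> \<open>The enclosing interval spans 0, \<open>a\<close> and \<open>b\<close> in
      whatever order they come, as additivity of interval integrals requires.\<close>
    have "set_integrable lborel {min 0 a<..<max 0 b} h"
      by (rule set_integrable_subset[OF L2_set_integral_Icc(1)[OF h, of "min 0 a" "max 0 b"]]) auto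
    moreover have "ereal (min 0 a) \<le> ereal (max 0 b)" unfolding ereal_less_eq by linarith
    ultimately have "interval_lebesgue_integrable lborel (ereal (min 0 a)) (ereal (max 0 b)) h"
      by (simp only: interval_lebesgue_integrable_def if_True einterval_eq)
    then have "(LBINT t=0..ereal a. h t) + (LBINT t=ereal a..ereal b. h t) = (LBINT t=0..ereal b. h t)"
      using ab by (intro interval_integral_sum) (simp add: min_def max_def zero_ereal_def split: if_splits)
    then show "(LBINT t=0..ereal b. h t) - (LBINT t=0..ereal a. h t) = (LINT t:{a..b}|lborel. h t)"
      using ab by (simp add: interval_integral_Icc[symmetric] algebra_simps)
  qed
qed

text \<open>The Cauchy-Schwarz inequality against the indicator of the interval: primitives of L^2
  functions are Hoelder continuous with exponent 1/2.\<close>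

lemma is_primitive_bound:
  assumes "is_primitive H h" "h \<in> line_L2"
  shows "cmod (H x - H y) \<le> sqrt \<bar>x - y\<bar> * line_norm h"
proof (cases "x \<le> y")
  case True
  then show ?thesis
    using is_primitiveD[OF assms(1) True] L2_set_integral_Icc(2)[OF assms(2) True]
    by (simp add: norm_minus_commute[of "H x"])
next
  case False
  then show ?thesis
    using is_primitiveD[OF assms(1), of y x] L2_set_integral_Icc(2)[OF assms(2), of y x] by simp
qed

lemma is_primitive_continuous:
  assumes "is_primitive H h" "h \<in> line_L2"
  shows "continuous_on S H"
proof -
  have "isCont H x" for x
    unfolding isCont_def
  proof (rule LIM_zero_cancel, rule Lim_null_comparison)
    show "\<forall>\<^sub>F y in at x. norm (H y - H x) \<le> sqrt \<bar>y - x\<bar> * line_norm h"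
      using is_primitive_bound[OF assms] by auto
    have "((\<lambda>y. sqrt \<bar>y - x\<bar> * line_norm h) \<longlongrightarrow> sqrt \<bar>x - x\<bar> * line_norm h) (at x)"
      by (intro tendsto_intros)
    then show "((\<lambda>y. sqrt \<bar>y - x\<bar> * line_norm h) \<longlongrightarrow> 0) (at x)" by simp
  qed
  then show ?thesis by (simp add: continuous_at_imp_continuous_on)
qed

lemma is_primitive_smooth:
  assumes "smooth_line q" "\<And>x. (Q has_vector_derivative q x) (at x)"
  shows "is_primitive Q q"
  using FTC_smooth_line[OF assms] by (simp add: is_primitive_def)

text \<open>Turns norms on an interval into norms on the line, where the estimates for primitives
  are stated.\<close>

lemma L2_restrict_Icc:
  fixes f :: "real \<Rightarrow> complex"
  assumes "f \<in> borel_measurable borel"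
  shows "f \<in> L2_space (lebesgue_on {a..b}) \<longleftrightarrow> (\<lambda>x. of_real (indicator {a..b} x) * f x) \<in> line_L2"
    and "L2_norm (lebesgue_on {a..b}) f = line_norm (\<lambda>x. of_real (indicator {a..b} x) * f x)"
proof -
  have eq: "(cmod (of_real (indicator {a..b} x) * f x))\<^sup>2 = indicator {a..b} x * (cmod (f x))\<^sup>2" for x
    by (simp add: norm_mult power_mult_distrib indicator_def)
  show "f \<in> L2_space (lebesgue_on {a..b}) \<longleftrightarrow> (\<lambda>x. of_real (indicator {a..b} x) * f x) \<in> line_L2"
    using assms by (simp add: L2_space_def integral_lebesgue_on_borel borel_imp_lebesgue_on set_integrable_def eq)
  show "L2_norm (lebesgue_on {a..b}) f = line_norm (\<lambda>x. of_real (indicator {a..b} x) * f x)"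
    using assms by (simp add: L2_norm_def integral_lebesgue_on_borel set_lebesgue_integral_def eq)
qed

lemma continuous_L2_Icc:
  fixes f :: "real \<Rightarrow> complex"
  assumes "continuous_on UNIV f"
  shows "(\<lambda>x. of_real (indicator {a..b} x) * f x) \<in> line_L2"
proof -
  have m: "f \<in> borel_measurable borel" using assms by (rule borel_measurable_continuous_onI)
  have "f \<in> L2_space (lebesgue_on {a..b})"
  proof (rule L2_spaceI[OF borel_imp_lebesgue_on[OF m]], subst integral_lebesgue_on_borel(2))
    show "set_integrable lborel {a..b} (\<lambda>x. (cmod (f x))\<^sup>2)"
      by (intro borel_integrable_atLeastAtMost' continuous_intros continuous_on_subset[OF assms]) auto
  qed (use m in auto)
  then show ?thesis using L2_restrict_Icc(1)[OF m] by simp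
qed

text \<open>A polynomial \<open>q\<close> approximates \<open>h\<close> in L^2 on the interval. Its
  primitive starts at \<open>H 0\<close>, so integrating the error over a distance of at most
  \<open>R\<close> gives the uniform bound. The exact value at 0 later keeps the traces of the
  approximants exact.\<close>

lemma primitive_approximation:
  assumes H: "is_primitive H h" and h: "h \<in> line_L2" and "0 < R" "0 < \<delta>"
  obtains Q q where "smooth_line q" "\<And>x. (Q has_vector_derivative q x) (at x)" "Q 0 = H 0"
    and "(\<lambda>x. of_real (indicator {-R..R} x) * (q x - h x)) \<in> line_L2"
    and "line_norm (\<lambda>x. of_real (indicator {-R..R} x) * (q x - h x)) < \<delta>"
    and "\<And>x. x \<in> {-R..R} \<Longrightarrow> cmod (Q x - H x) \<le> sqrt R * \<delta>"
proof -
  let ?I = "\<lambda>x. complex_of_real (indicator {-R..R} x)"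
  have hm: "h \<in> borel_measurable borel" using L2_spaceD(1)[OF h] by simp
  have Im: "?I \<in> borel_measurable borel" by measurable
  have "(\<lambda>x. ?I x * h x) \<in> line_L2"
    by (rule L2_space_bound[OF h, where C = 1]) (use hm Im in \<open>auto simp: norm_mult indicator_def\<close>)
  then have "h \<in> L2_space (lebesgue_on (cbox (-R) R))"
    using L2_restrict_Icc(1)[OF hm] by simp
  from polynomial_dense_L2[OF this \<open>0 < \<delta>\<close>]
  obtain q where q: "polynomial_function q" "L2_norm (lebesgue_on {-R..R}) (\<lambda>x. h x - q x) < \<delta>"
    unfolding cbox_interval by (elim exE conjE)
  have sq: "smooth_line q" by (rule smooth_line_polynomial[OF q(1)])
  obtain Q where Q: "\<And>x. (Q has_vector_derivative q x) (at x)" "Q 0 = H 0"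
    using smooth_line_antiderivative_exists[OF sq] by metis
  have qm: "q \<in> borel_measurable borel"
    by (intro borel_measurable_continuous_onI smooth_line_continuous sq)
  let ?d = "\<lambda>x. ?I x * (q x - h x)"
  have d: "?d \<in> line_L2"
    using L2_space_diff[OF continuous_L2_Icc[OF smooth_line_continuous[OF sq]] \<open>(\<lambda>x. ?I x * h x) \<in> line_L2\<close>]
    by (simp add: right_diff_distrib)
  have d_less: "line_norm ?d < \<delta>"
    using q(2) hm qm L2_restrict_Icc(2)[of "\<lambda>x. q x - h x" "-R" R] by (simp add: L2_norm_diff_commute[of _ h q])
  have diff: "(Q b - H b) - (Q a - H a) = (LINT t:{a..b}|lborel. ?d t)" if "a \<le> b" "-R \<le> a" "b \<le> R" for a b
  proof -
    have "set_integrable lborel {a..b} q" "set_integrable lborel {a..b} h"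
      using L2_set_integral_Icc(1)[OF h that(1)]
      by (auto intro!: borel_integrable_atLeastAtMost' smooth_line_continuous sq)
    then have "(LINT t:{a..b}|lborel. q t - h t) = (Q b - Q a) - (H b - H a)"
      using is_primitiveD[OF is_primitive_smooth[OF sq Q(1)] that(1)] is_primitiveD[OF H that(1)]
      by (simp add: set_integral_diff)
    moreover have "(LINT t:{a..b}|lborel. ?d t) = (LINT t:{a..b}|lborel. q t - h t)"
      using that by (intro set_lebesgue_integral_cong) auto
    ultimately show ?thesis by simp
  qed
  have "cmod (Q x - H x) \<le> sqrt R * \<delta>" if x: "x \<in> {-R..R}" for x
  proof -
    have bound: "cmod (LINT t:{a..b}|lborel. ?d t) \<le> sqrt R * \<delta>" if "a \<le> b" "b - a \<le> R" for a b
    proof -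
      have "cmod (LINT t:{a..b}|lborel. ?d t) \<le> sqrt (b - a) * line_norm ?d"
        by (rule L2_set_integral_Icc(2)[OF d that(1)])
      also have "\<dots> \<le> sqrt R * \<delta>"
        using that d_less \<open>0 < \<delta>\<close> \<open>0 < R\<close> by (intro mult_mono) auto
      finally show ?thesis .
    qed
    show ?thesis
    proof (cases "0 \<le> x")
      case True
      then show ?thesis using diff[of 0 x] bound[of 0 x] x Q(2) by simp
    next
      case False
      have "cmod (Q x - H x) = cmod ((Q 0 - H 0) - (Q x - H x))" using Q(2) by (simp add: norm_minus_commute)
      then show ?thesis using diff[of x 0] bound[of x 0] x False by simp
    qed
  qed
  with that[OF sq Q d d_less] show ?thesis by blast
qed

text \<open>For a smooth \<open>Q\<close> the identity is the fundamental theorem of calculus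
  applied to the product with \<open>\<psi>\<close>. The defect \<open>X\<close> for
  \<open>H\<close> is at most a fixed constant times the approximation error, which is
  arbitrary.\<close>

lemma primitive_integration_by_parts:
  assumes H: "is_primitive H h" and h: "h \<in> line_L2"
    and \<psi>: "smooth_line p" "\<And>x. (\<psi> has_vector_derivative p x) (at x)"
    and out: "\<And>x. x \<notin> {-R..R} \<Longrightarrow> \<psi> x = 0" "\<And>x. x \<notin> {-R..R} \<Longrightarrow> p x = 0" and R: "0 < R"
  shows "integrable lborel (\<lambda>x. H x * p x)"
    and "(\<integral>x. H x * p x \<partial>lborel) = - (\<integral>x. h x * \<psi> x \<partial>lborel)"
proof -
  have s\<psi>: "smooth_line \<psi>" by (rule smooth_line_antiderivative[OF \<psi>])
  have pL2: "p \<in> line_L2" and \<psi>L2: "\<psi> \<in> line_L2"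
    using out by (auto intro!: L2_compact_support(1)[of _ "{-R..R}" "{}"] smooth_line_continuous \<psi> s\<psi>)
  have int: "integrable lborel f" if "continuous_on UNIV f" "\<And>x. x \<notin> {-R..R} \<Longrightarrow> f x = 0" for f :: "real \<Rightarrow> complex"
  proof -
    have "set_integrable lborel {-R..R} f"
      by (intro borel_integrable_atLeastAtMost' continuous_on_subset[OF that(1)]) auto
    moreover have "indicator {-R..R} x *\<^sub>R f x = f x" for x using that(2)[of x] by (cases "x \<in> {-R..R}") auto
    ultimately show ?thesis by (simp add: set_integrable_def)
  qed
  have Hc: "continuous_on UNIV H" by (rule is_primitive_continuous[OF H h])
  show iH: "integrable lborel (\<lambda>x. H x * p x)"
    by (intro int continuous_intros Hc smooth_line_continuous \<psi>) (use out in auto)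
  have ih: "integrable lborel (\<lambda>x. h x * \<psi> x)" by (rule L2_mult_integrable(1)[OF h \<psi>L2])
  define X where "X = (\<integral>x. H x * p x \<partial>lborel) + (\<integral>x. h x * \<psi> x \<partial>lborel)"
  let ?C = "sqrt R * sqrt (2 * R) * line_norm p + line_norm \<psi>"
  have X_le: "cmod X \<le> ?C * \<delta>" if \<delta>: "0 < \<delta>" for \<delta>
  proof (rule primitive_approximation[OF H h R \<delta>])
    fix Q q
    let ?d = "\<lambda>x. of_real (indicator {-R..R} x) * (q x - h x)"
    let ?e = "\<lambda>x. of_real (indicator {-R..R} x) * (Q x - H x)"
    assume q: "smooth_line q" "\<And>x. (Q has_vector_derivative q x) (at x)"
      and d: "?d \<in> line_L2" "line_norm ?d < \<delta>"
      and close: "\<And>x. x \<in> {-R..R} \<Longrightarrow> cmod (Q x - H x) \<le> sqrt R * \<delta>"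
    have sQ: "smooth_line Q" by (rule smooth_line_antiderivative[OF q])
    have "((\<lambda>x. Q x * \<psi> x) has_vector_derivative (Q x * p x + q x * \<psi> x)) (at x)" for x
      by (rule has_vector_derivative_mult[OF q(2) \<psi>(2)])
    then have "(\<integral>x. Q x * p x + q x * \<psi> x \<partial>lborel) = 0"
      by (rule integral_compact_support_eq_0(2)[rotated, where a = "-R" and b = R])
         (use out sQ s\<psi> q \<psi> in auto)
    moreover have iQ: "integrable lborel (\<lambda>x. Q x * p x)" "integrable lborel (\<lambda>x. q x * \<psi> x)"
      by (intro int continuous_intros smooth_line_continuous sQ q \<psi> s\<psi>; use out in auto)+
    ultimately have zero: "(\<integral>x. Q x * p x \<partial>lborel) + (\<integral>x. q x * \<psi> x \<partial>lborel) = 0" by simp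
    have e: "?e \<in> line_L2"
      by (intro continuous_L2_Icc continuous_intros Hc smooth_line_continuous sQ)
    have "line_norm ?e \<le> (sqrt R * \<delta>) * line_norm (\<lambda>x. of_real (indicator {-R..R} x))"
      by (rule L2_norm_bound[OF L2_indicator_Icc(1)])
         (use R \<delta> close L2_spaceD(1)[OF e] in \<open>auto simp: norm_mult indicator_def\<close>)
    then have e_le: "line_norm ?e \<le> sqrt R * sqrt (2 * R) * \<delta>"
      using R by (simp add: L2_indicator_Icc(2) mult_ac)
    have "(\<integral>x. ?e x * p x \<partial>lborel) = (\<integral>x. Q x * p x - H x * p x \<partial>lborel)"
    proof (intro Bochner_Integration.integral_cong refl)
      fix x show "?e x * p x = Q x * p x - H x * p x"
        using out(2)[of x] by (cases "x \<in> {-R..R}") (auto simp: algebra_simps)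
    qed
    also have "\<dots> = (\<integral>x. Q x * p x \<partial>lborel) - (\<integral>x. H x * p x \<partial>lborel)" using iQ iH by simp
    finally have 1: "(\<integral>x. ?e x * p x \<partial>lborel) = (\<integral>x. Q x * p x \<partial>lborel) - (\<integral>x. H x * p x \<partial>lborel)" .
    have "(\<integral>x. ?d x * \<psi> x \<partial>lborel) = (\<integral>x. q x * \<psi> x - h x * \<psi> x \<partial>lborel)"
    proof (intro Bochner_Integration.integral_cong refl)
      fix x show "?d x * \<psi> x = q x * \<psi> x - h x * \<psi> x"
        using out(1)[of x] by (cases "x \<in> {-R..R}") (auto simp: algebra_simps)
    qed
    also have "\<dots> = (\<integral>x. q x * \<psi> x \<partial>lborel) - (\<integral>x. h x * \<psi> x \<partial>lborel)" using iQ ih by simp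
    finally have 2: "(\<integral>x. ?d x * \<psi> x \<partial>lborel) = (\<integral>x. q x * \<psi> x \<partial>lborel) - (\<integral>x. h x * \<psi> x \<partial>lborel)" .
    have "X = - ((\<integral>x. ?e x * p x \<partial>lborel) + (\<integral>x. ?d x * \<psi> x \<partial>lborel))"
      unfolding 1 2 X_def using zero by (simp add: algebra_simps)
    then have "cmod X \<le> cmod (\<integral>x. ?e x * p x \<partial>lborel) + cmod (\<integral>x. ?d x * \<psi> x \<partial>lborel)"
      by (simp only: norm_minus_cancel norm_triangle_ineq)
    also have "\<dots> \<le> line_norm ?e * line_norm p + line_norm ?d * line_norm \<psi>"
      by (intro add_mono norm_integral_mult_le e d pL2 \<psi>L2)
    also have "\<dots> \<le> (sqrt R * sqrt (2 * R) * \<delta>) * line_norm p + \<delta> * line_norm \<psi>"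
      using e_le d(2) by (intro add_mono mult_right_mono) auto
    finally show "cmod X \<le> ?C * \<delta>" by (simp add: algebra_simps)
  qed
  have "cmod X \<le> 0"
  proof (rule field_le_epsilon)
    fix e :: real assume e: "0 < e"
    have C: "0 \<le> ?C" using R by simp
    \<comment> \<open>The \<open>+ 1\<close> avoids a division by zero when \<open>?C\<close>
      vanishes.\<close>
    have "cmod X \<le> ?C * (e / (?C + 1))" using X_le[of "e / (?C + 1)"] C e by simp
    also have "\<dots> \<le> e" using C e by (simp add: field_simps)
    finally show "cmod X \<le> 0 + e" by simp
  qed
  then have "X = 0" by simp
  then show "(\<integral>x. H x * p x \<partial>lborel) = - (\<integral>x. h x * \<psi> x \<partial>lborel)"
    by (simp add: X_def eq_neg_iff_add_eq_0)
qed


section \<open>Sobolev functions on the line\<close>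

text \<open>The test functions \<open>p\<close> are the products of a bump and a polynomial, corrected by a multiple of the
  bump so that they have mean zero and hence a compactly supported primitive \<open>\<psi>\<close>.\<close>

lemma du_Bois_Reymond:
  assumes vm: "v \<in> borel_measurable borel"
    and v: "\<And>n::nat. (\<lambda>x. of_real (indicator {-real n..real n} x) * v x) \<in> line_L2"
    and orth: "\<And>\<psi> p R. smooth_line p \<Longrightarrow> (\<And>x. (\<psi> has_vector_derivative p x) (at x)) \<Longrightarrow> 0 < R \<Longrightarrow>
      (\<And>x. x \<notin> {-R..R} \<Longrightarrow> \<psi> x = 0) \<Longrightarrow> (\<And>x. x \<notin> {-R..R} \<Longrightarrow> p x = 0) \<Longrightarrow>
      (\<integral>x. v x * p x \<partial>lborel) = 0"
  shows "\<exists>c. AE x in lborel. v x = c"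
proof -
  have local: "\<exists>c. AE x in lborel. x \<in> {-real n<..<real n} \<longrightarrow> v x = c" if n: "0 < n" for n
  proof -
    let ?R = "real n"
    let ?I = "\<lambda>x. complex_of_real (indicator {-?R..?R} x)"
    let ?b = "bump (-?R) ?R"
    have R: "0 < ?R" using n by simp
    have b_out: "?b x = 0" if "x \<notin> {-?R..?R}" for x using that by (intro bump_eq_0) auto
    have bL2: "?b \<in> line_L2"
      by (rule L2_compact_support(1)[of _ "{-?R..?R}" "{}"])
        (use b_out in \<open>auto intro!: smooth_line_continuous\<close>)
    have int: "integrable lborel (\<lambda>x. v x * f x)" if f: "smooth_line f" "\<And>x. x \<notin> {-?R..?R} \<Longrightarrow> f x = 0" for f
    proof -
      have "f \<in> line_L2"
        by (rule L2_compact_support(1)[of _ "{-?R..?R}" "{}"]) (use f in \<open>auto intro!: smooth_line_continuous\<close>)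
      from L2_mult_integrable(1)[OF v[of n] this]
      have "integrable lborel (\<lambda>x. ?I x * v x * f x)" .
      moreover have "?I x * v x * f x = v x * f x" for x using f(2)[of x] by (cases "x \<in> {-?R..?R}") auto
      ultimately show ?thesis by simp
    qed
    define A where "A = (LINT x:{-?R..?R}|lborel. ?b x)"
    have A: "A \<noteq> 0" using R bump_integral_nonzero[of "-?R" ?R] by (simp add: A_def)
    \<comment> \<open>The mean of \<open>v\<close> weighted by the bump: if \<open>v\<close> is
      constant on the interval, this is its value.\<close>
    define \<kappa> where "\<kappa> = (\<integral>x. v x * ?b x \<partial>lborel) / A"
    let ?v = "\<lambda>x. (v x - \<kappa>) * ?b x"
    have vm': "?v \<in> borel_measurable borel"
      by (intro borel_measurable_times borel_measurable_diff borel_measurable_const vm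
          borel_measurable_continuous_onI smooth_line_continuous smooth_line_bump)
    have bd: "bounded (?b ` {-?R..?R})"
      by (intro compact_imp_bounded compact_continuous_image smooth_line_continuous) auto
    then obtain C where C: "\<And>x. x \<in> {-?R..?R} \<Longrightarrow> cmod (?b x) \<le> C"
      unfolding bounded_iff ball_simps by blast
    have "(\<lambda>x. ?I x * v x - ?I x * \<kappa>) \<in> line_L2"
      using L2_space_diff[OF v[of n] continuous_L2_Icc[OF continuous_on_const]] .
    then have vL2: "(\<lambda>x. ?I x * ?v x) \<in> line_L2"
    proof (rule L2_space_bound[where C = C])
      show "(\<lambda>x. ?I x * ?v x) \<in> borel_measurable lborel" using vm' by measurable
      show "AE x in lborel. cmod (?I x * ?v x) \<le> C * cmod (?I x * v x - ?I x * \<kappa>)"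
      proof (rule AE_I2)
        fix x show "cmod (?I x * ?v x) \<le> C * cmod (?I x * v x - ?I x * \<kappa>)"
          using mult_left_mono[OF C[of x], of "cmod (v x - \<kappa>)"]
          by (cases "x \<in> {-?R..?R}") (auto simp: norm_mult mult.commute)
      qed
    qed
    have "AE x in lebesgue_on (cbox (-?R) ?R). ?v x = 0"
    proof (rule polynomial_orthogonal_imp_AE_0)
      show "?v \<in> L2_space (lebesgue_on (cbox (-?R) ?R))"
        using L2_restrict_Icc(1)[OF vm'] vL2 by simp
      fix q :: "real \<Rightarrow> complex" assume q: "polynomial_function q"
      have sq: "smooth_line (\<lambda>x. q x * ?b x)" by (intro smooth_line_mult smooth_line_polynomial q smooth_line_bump)
      \<comment> \<open>This multiple of the bump makes the integral of \<open>?p\<close> zero, so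
        the primitive that starts with 0 at \<open>-?R\<close> returns to 0 at
        \<open>?R\<close>.\<close>
      define c where "c = (LINT x:{-?R..?R}|lborel. q x * ?b x) / A"
      let ?p = "\<lambda>x. q x * ?b x - c * ?b x"
      have sp: "smooth_line ?p" by (intro smooth_line_diff sq smooth_line_mult) auto
      obtain \<psi> where \<psi>: "\<And>x. (\<psi> has_vector_derivative ?p x) (at x)" "\<psi> (-?R) = 0"
        using smooth_line_antiderivative_exists[OF sp] by metis
      note FTC = FTC_smooth_line[OF sp \<psi>(1)]
      have p_out: "?p x = 0" if "x \<notin> {-?R<..<?R}" for x using that bump_eq_0[of x "-?R" ?R] by simp
      have flat: "\<psi> x = \<psi> y" if "x \<le> y" "{x..y} \<inter> {-?R<..<?R} = {}" for x y
      proof -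
        have "(LINT t:{x..y}|lborel. ?p t) = (LINT t:{x..y}|lborel. 0)"
        proof (intro set_lebesgue_integral_cong allI impI)
          fix t assume "t \<in> {x..y}"
          then have "t \<notin> {-?R<..<?R}" using that(2) by blast
          then show "?p t = 0" by (rule p_out)
        qed simp
        then show ?thesis using FTC[OF that(1)] by simp
      qed
      have si: "set_integrable lborel {-?R..?R} f" if "smooth_line f" for f
        by (intro borel_integrable_atLeastAtMost' smooth_line_continuous that)
      have "(LINT x:{-?R..?R}|lborel. ?p x) = c * A - c * A"
        using si[OF sq] si[OF smooth_line_bump] A
        by (simp add: set_integral_diff c_def A_def set_integral_mult_right)
      then have top: "\<psi> ?R = 0" using FTC[of "-?R" ?R] \<psi>(2) R by simp
      have \<psi>_out: "\<psi> x = 0" if "x \<notin> {-?R..?R}" for x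
      proof (cases "x < -?R")
        case True
        moreover have "{x..-?R} \<inter> {-?R<..<?R} = {}" by auto
        ultimately show ?thesis using flat[of x "-?R"] \<psi>(2) by simp
      next
        case False
        then have "?R \<le> x" using that by auto
        moreover have "{?R..x} \<inter> {-?R<..<?R} = {}" by auto
        ultimately show ?thesis using flat[of ?R x] top by simp
      qed
      have "(\<integral>x. v x * ?p x \<partial>lborel) = 0"
      proof (rule orth[OF sp \<psi>(1) R \<psi>_out])
        fix x assume "x \<notin> {-?R..?R}"
        then have "x \<notin> {-?R<..<?R}" by auto
        then show "?p x = 0" by (rule p_out)
      qed
      moreover have iq: "integrable lborel (\<lambda>x. v x * (q x * ?b x))" and ib: "integrable lborel (\<lambda>x. v x * ?b x)"
        using b_out by (auto intro!: int sq)
      moreover have "(\<lambda>x. v x * ?p x) = (\<lambda>x. v x * (q x * ?b x) - c * (v x * ?b x))"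
        by (auto simp: algebra_simps)
      ultimately have eq: "(\<integral>x. v x * (q x * ?b x) \<partial>lborel) = c * (\<kappa> * A)"
        using A by (simp add: \<kappa>_def)
      have *: "indicator {-?R..?R} x *\<^sub>R (?v x * q x) = v x * (q x * ?b x) - \<kappa> * (indicator {-?R..?R} x *\<^sub>R (q x * ?b x))" for x
        using b_out[of x] by (cases "x \<in> {-?R..?R}") (auto simp: algebra_simps)
      have "(\<integral>x. ?v x * q x \<partial>lebesgue_on (cbox (-?R) ?R)) = (LINT x:{-?R..?R}|lborel. ?v x * q x)"
        unfolding cbox_interval
        by (intro integral_lebesgue_on_borel(1) borel_measurable_times vm' borel_measurable_continuous_onI
            smooth_line_continuous smooth_line_polynomial q) simp
      also have "\<dots> = (\<integral>x. v x * (q x * ?b x) - \<kappa> * (indicator {-?R..?R} x *\<^sub>R (q x * ?b x)) \<partial>lborel)"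
        unfolding set_lebesgue_integral_def * ..
      also have "\<dots> = (\<integral>x. v x * (q x * ?b x) \<partial>lborel)
          - (\<integral>x. \<kappa> * (indicator {-?R..?R} x *\<^sub>R (q x * ?b x)) \<partial>lborel)"
        by (intro Bochner_Integration.integral_diff iq integrable_mult_right)
          (use si[OF sq] in \<open>simp only: set_integrable_def\<close>)
      also have "(\<integral>x. \<kappa> * (indicator {-?R..?R} x *\<^sub>R (q x * ?b x)) \<partial>lborel)
          = \<kappa> * (LINT x:{-?R..?R}|lborel. q x * ?b x)"
        by (simp only: integral_mult_right_zero set_lebesgue_integral_def)
      also have "\<dots> = \<kappa> * (c * A)" using A by (simp add: c_def)
      finally have "(\<integral>x. ?v x * q x \<partial>lebesgue_on (cbox (-?R) ?R)) = c * (\<kappa> * A) - \<kappa> * (c * A)"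
        unfolding eq .
      then show "(\<integral>x. ?v x * q x \<partial>lebesgue_on (cbox (-?R) ?R)) = 0" by simp
    qed
    then have "AE x in lebesgue. x \<in> {-?R..?R} \<longrightarrow> ?v x = 0"
      by (simp add: AE_restrict_space_iff)
    then have "AE x in lborel. x \<in> {-?R..?R} \<longrightarrow> ?v x = 0" by (simp only: AE_completion_iff)
    then have "AE x in lborel. x \<in> {-?R<..<?R} \<longrightarrow> v x = \<kappa>"
    proof eventually_elim
      case (elim x)
      show ?case
      proof
        assume "x \<in> {-?R<..<?R}"
        then show "v x = \<kappa>" using elim bump_nonzero[of x "-?R" ?R] by auto
      qed
    qed
    then show ?thesis by blast
  qed
  have "\<exists>c. \<forall>n. 0 < n \<longrightarrow> (AE x in lborel. x \<in> {-real n<..<real n} \<longrightarrow> v x = c n)"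
    by (intro choice allI) (use local in blast)
  then obtain c where c: "\<And>n. 0 < n \<Longrightarrow> AE x in lborel. x \<in> {-real n<..<real n} \<longrightarrow> v x = c n" by blast
  \<comment> \<open>All these intervals contain (-1, 1), which has positive measure, so the
    constants cannot differ.\<close>
  have same: "c n = c 1" if n: "0 < n" for n
  proof (rule ccontr)
    assume ne: "c n \<noteq> c 1"
    have "AE x in lborel. x \<notin> {-1<..<1::real}"
      using c[OF n] c[of 1, simplified]
    proof eventually_elim
      case (elim x)
      have "x \<in> {-real n<..<real n}" if "x \<in> {-1<..<1}" using n that by auto
      then show ?case using elim ne by auto
    qed
    moreover have "{x \<in> space lborel. \<not> x \<notin> {-1<..<1::real}} = {-1<..<1}" by auto
    ultimately have "emeasure lborel {-1<..<1::real} = 0"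
      using AE_iff_measurable[of "{-1<..<1::real}" lborel "\<lambda>x. x \<notin> {-1<..<1}"] by simp
    then show False by simp
  qed
  have "AE x in lborel. \<forall>n. 0 < n \<longrightarrow> x \<in> {-real n<..<real n} \<longrightarrow> v x = c n"
    unfolding AE_all_countable using c by auto
  then have "AE x in lborel. v x = c 1"
  proof eventually_elim
    case (elim x)
    obtain n where n: "\<bar>x\<bar> < real n" using reals_Archimedean2 by blast
    then have "0 < n" "x \<in> {-real n<..<real n}" by auto
    then show ?case using elim same by metis
  qed
  then show ?thesis by blast
qed

text \<open>\<open>f\<close> is the continuous representative of a Sobolev function on the line and
  \<open>h\<close> its weak derivative. Thus \<open>f 0\<close> is a genuine point value and can
  serve as the trace.\<close>

definition H1_line :: "(real \<Rightarrow> complex) \<Rightarrow> (real \<Rightarrow> complex) \<Rightarrow> bool" where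
  "H1_line f h \<longleftrightarrow> f \<in> line_L2 \<and> h \<in> line_L2 \<and> is_primitive f h"

text \<open>A primitive of \<open>h\<close> satisfies the same integration by parts as
  \<open>f\<close>, so their difference has weak derivative zero and is constant almost everywhere.
  Adding that constant to the primitive gives \<open>g\<close>.\<close>

lemma weak_derivative_imp_H1_line:
  assumes f: "f \<in> line_L2" and h: "h \<in> line_L2"
    and weak: "\<And>\<psi> p R. smooth_line p \<Longrightarrow> (\<And>x. (\<psi> has_vector_derivative p x) (at x)) \<Longrightarrow> 0 < R \<Longrightarrow>
      (\<And>x. x \<notin> {-R..R} \<Longrightarrow> \<psi> x = 0) \<Longrightarrow> (\<And>x. x \<notin> {-R..R} \<Longrightarrow> p x = 0) \<Longrightarrow>
      (\<integral>x. f x * p x \<partial>lborel) = - (\<integral>x. h x * \<psi> x \<partial>lborel)"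
  shows "\<exists>g. H1_line g h \<and> (AE x in lborel. f x = g x)"
proof -
  obtain H where H: "is_primitive H h" using is_primitive_exists[OF h] by blast
  have Hc: "continuous_on UNIV H" by (rule is_primitive_continuous[OF H h])
  then have Hm: "H \<in> borel_measurable borel" by (rule borel_measurable_continuous_onI)
  have fm: "f \<in> borel_measurable borel" using L2_spaceD(1)[OF f] by simp
  have "\<exists>c. AE x in lborel. f x - H x = c"
  proof (rule du_Bois_Reymond)
    show "(\<lambda>x. f x - H x) \<in> borel_measurable borel" using fm Hm by simp
    show "(\<lambda>x. of_real (indicator {-real n..real n} x) * (f x - H x)) \<in> line_L2" for n
    proof -
      have "(\<lambda>x. of_real (indicator {-real n..real n} x) * f x) \<in> line_L2"
        by (rule L2_space_bound[OF f, where C = 1]) (use fm in \<open>auto simp: norm_mult indicator_def\<close>)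
      from L2_space_diff[OF this continuous_L2_Icc[OF Hc]] show ?thesis by (simp add: right_diff_distrib)
    qed
    fix \<psi> p :: "real \<Rightarrow> complex" and R :: real
    assume *: "smooth_line p" "\<And>x. (\<psi> has_vector_derivative p x) (at x)" "0 < R"
      "\<And>x. x \<notin> {-R..R} \<Longrightarrow> \<psi> x = 0" "\<And>x. x \<notin> {-R..R} \<Longrightarrow> p x = 0"
    have "p \<in> line_L2"
      by (rule L2_compact_support(1)[of _ "{-R..R}" "{}"]) (use * in \<open>auto intro!: smooth_line_continuous\<close>)
    then have "integrable lborel (\<lambda>x. f x * p x)" by (rule L2_mult_integrable(1)[OF f])
    then show "(\<integral>x. (f x - H x) * p x \<partial>lborel) = 0"
      using primitive_integration_by_parts[OF H h *(1,2,4,5,3)] weak[OF *]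
      by (simp add: left_diff_distrib)
  qed
  then obtain c where c: "AE x in lborel. f x - H x = c" by blast
  then have AE: "AE x in lborel. f x = H x + c" by eventually_elim (simp add: algebra_simps)
  have "(\<lambda>x. H x + c) \<in> line_L2" by (rule L2_space_cong_AE[OF f AE]) (use Hm in simp)
  moreover have "is_primitive (\<lambda>x. H x + c) h" using H by (simp add: is_primitive_def)
  ultimately show ?thesis using AE h by (intro exI[of _ "\<lambda>x. H x + c"]) (simp add: H1_line_def)
qed

lemma L2_tail_tendsto_0:
  fixes f :: "real \<Rightarrow> complex"
  assumes f: "f \<in> line_L2"
  shows "(\<lambda>n. line_norm (\<lambda>x. if \<bar>x\<bar> \<le> real n then 0 else f x)) \<longlonglongrightarrow> 0"
    and "(\<lambda>x. if \<bar>x\<bar> \<le> real n then 0 else f x) \<in> line_L2"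
proof -
  note [measurable] = L2_spaceD(1)[OF f]
  have "(\<lambda>n. \<integral>x. (cmod (if \<bar>x\<bar> \<le> real n then 0 else f x))\<^sup>2 \<partial>lborel) \<longlonglongrightarrow> (\<integral>x. 0 \<partial>(lborel :: real measure))"
  proof (rule integral_dominated_convergence[where w = "\<lambda>x. (cmod (f x))\<^sup>2"])
    show "AE x in lborel. (\<lambda>n. (cmod (if \<bar>x\<bar> \<le> real n then 0 else f x))\<^sup>2) \<longlonglongrightarrow> 0"
    proof (rule AE_I2)
      fix x :: real
      have "\<forall>\<^sub>F n in sequentially. (cmod (if \<bar>x\<bar> \<le> real n then 0 else f x))\<^sup>2 = 0"
        using eventually_ge_at_top[of "nat \<lceil>\<bar>x\<bar>\<rceil>"]
        by eventually_elim (simp add: nat_le_iff ceiling_le_iff)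
      then show "(\<lambda>n. (cmod (if \<bar>x\<bar> \<le> real n then 0 else f x))\<^sup>2) \<longlonglongrightarrow> 0" by (rule tendsto_eventually)
    qed
  qed (use L2_spaceD(2)[OF f] in auto)
  then show "(\<lambda>n. line_norm (\<lambda>x. if \<bar>x\<bar> \<le> real n then 0 else f x)) \<longlonglongrightarrow> 0"
    by (intro L2_norm_tendsto_0) simp
  show "(\<lambda>x. if \<bar>x\<bar> \<le> real n then 0 else f x) \<in> line_L2"
    by (rule L2_space_bound[OF f, where C = 1]) auto
qed

text \<open>The approximant is a polynomial primitive times a cutoff.\<close>

lemma H1_line_approximation:
  assumes fh: "H1_line f h" and e: "0 < e"
  obtains P p R where "smooth_line p" "\<And>x. (P has_vector_derivative p x) (at x)" "P 0 = f 0"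
    and "\<And>x. x \<notin> {-R..R} \<Longrightarrow> P x = 0"
    and "line_norm (\<lambda>x. P x - f x) < e" "line_norm (\<lambda>x. p x - h x) < e"
proof -
  have f: "f \<in> line_L2" and h: "h \<in> line_L2" and prim: "is_primitive f h"
    using fh by (auto simp: H1_line_def)
  have [measurable]: "f \<in> borel_measurable borel" "h \<in> borel_measurable borel"
    using L2_spaceD(1)[OF f] L2_spaceD(1)[OF h] by auto
  obtain \<eta> where \<eta>: "smooth_line \<eta>" "\<And>x. x \<in> {-1..1} \<Longrightarrow> \<eta> x = 1" "\<And>x. x \<notin> {-2<..<2} \<Longrightarrow> \<eta> x = 0"
    using cutoff_exists by blast
  define \<eta>' where "\<eta>' x = vector_derivative \<eta> (at x)" for x
  have \<eta>': "smooth_line \<eta>'" "\<And>x. (\<eta> has_vector_derivative \<eta>' x) (at x)"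
    unfolding \<eta>'_def using smooth_line_vector_derivative[OF \<eta>(1)] smooth_line_has_derivative[OF \<eta>(1)] by auto
  have \<eta>'0: "\<eta>' x = 0" if "x \<notin> {-2..2}" for x
  proof -
    have "(\<eta> has_vector_derivative 0) (at x)"
      by (rule has_vector_derivative_transform_within_open[of "\<lambda>x. 0" _ _ "- {-2..2}"])
        (use that \<eta>(3) in \<open>auto intro!: open_Compl\<close>)
    then show ?thesis using \<eta>'(2)[of x] vector_derivative_unique_at by blast
  qed
  have bd: "bounded (\<eta> ` {-2..2})" "bounded (\<eta>' ` {-2..2})"
    by (intro compact_imp_bounded compact_continuous_image smooth_line_continuous \<eta> \<eta>', simp)+
  obtain C1 where C1: "\<And>x. x \<in> {-2..2} \<Longrightarrow> cmod (\<eta> x) \<le> C1" using bd(1) unfolding bounded_iff ball_simps by blast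
  obtain C2 where C2: "\<And>x. x \<in> {-2..2} \<Longrightarrow> cmod (\<eta>' x) \<le> C2" using bd(2) unfolding bounded_iff ball_simps by blast
  \<comment> \<open>A common bound for the cutoff and its derivative, at least 1 so that
    \<open>2 * C\<close> bounds the distance of the cutoff from 1.\<close>
  define C where "C = max 1 (max C1 C2)"
  have C: "cmod (\<eta> x) \<le> C" "cmod (\<eta>' x) \<le> C" "1 \<le> C" for x
    using C1[of x] C2[of x] \<eta>(3)[of x] \<eta>'0[of x] by (cases "x \<in> {-2..2}"; force simp: C_def)+
  let ?tf = "\<lambda>n::nat. line_norm (\<lambda>x. if \<bar>x\<bar> \<le> real n then 0 else f x)"
  let ?th = "\<lambda>n::nat. line_norm (\<lambda>x. if \<bar>x\<bar> \<le> real n then 0 else h x)"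
  have "\<forall>\<^sub>F n in sequentially. ?tf n < e / (8 * C)" "\<forall>\<^sub>F n in sequentially. ?th n < e / (8 * C)"
    by (intro order_tendstoD(2)[OF L2_tail_tendsto_0(1)] f h; use e C(3) in simp)+
  moreover have "(\<lambda>n. (C * line_norm f) * inverse (real n)) \<longlonglongrightarrow> (C * line_norm f) * 0"
    by (intro tendsto_intros lim_inverse_n)
  then have "\<forall>\<^sub>F n in sequentially. (C * line_norm f) * inverse (real n) < e / 4"
    by (rule order_tendstoD(2)) (use e in simp)
  ultimately have "\<forall>\<^sub>F n in sequentially. ?tf n < e / (8 * C) \<and> ?th n < e / (8 * C) \<and>
      (C * line_norm f) * inverse (real n) < e / 4 \<and> 0 < n"
    using eventually_gt_at_top[of 0] by eventually_elim simp
  from eventually_happens'[OF sequentially_bot this]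
  obtain n where n: "?tf n < e / (8 * C)" "?th n < e / (8 * C)"
    "(C * line_norm f) * inverse (real n) < e / 4" "0 < n" by (elim exE conjE)
  \<comment> \<open>The cutoff is stretched by the factor \<open>n\<close>: it is 1 on [-n, n] and
    vanishes outside [-2n, 2n].\<close>
  define R where "R = 2 * real n"
  have R: "0 < R" "2 \<le> R" using n(4) by (auto simp: R_def)
  \<comment> \<open>A uniform error \<open>sqrt R * \<delta>\<close> on an interval of length
    \<open>2 * R\<close>, times a factor of size at most \<open>C\<close>, costs
    \<open>sqrt 2 * R * \<delta> * C\<close> in L^2. This choice keeps that below e / 4.\<close>
  define \<delta> where "\<delta> = e / (8 * C * R)"
  have \<delta>: "0 < \<delta>" using e R C(3) by (simp add: \<delta>_def)
  let ?a = "inverse (real n)"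
  have a: "0 < ?a" "?a \<le> 1" using n(4) by (auto simp: field_simps)
  let ?\<eta> = "\<lambda>x. \<eta> (?a * x + 0)" and ?\<eta>' = "\<lambda>x. of_real ?a * \<eta>' (?a * x + 0)"
  have s\<eta>: "smooth_line ?\<eta>" "smooth_line ?\<eta>'"
    by (intro smooth_line_mult smooth_line_const smooth_line_affine \<eta> \<eta>')+
  have d\<eta>: "(?\<eta> has_vector_derivative ?\<eta>' x) (at x)" for x
  proof -
    have "((\<lambda>x. ?a * x + 0) has_vector_derivative ?a) (at x)"
      by (auto intro!: derivative_eq_intros simp: has_real_derivative_iff_has_vector_derivative[symmetric])
    from vector_diff_chain_at[OF this \<eta>'(2)] show ?thesis by (simp add: o_def scaleR_conv_of_real)
  qed
  have out: "?\<eta> x = 0" "?\<eta>' x = 0" if "x \<notin> {-R..R}" for x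
  proof -
    have "?a * x + 0 \<notin> {-2..2}" using that n(4) by (auto simp: R_def field_simps)
    then show "?\<eta> x = 0" "?\<eta>' x = 0" using \<eta>(3)[of "?a * x + 0"] \<eta>'0[of "?a * x + 0"] by auto
  qed
  have one: "?\<eta> x = 1" if "\<bar>x\<bar> \<le> real n" for x
    using that n(4) by (intro \<eta>(2)) (auto simp: field_simps abs_le_iff)
  have b\<eta>: "cmod (?\<eta> x) \<le> C" "cmod (?\<eta>' x) \<le> C" "cmod (?\<eta>' x) \<le> C * ?a" for x
  proof -
    show "cmod (?\<eta> x) \<le> C" by (rule C)
    show *: "cmod (?\<eta>' x) \<le> C * ?a"
      using mult_left_mono[OF C(2)[of "?a * x + 0"], of ?a] a by (simp add: norm_mult norm_inverse mult.commute)
    show "cmod (?\<eta>' x) \<le> C" using mult_left_mono[OF a(2), of C] C(3) by (intro order_trans[OF *]) simp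
  qed
  obtain Q q where q: "smooth_line q" "\<And>x. (Q has_vector_derivative q x) (at x)" "Q 0 = f 0"
    and d: "(\<lambda>x. of_real (indicator {-R..R} x) * (q x - h x)) \<in> line_L2"
      "line_norm (\<lambda>x. of_real (indicator {-R..R} x) * (q x - h x)) < \<delta>"
    and close: "\<And>x. x \<in> {-R..R} \<Longrightarrow> cmod (Q x - f x) \<le> sqrt R * \<delta>"
    by (rule primitive_approximation[OF prim h R(1) \<delta>], rule that)
  have sQ: "smooth_line Q" by (rule smooth_line_antiderivative[OF q(1,2)])
  define P where "P x = Q x * ?\<eta> x" for x
  define p where "p x = Q x * ?\<eta>' x + q x * ?\<eta> x" for x
  have sp: "smooth_line p" unfolding p_def by (intro smooth_line_add smooth_line_mult sQ q s\<eta>)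
  have dP: "(P has_vector_derivative p x) (at x)" for x
    unfolding P_def p_def by (intro has_vector_derivative_mult q d\<eta>)
  have \<eta>m [measurable]: "?\<eta> \<in> borel_measurable borel" "?\<eta>' \<in> borel_measurable borel"
      "Q \<in> borel_measurable borel" "q \<in> borel_measurable borel"
    by (intro borel_measurable_continuous_onI smooth_line_continuous s\<eta> sQ q)+
  note ind = L2_indicator_Icc[of "-R" R]
  have ind_norm: "line_norm (\<lambda>x. of_real (indicator {-R..R} x)) \<le> sqrt R * sqrt 2"
    using ind(2) R by (simp add: real_sqrt_mult[symmetric])
  have ap: "(\<lambda>x. (Q x - f x) * k x) \<in> line_L2 \<and> line_norm (\<lambda>x. (Q x - f x) * k x) \<le> e / 4"
    if k: "\<And>x. x \<notin> {-R..R} \<Longrightarrow> k x = 0" "\<And>x. cmod (k x) \<le> C" "k \<in> borel_measurable borel" for k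
  proof -
    have AE: "AE x in lborel. cmod ((Q x - f x) * k x) \<le> (sqrt R * \<delta> * C) * cmod (of_real (indicator {-R..R} x))"
    proof (rule AE_I2)
      fix x
      show "cmod ((Q x - f x) * k x) \<le> (sqrt R * \<delta> * C) * cmod (of_real (indicator {-R..R} x))"
      proof (cases "x \<in> {-R..R}")
        case True
        have "cmod ((Q x - f x) * k x) \<le> (sqrt R * \<delta>) * C"
          unfolding norm_mult using close[OF True] k(2)[of x] \<delta> R by (intro mult_mono) auto
        then show ?thesis using True by simp
      next
        case False
        then show ?thesis using k(1) by simp
      qed
    qed
    have m: "(\<lambda>x. (Q x - f x) * k x) \<in> borel_measurable lborel" using k(3) by measurable
    have "line_norm (\<lambda>x. (Q x - f x) * k x) \<le> (sqrt R * \<delta> * C) * line_norm (\<lambda>x. of_real (indicator {-R..R} x))"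
      by (rule L2_norm_bound[OF ind(1) m _ AE]) (use R \<delta> C(3) in auto)
    also have "\<dots> \<le> (sqrt R * \<delta> * C) * (sqrt R * sqrt 2)"
      using ind_norm R \<delta> C(3) by (intro mult_left_mono) auto
    also have "\<dots> = (sqrt R * sqrt R) * C * \<delta> * sqrt 2" by (simp only: mult_ac)
    also have "\<dots> = e / 8 * sqrt 2" using R C(3) by (simp add: \<delta>_def)
    also have "\<dots> \<le> e / 8 * 2"
      using e real_sqrt_le_iff[of 2 4] by (intro mult_left_mono) (auto simp: real_le_lsqrt)
    finally show ?thesis using L2_space_bound[OF ind(1) m AE] R by simp
  qed
  have tail: "(\<lambda>x. g x * (?\<eta> x - 1)) \<in> line_L2 \<and>
      line_norm (\<lambda>x. g x * (?\<eta> x - 1)) < e / 4"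
    if g: "g \<in> line_L2" "line_norm (\<lambda>x. if \<bar>x\<bar> \<le> real n then 0 else g x) < e / (8 * C)" for g
  proof -
    have [measurable]: "g \<in> borel_measurable borel" using L2_spaceD(1)[OF g(1)] by simp
    have AE: "AE x in lborel. cmod (g x * (?\<eta> x - 1)) \<le> (2 * C) * cmod (if \<bar>x\<bar> \<le> real n then 0 else g x)"
    proof (rule AE_I2)
      fix x
      have "cmod (?\<eta> x - 1) \<le> 2 * C"
        using norm_triangle_ineq4[of "?\<eta> x" 1] b\<eta>(1)[of x] C(3) by simp
      then show "cmod (g x * (?\<eta> x - 1)) \<le> (2 * C) * cmod (if \<bar>x\<bar> \<le> real n then 0 else g x)"
        using one[of x] mult_right_mono[of "cmod (?\<eta> x - 1)" "2 * C" "cmod (g x)"]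
        by (auto simp: norm_mult mult.commute)
    qed
    have m: "(\<lambda>x. g x * (?\<eta> x - 1)) \<in> borel_measurable lborel" by measurable
    note t = L2_tail_tendsto_0(2)[OF g(1), of n]
    have "line_norm (\<lambda>x. g x * (?\<eta> x - 1)) \<le> (2 * C) * line_norm (\<lambda>x. if \<bar>x\<bar> \<le> real n then 0 else g x)"
      by (rule L2_norm_bound[OF t m _ AE]) (use C(3) in simp)
    also have "\<dots> < (2 * C) * (e / (8 * C))" using g(2) C(3) by (intro mult_strict_left_mono) auto
    also have "\<dots> = e / 4" using C(3) by simp
    finally show ?thesis using L2_space_bound[OF t m AE] by simp
  qed
  have near: "(\<lambda>x. (q x - h x) * ?\<eta> x) \<in> line_L2 \<and> line_norm (\<lambda>x. (q x - h x) * ?\<eta> x) \<le> e / 8"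
  proof -
    have AE: "AE x in lborel. cmod ((q x - h x) * ?\<eta> x) \<le> C * cmod (of_real (indicator {-R..R} x) * (q x - h x))"
    proof (rule AE_I2)
      fix x
      show "cmod ((q x - h x) * ?\<eta> x) \<le> C * cmod (of_real (indicator {-R..R} x) * (q x - h x))"
        using mult_right_mono[OF b\<eta>(1)[of x], of "cmod (q x - h x)"] out(1)[of x]
        by (cases "x \<in> {-R..R}") (auto simp: norm_mult mult.commute)
    qed
    have m: "(\<lambda>x. (q x - h x) * ?\<eta> x) \<in> borel_measurable lborel" by measurable
    have "line_norm (\<lambda>x. (q x - h x) * ?\<eta> x) \<le> C * line_norm (\<lambda>x. of_real (indicator {-R..R} x) * (q x - h x))"
      by (rule L2_norm_bound[OF d(1) m _ AE]) (use C(3) in simp)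
    also have "\<dots> \<le> C * \<delta>" using d(2) C(3) by (intro mult_left_mono) auto
    also have "\<dots> = e / (8 * R)" using C(3) by (simp add: \<delta>_def)
    also have "\<dots> \<le> e / 8" using R e by (simp add: field_simps)
    finally show ?thesis using L2_space_bound[OF d(1) m AE] by simp
  qed
  \<comment> \<open>Here the derivative falls on the stretched cutoff, which gains a factor 1 /
    n.\<close>
  have drift: "(\<lambda>x. f x * ?\<eta>' x) \<in> line_L2 \<and> line_norm (\<lambda>x. f x * ?\<eta>' x) < e / 4"
  proof -
    have AE: "AE x in lborel. cmod (f x * ?\<eta>' x) \<le> (C * ?a) * cmod (f x)"
    proof (rule AE_I2)
      fix x show "cmod (f x * ?\<eta>' x) \<le> (C * ?a) * cmod (f x)"
        unfolding norm_mult[of "f x"] using mult_right_mono[OF b\<eta>(3)[of x], of "cmod (f x)"]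
        by (simp only: mult.commute[of "cmod (f x)"] norm_ge_zero simp_thms)
    qed
    have m: "(\<lambda>x. f x * ?\<eta>' x) \<in> borel_measurable lborel" by measurable
    have "line_norm (\<lambda>x. f x * ?\<eta>' x) \<le> (C * ?a) * line_norm f"
      by (rule L2_norm_bound[OF f m _ AE]) (use C(3) in simp)
    also have "\<dots> < e / 4" using n(3) by (simp add: mult_ac)
    finally show ?thesis using L2_space_bound[OF f m AE] by simp
  qed
  note apx = ap[of ?\<eta>, OF out(1) b\<eta>(1) \<eta>m(1)] ap[of ?\<eta>', OF out(2) b\<eta>(2) \<eta>m(2)]
  note tails = tail[OF f n(1)] tail[OF h n(2)]
  have "line_norm (\<lambda>x. P x - f x) = line_norm (\<lambda>x. (Q x - f x) * ?\<eta> x + f x * (?\<eta> x - 1))"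
    by (simp add: P_def algebra_simps)
  also have "\<dots> \<le> line_norm (\<lambda>x. (Q x - f x) * ?\<eta> x) + line_norm (\<lambda>x. f x * (?\<eta> x - 1))"
    using apx tails by (intro L2_norm_triangle) auto
  also have "\<dots> < e" using apx tails e by linarith
  finally have Pf: "line_norm (\<lambda>x. P x - f x) < e" .
  \<comment> \<open>The product rule splits the error into those of \<open>q\<close> and
    \<open>Q\<close>, the tail of \<open>h\<close>, and the derivative of the cutoff. The four
    bounds add up to 7 e / 8.\<close>
  have "line_norm (\<lambda>x. p x - h x) = line_norm
      (\<lambda>x. ((q x - h x) * ?\<eta> x + (Q x - f x) * ?\<eta>' x) + (h x * (?\<eta> x - 1) + f x * ?\<eta>' x))"
    by (simp add: p_def algebra_simps)
  also have "\<dots> \<le> line_norm (\<lambda>x. (q x - h x) * ?\<eta> x + (Q x - f x) * ?\<eta>' x)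
      + line_norm (\<lambda>x. h x * (?\<eta> x - 1) + f x * ?\<eta>' x)"
    using apx tails near drift by (intro L2_norm_triangle L2_space_add) auto
  also have "\<dots> \<le> (line_norm (\<lambda>x. (q x - h x) * ?\<eta> x) + line_norm (\<lambda>x. (Q x - f x) * ?\<eta>' x))
      + (line_norm (\<lambda>x. h x * (?\<eta> x - 1)) + line_norm (\<lambda>x. f x * ?\<eta>' x))"
    using apx tails near drift by (intro add_mono L2_norm_triangle) auto
  also have "\<dots> < e" using apx tails near drift e by linarith
  finally have ph: "line_norm (\<lambda>x. p x - h x) < e" .
  show ?thesis
  proof (rule that[OF sp dP _ _ Pf ph])
    show "P 0 = f 0" using q(3) \<eta>(2)[of 0] by (simp add: P_def)
    show "P x = 0" if "x \<notin> {-R..R}" for x using out(1)[OF that] by (simp add: P_def)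
  qed
qed


section \<open>The trace\<close>

lemma partial_test_L2:
  assumes "\<phi> \<in> test_functions \<Omega>" "e \<in> {(1, 0), (0, 1)}"
  shows "partial e \<phi> \<in> strip_L2 L"
  by (rule test_functions_L2[OF test_functions_partial[OF assms]])

lemma is_weak_partial_test:
  assumes "\<phi> \<in> test_functions \<Omega>" "e \<in> {(1, 0), (0, 1)}"
  shows "is_weak_partial L e \<phi> (partial e \<phi>)"
  by (rule is_weak_partial_smooth[OF test_functions_smooth[OF assms(1)] partial_test_L2[OF assms] assms(2)])

text \<open>Both sides of the weak identity are continuous in the L^2 norm, so weak derivatives
  survive limits.\<close>

lemma is_weak_partial_limit:
  assumes \<phi>: "\<And>n. \<phi> n \<in> test_functions UNIV" and e: "e \<in> {(1, 0), (0, 1)}"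
    and u: "u \<in> strip_L2 L" and g: "g \<in> strip_L2 L"
    and lim: "(\<lambda>n. strip_norm L (\<lambda>z. \<phi> n z - u z)) \<longlonglongrightarrow> 0"
      "(\<lambda>n. strip_norm L (\<lambda>z. partial e (\<phi> n) z - g z)) \<longlonglongrightarrow> 0"
  shows "is_weak_partial L e u g"
  unfolding is_weak_partial_def
proof (intro conjI ballI g)
  fix \<psi> assume \<psi>: "\<psi> \<in> test_functions (interior (strip L))"
  have "(\<lambda>n. \<integral>z. \<phi> n z * partial e \<psi> z \<partial>strip_measure L) \<longlonglongrightarrow> (\<integral>z. u z * partial e \<psi> z \<partial>strip_measure L)"
    by (rule L2_integral_tendsto[OF test_functions_L2[OF \<phi>] u partial_test_L2[OF \<psi> e] lim(1)])
  moreover have "(\<lambda>n. - (\<integral>z. partial e (\<phi> n) z * \<psi> z \<partial>strip_measure L)) \<longlonglongrightarrow> - (\<integral>z. g z * \<psi> z \<partial>strip_measure L)"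
    by (intro tendsto_minus L2_integral_tendsto[OF partial_test_L2[OF \<phi> e] g test_functions_L2[OF \<psi>] lim(2)])
  moreover have "(\<integral>z. \<phi> n z * partial e \<psi> z \<partial>strip_measure L) = - (\<integral>z. partial e (\<phi> n) z * \<psi> z \<partial>strip_measure L)" for n
    using is_weak_partial_test[OF \<phi> e, of L n] \<psi> by (simp add: is_weak_partial_def)
  ultimately show "(\<integral>z. u z * partial e \<psi> z \<partial>strip_measure L) = - (\<integral>z. g z * \<psi> z \<partial>strip_measure L)"
    using LIMSEQ_unique by simp
qed

lemma L2_norm_weak_partial:
  assumes "u \<in> strip_L2 L" "is_weak_partial L e u g" "e \<in> {(1, 0), (0, 1)}"
  shows "strip_norm L (weak_partial L e u) = strip_norm L g"
proof (rule L2_norm_eqI)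
  show "AE z in strip_measure L. cmod (weak_partial L e u z) = cmod (g z)"
    using weak_partial_AE_eq(1)[OF assms] by eventually_elim simp
  show "weak_partial L e u \<in> borel_measurable (strip_measure L)" "g \<in> borel_measurable (strip_measure L)"
    using weak_partial_AE_eq(2)[OF assms] assms(2) by (auto simp: is_weak_partial_def dest: L2_spaceD)
qed

lemma H1_norm_eq:
  assumes "u \<in> strip_L2 L" "is_weak_partial L (1, 0) u g" "is_weak_partial L (0, 1) u h"
  shows "H1_norm L u = sqrt ((strip_norm L u)\<^sup>2
    + ((strip_norm L g)\<^sup>2 + (strip_norm L h)\<^sup>2))"
  using assms by (simp add: H1_norm_def grad_norm_def L2_norm_weak_partial)

text \<open>\<open>H1_norm\<close> involves chosen weak derivatives. By their uniqueness,
  convergence in it reduces to three L^2 limits with explicit candidates \<open>g\<close> and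
  \<open>h\<close>, which these limits also identify as weak derivatives.\<close>

lemma trace_limit:
  assumes \<phi>: "\<And>n. \<phi> n \<in> test_functions UNIV"
    and u: "u \<in> strip_L2 L" and g: "g \<in> strip_L2 L"
    and h: "h \<in> strip_L2 L" and t: "t \<in> L2_space (lebesgue_on {0..L})"
    and lim: "(\<lambda>n. strip_norm L (\<lambda>z. \<phi> n z - u z)) \<longlonglongrightarrow> 0"
      "(\<lambda>n. strip_norm L (\<lambda>z. partial (1, 0) (\<phi> n) z - g z)) \<longlonglongrightarrow> 0"
      "(\<lambda>n. strip_norm L (\<lambda>z. partial (0, 1) (\<phi> n) z - h z)) \<longlonglongrightarrow> 0"
      "(\<lambda>n. L2_norm (lebesgue_on {0..L}) (\<lambda>y. \<phi> n (0, y) - t y)) \<longlonglongrightarrow> 0"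
  shows "is_weak_partial L (1, 0) u g" "is_weak_partial L (0, 1) u h" "is_trace L u t"
proof -
  show wg: "is_weak_partial L (1, 0) u g" by (rule is_weak_partial_limit[OF \<phi> _ u g lim(1,2)]) simp
  show wh: "is_weak_partial L (0, 1) u h" by (rule is_weak_partial_limit[OF \<phi> _ u h lim(1,3)]) simp
  have "H1_norm L (\<lambda>z. \<phi> n z - u z) = sqrt ((strip_norm L (\<lambda>z. \<phi> n z - u z))\<^sup>2
      + ((strip_norm L (\<lambda>z. partial (1, 0) (\<phi> n) z - g z))\<^sup>2
        + (strip_norm L (\<lambda>z. partial (0, 1) (\<phi> n) z - h z))\<^sup>2))" for n
    by (intro H1_norm_eq L2_space_diff is_weak_partial_diff test_functions_L2[OF \<phi>] is_weak_partial_test[OF \<phi>] u wg wh) auto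
  moreover have "(\<lambda>n. sqrt ((strip_norm L (\<lambda>z. \<phi> n z - u z))\<^sup>2
      + ((strip_norm L (\<lambda>z. partial (1, 0) (\<phi> n) z - g z))\<^sup>2
        + (strip_norm L (\<lambda>z. partial (0, 1) (\<phi> n) z - h z))\<^sup>2))) \<longlonglongrightarrow> sqrt (0\<^sup>2 + (0\<^sup>2 + 0\<^sup>2))"
    by (intro tendsto_intros lim)
  ultimately have "(\<lambda>n. H1_norm L (\<lambda>z. \<phi> n z - u z)) \<longlonglongrightarrow> 0" by simp
  then show "is_trace L u t"
    unfolding is_trace_def H1_def using u wg wh t \<phi> lim(4) by blast
qed

text \<open>Converse of \<open>trace_limit\<close>: the norm dominates each of its three components,
  whichever weak derivatives \<open>g\<close> and \<open>h\<close> are used.\<close>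

lemma is_trace_cases:
  assumes "is_trace L u t" "is_weak_partial L (1, 0) u g" "is_weak_partial L (0, 1) u h"
  obtains \<phi> where "\<And>n. \<phi> n \<in> test_functions UNIV"
    and "(\<lambda>n. strip_norm L (\<lambda>z. \<phi> n z - u z)) \<longlonglongrightarrow> 0"
      "(\<lambda>n. strip_norm L (\<lambda>z. partial (1, 0) (\<phi> n) z - g z)) \<longlonglongrightarrow> 0"
      "(\<lambda>n. strip_norm L (\<lambda>z. partial (0, 1) (\<phi> n) z - h z)) \<longlonglongrightarrow> 0"
      "(\<lambda>n. L2_norm (lebesgue_on {0..L}) (\<lambda>y. \<phi> n (0, y) - t y)) \<longlonglongrightarrow> 0"
proof -
  have u: "u \<in> strip_L2 L" using assms(1) by (simp add: is_trace_def H1_def)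
  obtain \<phi> where \<phi>: "\<And>n. \<phi> n \<in> test_functions UNIV"
    and lim: "(\<lambda>n. H1_norm L (\<lambda>z. \<phi> n z - u z)) \<longlonglongrightarrow> 0"
      "(\<lambda>n. L2_norm (lebesgue_on {0..L}) (\<lambda>y. \<phi> n (0, y) - t y)) \<longlonglongrightarrow> 0"
    using assms(1) by (auto simp: is_trace_def)
  have eq: "H1_norm L (\<lambda>z. \<phi> n z - u z) = sqrt ((strip_norm L (\<lambda>z. \<phi> n z - u z))\<^sup>2
      + ((strip_norm L (\<lambda>z. partial (1, 0) (\<phi> n) z - g z))\<^sup>2
        + (strip_norm L (\<lambda>z. partial (0, 1) (\<phi> n) z - h z))\<^sup>2))" for n
    by (intro H1_norm_eq L2_space_diff is_weak_partial_diff test_functions_L2[OF \<phi>] is_weak_partial_test[OF \<phi>] u assms) auto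
  have le: "strip_norm L (\<lambda>z. \<phi> n z - u z) \<le> H1_norm L (\<lambda>z. \<phi> n z - u z)"
    "strip_norm L (\<lambda>z. partial (1, 0) (\<phi> n) z - g z) \<le> H1_norm L (\<lambda>z. \<phi> n z - u z)"
    "strip_norm L (\<lambda>z. partial (0, 1) (\<phi> n) z - h z) \<le> H1_norm L (\<lambda>z. \<phi> n z - u z)" for n
    unfolding eq by (intro real_le_rsqrt; simp)+
  show ?thesis
    by (rule that[OF \<phi>]; (rule lim(2))?; rule Lim_null_comparison[OF _ lim(1)]; use le in simp)
qed

text \<open>The squared modulus at 0 is the integral of its derivative over the left half of the
  interval, and minus that over the right half. Averaging both expressions and applying Young's
  inequality with weight \<open>\<kappa>\<close> gives constants that are sharp: exp (-\<kappa> |x|)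
  is extremal on the line.\<close>

lemma pointwise_trace_bound:
  assumes p: "smooth_line p" "\<And>x. (\<psi> has_vector_derivative p x) (at x)" and "0 < \<kappa>" "0 < R"
    and out: "\<And>x. x \<notin> {-R<..<R} \<Longrightarrow> \<psi> x = 0"
  shows "(cmod (\<psi> 0))\<^sup>2 \<le> (LINT x:{-R..R}|lborel. \<kappa> / 2 * (cmod (\<psi> x))\<^sup>2 + 1 / (2 * \<kappa>) * (cmod (p x))\<^sup>2)"
proof -
  let ?w = "\<lambda>x. \<kappa> / 2 * (cmod (\<psi> x))\<^sup>2 + 1 / (2 * \<kappa>) * (cmod (p x))\<^sup>2"
  let ?m = "\<lambda>x. \<psi> x \<bullet> \<psi> x" and ?m' = "\<lambda>x. \<psi> x \<bullet> p x + p x \<bullet> \<psi> x"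
  have s\<psi>: "smooth_line \<psi>" by (rule smooth_line_antiderivative[OF p])
  have c: "continuous_on S ?w" "continuous_on S ?m'" for S
    by (intro continuous_intros smooth_line_continuous p s\<psi>)+
  have d: "(?m has_vector_derivative ?m' x) (at x within S)" for x S
    using has_derivative_inner[OF p(2)[unfolded has_vector_derivative_def, of x] p(2)[unfolded has_vector_derivative_def, of x]]
    by (auto simp: has_vector_derivative_def algebra_simps intro: has_derivative_at_withinI)
  have si: "set_integrable lborel {a..b} ?w" "set_integrable lborel {a..b} ?m'" for a b
    by (intro borel_integrable_atLeastAtMost' c)+
  have FTC: "(LINT x:{a..b}|lborel. ?m' x) = ?m b - ?m a" if "a \<le> b" for a b
    unfolding set_lebesgue_integral_def by (rule integral_FTC_Icc[OF that d c(2)])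
  have le: "\<bar>?m' x\<bar> \<le> 2 * ?w x" for x
  proof -
    have "\<bar>?m' x\<bar> = 2 * \<bar>\<psi> x \<bullet> p x\<bar>" by (simp add: inner_commute)
    also have "\<dots> \<le> 2 * (cmod (\<psi> x) * cmod (p x))" using Cauchy_Schwarz_ineq2[of "\<psi> x" "p x"] by simp
    also have "\<dots> \<le> 2 * ?w x" using weighted_arith_geo_le[OF \<open>0 < \<kappa>\<close>, of "cmod (\<psi> x)" "cmod (p x)"] by simp
    finally show ?thesis .
  qed
  have "?m 0 - ?m (-R) \<le> (LINT x:{-R..0}|lborel. 2 * ?w x)"
  proof -
    have "(LINT x:{-R..0}|lborel. ?m' x) \<le> (LINT x:{-R..0}|lborel. 2 * ?w x)"
      by (intro set_integral_mono si set_integrable_mult_right abs_le_D1[OF le])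
    then show ?thesis using FTC[of "-R" 0] \<open>0 < R\<close> by simp
  qed
  moreover have "- (?m R - ?m 0) \<le> (LINT x:{0..R}|lborel. 2 * ?w x)"
  proof -
    have "- 2 * ?w x \<le> ?m' x" for x using abs_le_D2[OF le[of x]] by linarith
    then have "(LINT x:{0..R}|lborel. - 2 * ?w x) \<le> (LINT x:{0..R}|lborel. ?m' x)"
      by (intro set_integral_mono si set_integrable_mult_right)
    then show ?thesis using FTC[of 0 R] \<open>0 < R\<close> by (simp only: set_integral_mult_right)
  qed
  moreover have "?m R = 0" "?m (-R) = 0" using out[of R] out[of "-R"] by auto
  moreover have "(LINT x:{-R..R}|lborel. ?w x) = (LINT x:{-R..0}|lborel. ?w x) + (LINT x:{0..R}|lborel. ?w x)"
  proof -
    have "(LINT x:{-R..0} \<union> {0..R}|lborel. ?w x) = (LINT x:{-R..0}|lborel. ?w x) + (LINT x:{0..R}|lborel. ?w x)"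
    proof (rule set_integral_Un_AE)
      show "AE x in lborel. \<not> (x \<in> {-R..0} \<and> x \<in> {0..R})"
        using AE_lborel_singleton[of 0] by eventually_elim auto
    qed (use si in auto)
    moreover have "{-R..0} \<union> {0..R} = {-R..R}" using \<open>0 < R\<close> by auto
    ultimately show ?thesis by simp
  qed
  moreover have "?m 0 = (cmod (\<psi> 0))\<^sup>2" by (simp add: power2_norm_eq_inner)
  ultimately show ?thesis unfolding set_integral_mult_right by linarith
qed

text \<open>\<open>pointwise_trace_bound\<close> on every horizontal line, integrated in y with
  Fubini's theorem.\<close>

lemma trace_bound_test:
  assumes \<phi>: "\<phi> \<in> test_functions \<Omega>" and "0 < \<kappa>"
  shows "(L2_norm (lebesgue_on {0..L}) (\<lambda>y. \<phi> (0, y)))\<^sup>2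
    \<le> \<kappa> / 2 * (strip_norm L \<phi>)\<^sup>2 + 1 / (2 * \<kappa>) * (strip_norm L (partial (1, 0) \<phi>))\<^sup>2"
proof -
  let ?p = "partial (1, 0) \<phi>"
  let ?w = "\<lambda>z. \<kappa> / 2 * (cmod (\<phi> z))\<^sup>2 + 1 / (2 * \<kappa>) * (cmod (?p z))\<^sup>2"
  have s: "smooth \<phi>" by (rule test_functions_smooth[OF \<phi>])
  then have sp: "smooth ?p" by (rule smooth_partial) simp
  have p_test: "?p \<in> test_functions \<Omega>" using test_functions_partial[OF \<phi>] by simp
  obtain R1 where R1: "0 < R1" "\<And>z. z \<notin> {-R1..R1} \<times> {-R1..R1} \<Longrightarrow> \<phi> z = 0"
    using test_functions_box[OF \<phi>] by metis
  obtain R2 where R2: "0 < R2" "\<And>z. z \<notin> {-R2..R2} \<times> {-R2..R2} \<Longrightarrow> ?p z = 0"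
    using test_functions_box[OF p_test] by metis
  \<comment> \<open>The summand 1 makes the slices vanish at the endpoints as well, as the open
    interval in \<open>pointwise_trace_bound\<close> demands.\<close>
  define R where "R = max R1 R2 + 1"
  have le_R: "R1 < R" "R2 < R" by (auto simp: R_def)
  have R_pos: "0 < R" using le_R R1(1) by simp
  have R: "\<phi> (x, y) = 0" "?p (x, y) = 0" if "x \<notin> {-R<..<R}" for x y
  proof -
    have "x \<notin> {-R1..R1}" "x \<notin> {-R2..R2}" using that le_R by auto
    then show "\<phi> (x, y) = 0" "?p (x, y) = 0" using R1(2)[of "(x, y)"] R2(2)[of "(x, y)"] by auto
  qed
  have cw: "continuous_on S ?w" for S
    by (intro continuous_intros smooth_continuous s sp)
  have wi: "integrable (strip_measure L) ?w"
    using L2_spaceD(2)[OF test_functions_L2[OF \<phi>]] L2_spaceD(2)[OF test_functions_L2[OF p_test]] by simp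
  have wm: "?w \<in> borel_measurable borel" by (intro borel_measurable_continuous_onI cw)
  let ?i = "\<lambda>z. indicator (strip L) z *\<^sub>R ?w z"
  have i: "integrable (lborel \<Otimes>\<^sub>M lborel) (\<lambda>(x, y). ?i (x, y))"
    using wi wm sets_strip by (simp add: integral_lebesgue_on_borel lborel_prod set_integrable_def split_def)
  have slice: "(\<integral>x. ?i (x, y) \<partial>lborel) = indicator {0..L} y * (LINT x:{-R..R}|lborel. ?w (x, y))" for y
  proof -
    have "?i (x, y) = indicator {0..L} y * (indicator {-R..R} x *\<^sub>R ?w (x, y))" for x
      using R[of x y] by (cases "x \<in> {-R..R}") (auto simp: indicator_strip)
    then show ?thesis by (simp only: integral_mult_right_zero set_lebesgue_integral_def)
  qed
  have "(L2_norm (lebesgue_on {0..L}) (\<lambda>y. \<phi> (0, y)))\<^sup>2 = (\<integral>y. indicator {0..L} y * (cmod (\<phi> (0, y)))\<^sup>2 \<partial>lborel)"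
    using smooth_continuous[OF s, of UNIV]
    by (subst L2_norm_power2, subst integral_lebesgue_on_borel(1))
      (auto intro!: borel_measurable_continuous_onI continuous_intros smooth_line_continuous smooth_slice s
        simp: set_lebesgue_integral_def)
  also have "\<dots> \<le> (\<integral>y. (\<integral>x. ?i (x, y) \<partial>lborel) \<partial>lborel)"
  proof (rule integral_mono)
    show "integrable lborel (\<lambda>y. indicator {0..L} y * (cmod (\<phi> (0, y)))\<^sup>2)"
      using borel_integrable_atLeastAtMost'[of 0 L "\<lambda>y. (cmod (\<phi> (0, y)))\<^sup>2"]
      by (simp add: set_integrable_def continuous_intros smooth_line_continuous smooth_slice s)
    show "integrable lborel (\<lambda>y. \<integral>x. ?i (x, y) \<partial>lborel)"
      using lborel_pair.integrable_snd[OF i] .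
    fix y
    have "(cmod (\<phi> (0, y)))\<^sup>2 \<le> (LINT x:{-R..R}|lborel. ?w (x, y))"
      by (rule pointwise_trace_bound[OF smooth_slice(1)[OF sp] slice_has_vector_derivative(1)[OF smooth_differentiable[OF s]]
            \<open>0 < \<kappa>\<close> R_pos R(1)])
    then show "indicator {0..L} y * (cmod (\<phi> (0, y)))\<^sup>2 \<le> (\<integral>x. ?i (x, y) \<partial>lborel)"
      unfolding slice by (intro mult_left_mono) auto
  qed
  also have "\<dots> = (\<integral>z. ?w z \<partial>strip_measure L)"
    using lborel_pair.integral_snd[OF i] wm sets_strip
    by (simp add: integral_lebesgue_on_borel lborel_prod set_lebesgue_integral_def split_def)
  also have "\<dots> = \<kappa> / 2 * (strip_norm L \<phi>)\<^sup>2 + 1 / (2 * \<kappa>) * (strip_norm L ?p)\<^sup>2"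
    using L2_spaceD(2)[OF test_functions_L2[OF \<phi>, of L]] L2_spaceD(2)[OF test_functions_L2[OF p_test, of L]]
    by (simp add: L2_norm_power2)
  finally show ?thesis .
qed

lemma test_functions_slice_L2:
  assumes "\<phi> \<in> test_functions \<Omega>"
  shows "(\<lambda>y. \<phi> (x, y)) \<in> L2_space (lebesgue_on {0..L})"
proof -
  obtain R where R: "\<And>z. z \<notin> {-R..R} \<times> {-R..R} \<Longrightarrow> \<phi> z = 0" using test_functions_box[OF assms] by metis
  show ?thesis
    by (rule L2_compact_support(2)[of _ "{-R..R}"])
      (use R in \<open>auto intro!: smooth_line_continuous smooth_slice test_functions_smooth[OF assms]\<close>)
qed

text \<open>Both sides of the bound for test functions pass to the limit. The parameter stays free:
  any value yields uniqueness of the trace, while one adapted to \<gamma> yields the sharp lower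
  bound on the quadratic energy.\<close>

lemma trace_bound:
  assumes t: "is_trace L u t" and g: "is_weak_partial L (1, 0) u g" and "0 < \<kappa>"
  shows "(L2_norm (lebesgue_on {0..L}) t)\<^sup>2
    \<le> \<kappa> / 2 * (strip_norm L u)\<^sup>2 + 1 / (2 * \<kappa>) * (strip_norm L g)\<^sup>2"
proof -
  have u: "u \<in> strip_L2 L" and tL2: "t \<in> L2_space (lebesgue_on {0..L})"
    using t by (auto simp: is_trace_def H1_def)
  have gL2: "g \<in> strip_L2 L" using g by (simp add: is_weak_partial_def)
  obtain h where h: "is_weak_partial L (0, 1) u h" using t by (auto simp: is_trace_def H1_def)
  obtain \<phi> where \<phi>: "\<And>n. \<phi> n \<in> test_functions UNIV"
    and lim: "(\<lambda>n. strip_norm L (\<lambda>z. \<phi> n z - u z)) \<longlonglongrightarrow> 0"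
      "(\<lambda>n. strip_norm L (\<lambda>z. partial (1, 0) (\<phi> n) z - g z)) \<longlonglongrightarrow> 0"
      "(\<lambda>n. L2_norm (lebesgue_on {0..L}) (\<lambda>y. \<phi> n (0, y) - t y)) \<longlonglongrightarrow> 0"
    by (rule is_trace_cases[OF t g h], rule that)
  have p: "partial (1, 0) (\<phi> n) \<in> strip_L2 L" for n by (rule partial_test_L2[OF \<phi>]) simp
  show ?thesis
  proof (rule LIMSEQ_le)
    show "(\<lambda>n. (L2_norm (lebesgue_on {0..L}) (\<lambda>y. \<phi> n (0, y)))\<^sup>2) \<longlonglongrightarrow> (L2_norm (lebesgue_on {0..L}) t)\<^sup>2"
      by (intro tendsto_intros L2_norm_tendsto test_functions_slice_L2[OF \<phi>] tL2 lim)
    show "(\<lambda>n. \<kappa> / 2 * (strip_norm L (\<phi> n))\<^sup>2 + 1 / (2 * \<kappa>) * (strip_norm L (partial (1, 0) (\<phi> n)))\<^sup>2)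
      \<longlonglongrightarrow> \<kappa> / 2 * (strip_norm L u)\<^sup>2 + 1 / (2 * \<kappa>) * (strip_norm L g)\<^sup>2"
      by (intro tendsto_add tendsto_mult tendsto_const tendsto_power L2_norm_tendsto test_functions_L2[OF \<phi>] p u gL2 lim)
    show "\<exists>N. \<forall>n\<ge>N. (L2_norm (lebesgue_on {0..L}) (\<lambda>y. \<phi> n (0, y)))\<^sup>2
      \<le> \<kappa> / 2 * (strip_norm L (\<phi> n))\<^sup>2 + 1 / (2 * \<kappa>) * (strip_norm L (partial (1, 0) (\<phi> n)))\<^sup>2"
      using trace_bound_test[OF \<phi> \<open>0 < \<kappa>\<close>] by blast
  qed
qed

lemma L2_norm_diff_tendsto_0:
  assumes "\<And>n. u n \<in> L2_space M" "\<And>n. v n \<in> L2_space M" "a \<in> L2_space M" "b \<in> L2_space M"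
    and "(\<lambda>n. L2_norm M (\<lambda>z. u n z - a z)) \<longlonglongrightarrow> 0" "(\<lambda>n. L2_norm M (\<lambda>z. v n z - b z)) \<longlonglongrightarrow> 0"
  shows "(\<lambda>n. L2_norm M (\<lambda>z. (u n z - v n z) - (a z - b z))) \<longlonglongrightarrow> 0"
proof (rule Lim_null_comparison)
  show "(\<lambda>n. L2_norm M (\<lambda>z. u n z - a z) + L2_norm M (\<lambda>z. v n z - b z)) \<longlonglongrightarrow> 0"
    using tendsto_add[OF assms(5,6)] by simp
  have "L2_norm M (\<lambda>z. (u n z - v n z) - (a z - b z)) \<le> L2_norm M (\<lambda>z. u n z - a z) + L2_norm M (\<lambda>z. v n z - b z)" for n
    using L2_norm_triangle[OF L2_space_diff[OF assms(1)[of n] assms(3)] L2_space_diff[OF assms(4) assms(2)[of n]]]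
    by (simp add: L2_norm_diff_commute[of M b] algebra_simps)
  then show "\<forall>\<^sub>F n in sequentially. norm (L2_norm M (\<lambda>z. (u n z - v n z) - (a z - b z)))
      \<le> L2_norm M (\<lambda>z. u n z - a z) + L2_norm M (\<lambda>z. v n z - b z)" by simp
qed

lemma partial_diff:
  assumes "smooth f" "smooth g"
  shows "partial e (\<lambda>z. f z - g z) z = partial e f z - partial e g z"
  using partialI[OF has_derivative_diff[of f "frechet_derivative f (at z)" "at z" g "frechet_derivative g (at z)"]]
    smooth_differentiable[OF assms(1), of z] smooth_differentiable[OF assms(2), of z]
  by (simp add: frechet_derivative_works partial_def)

text \<open>Subtracting two approximating sequences shows that the difference of \<open>s\<close>
  and \<open>t\<close> is a trace of the zero function, whose weak derivative is zero. The trace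
  bound then makes its norm vanish.\<close>

lemma is_trace_unique:
  assumes s: "is_trace L u s" and t: "is_trace L u t"
  shows "AE y in lebesgue_on {0..L}. s y = t y"
proof -
  have u: "u \<in> strip_L2 L" and sL2: "s \<in> L2_space (lebesgue_on {0..L})"
    and tL2: "t \<in> L2_space (lebesgue_on {0..L})"
    using s t by (auto simp: is_trace_def H1_def)
  obtain g h where g: "is_weak_partial L (1, 0) u g" and h: "is_weak_partial L (0, 1) u h"
    using t by (auto simp: is_trace_def H1_def)
  then have gL2: "g \<in> strip_L2 L" "h \<in> strip_L2 L" by (auto simp: is_weak_partial_def)
  obtain \<phi> where \<phi>: "\<And>n. \<phi> n \<in> test_functions UNIV"
    and lim1: "(\<lambda>n. strip_norm L (\<lambda>z. \<phi> n z - u z)) \<longlonglongrightarrow> 0"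
      "(\<lambda>n. strip_norm L (\<lambda>z. partial (1, 0) (\<phi> n) z - g z)) \<longlonglongrightarrow> 0"
      "(\<lambda>n. strip_norm L (\<lambda>z. partial (0, 1) (\<phi> n) z - h z)) \<longlonglongrightarrow> 0"
      "(\<lambda>n. L2_norm (lebesgue_on {0..L}) (\<lambda>y. \<phi> n (0, y) - s y)) \<longlonglongrightarrow> 0"
    by (rule is_trace_cases[OF s g h], rule that)
  obtain \<psi> where \<psi>: "\<And>n. \<psi> n \<in> test_functions UNIV"
    and lim2: "(\<lambda>n. strip_norm L (\<lambda>z. \<psi> n z - u z)) \<longlonglongrightarrow> 0"
      "(\<lambda>n. strip_norm L (\<lambda>z. partial (1, 0) (\<psi> n) z - g z)) \<longlonglongrightarrow> 0"
      "(\<lambda>n. strip_norm L (\<lambda>z. partial (0, 1) (\<psi> n) z - h z)) \<longlonglongrightarrow> 0"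
      "(\<lambda>n. L2_norm (lebesgue_on {0..L}) (\<lambda>y. \<psi> n (0, y) - t y)) \<longlonglongrightarrow> 0"
    by (rule is_trace_cases[OF t g h], rule that)
  have p: "partial e (\<phi> n) \<in> strip_L2 L" "partial e (\<psi> n) \<in> strip_L2 L"
    if "e \<in> {(1, 0), (0, 1)}" for e n using that partial_test_L2[OF \<phi>] partial_test_L2[OF \<psi>] by auto
  have pd: "partial e (\<lambda>z. \<phi> n z - \<psi> n z) = (\<lambda>z. partial e (\<phi> n) z - partial e (\<psi> n) z)" for e n
    using partial_diff[OF test_functions_smooth[OF \<phi>] test_functions_smooth[OF \<psi>]] by blast
  have d: "(\<lambda>z. \<phi> n z - \<psi> n z) \<in> test_functions UNIV" for n by (rule test_functions_diff[OF \<phi> \<psi>])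
  have d1: "(\<lambda>n. strip_norm L (\<lambda>z. (\<phi> n z - \<psi> n z) - (u z - u z))) \<longlonglongrightarrow> 0"
    by (rule L2_norm_diff_tendsto_0[OF test_functions_L2[OF \<phi>] test_functions_L2[OF \<psi>] u u lim1(1) lim2(1)])
  have d2: "(\<lambda>n. strip_norm L (\<lambda>z. partial (1, 0) (\<lambda>z. \<phi> n z - \<psi> n z) z - (g z - g z))) \<longlonglongrightarrow> 0"
    unfolding pd by (rule L2_norm_diff_tendsto_0[OF p(1) p(2) gL2(1) gL2(1) lim1(2) lim2(2)]) auto
  have d3: "(\<lambda>n. strip_norm L (\<lambda>z. partial (0, 1) (\<lambda>z. \<phi> n z - \<psi> n z) z - (h z - h z))) \<longlonglongrightarrow> 0"
    unfolding pd by (rule L2_norm_diff_tendsto_0[OF p(1) p(2) gL2(2) gL2(2) lim1(3) lim2(3)]) auto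
  have d4: "(\<lambda>n. L2_norm (lebesgue_on {0..L}) (\<lambda>y. (\<phi> n (0, y) - \<psi> n (0, y)) - (s y - t y))) \<longlonglongrightarrow> 0"
    by (rule L2_norm_diff_tendsto_0[OF test_functions_slice_L2[OF \<phi>] test_functions_slice_L2[OF \<psi>] sL2 tL2 lim1(4) lim2(4)])
  note limits = trace_limit[OF d L2_space_diff[OF u u] L2_space_diff[OF gL2(1) gL2(1)] L2_space_diff[OF gL2(2) gL2(2)]
      L2_space_diff[OF sL2 tL2] d1 d2 d3 d4]
  note zero = limits(1) and trace = limits(3)
  have "(L2_norm (lebesgue_on {0..L}) (\<lambda>y. s y - t y))\<^sup>2 \<le> 0"
    using trace_bound[OF trace zero, of 1] by simp
  then have "L2_norm (lebesgue_on {0..L}) (\<lambda>y. s y - t y) = 0" by simp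
  then show ?thesis using L2_norm_eq_0_iff[OF L2_space_diff[OF sL2 tL2]] by simp
qed

text \<open>Uniqueness lets any trace and any weak derivatives replace the ones picked by
  \<open>SOME\<close>.\<close>

lemma energy_eq:
  assumes t: "is_trace L u t" and g: "is_weak_partial L (1, 0) u g" and h: "is_weak_partial L (0, 1) u h"
  shows "energy \<gamma> p L u =
    1 / 2 * ((strip_norm L g)\<^sup>2 + (strip_norm L h)\<^sup>2)
    + \<gamma> / 2 * (L2_norm (lebesgue_on {0..L}) t)\<^sup>2
    - 1 / (p + 1) * (\<integral>z. cmod (u z) powr (p + 1) \<partial>strip_measure L)"
proof -
  have u: "u \<in> strip_L2 L" and tL2: "t \<in> L2_space (lebesgue_on {0..L})"
    using t by (auto simp: is_trace_def H1_def)
  have t0: "is_trace L u (trace0 L u)" unfolding trace0_def by (rule someI[of "is_trace L u", OF t])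
  then have t0L2: "trace0 L u \<in> L2_space (lebesgue_on {0..L})" by (simp add: is_trace_def)
  have "L2_norm (lebesgue_on {0..L}) (trace0 L u) = L2_norm (lebesgue_on {0..L}) t"
  proof (rule L2_norm_eqI)
    show "AE y in lebesgue_on {0..L}. cmod (trace0 L u y) = cmod (t y)"
      using is_trace_unique[OF t0 t] by eventually_elim simp
  qed (use L2_spaceD(1)[OF t0L2] L2_spaceD(1)[OF tL2] in auto)
  then show ?thesis
    using L2_norm_weak_partial[OF u g] L2_norm_weak_partial[OF u h]
    by (simp add: energy_def grad_norm_def L2_norm_power2[symmetric])
qed

text \<open>The approximants are products of \<open>P n\<close>, which approximates \<open>f\<close>
  with compact support, and \<open>B\<close>, which is \<open>b\<close> cut off away from the strip.
  Since \<open>P n 0 = f 0\<close>, their traces are exact from the start. Asking for the product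
  form only almost everywhere makes the result apply to a minimizer as well.\<close>

lemma product_trace:
  assumes fh: "H1_line f h" and b: "smooth_line b" "\<And>y. (b has_vector_derivative b' y) (at y)"
    and u: "u \<in> borel_measurable (strip_measure L)" "AE z in strip_measure L. u z = f (fst z) * b (snd z)"
  shows "is_weak_partial L (1, 0) u (\<lambda>z. h (fst z) * b (snd z))"
    and "is_weak_partial L (0, 1) u (\<lambda>z. f (fst z) * b' (snd z))"
    and "is_trace L u (\<lambda>y. f 0 * b y)"
    and "u \<in> strip_L2 L"
proof -
  have f: "f \<in> line_L2" and h: "h \<in> line_L2" using fh by (auto simp: H1_line_def)
  have bc: "continuous_on S b" for S by (rule smooth_line_continuous[OF b(1)])
  have b'_eq: "b' = (\<lambda>y. vector_derivative b (at y))" by (intro ext vector_derivative_at[symmetric] b(2))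
  have sb': "smooth_line b'" unfolding b'_eq by (rule smooth_line_vector_derivative[OF b(1)])
  have b'c: "continuous_on S b'" for S by (rule smooth_line_continuous[OF sb'])
  obtain \<eta> where \<eta>: "smooth_line \<eta>" "\<And>x. x \<in> {-1..1} \<Longrightarrow> \<eta> x = 1" "\<And>x. x \<notin> {-2<..<2} \<Longrightarrow> \<eta> x = 0"
    using cutoff_exists by blast
  \<comment> \<open>The open interval (-K, K) contains \<open>{0..L}\<close>, and the cutoff
    stretched by \<open>K\<close> equals 1 on it.\<close>
  define K where "K = \<bar>L\<bar> + 1"
  have K: "0 < K" by (simp add: K_def)
  define B where "B y = b y * \<eta> (inverse K * y + 0)" for y
  have sB: "smooth_line B" unfolding B_def by (intro smooth_line_mult smooth_line_affine b \<eta>)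
  define B' where "B' y = vector_derivative B (at y)" for y
  have B': "(B has_vector_derivative B' y) (at y)" for y
    unfolding B'_def by (rule smooth_line_has_derivative[OF sB])
  have B_eq: "B y = b y" if "y \<in> {-K<..<K}" for y
  proof -
    have "inverse K * y + 0 \<in> {-1..1}" using that K by (auto simp: field_simps)
    then show ?thesis using \<eta>(2) by (simp add: B_def)
  qed
  have B'_eq: "B' y = b' y" if "y \<in> {-K<..<K}" for y
  proof -
    have "(b has_vector_derivative B' y) (at y)"
      by (rule has_vector_derivative_transform_within_open[OF B', of "{-K<..<K}"]) (use that B_eq in auto)
    then show ?thesis using b(2)[of y] vector_derivative_unique_at by blast
  qed
  have strip_K: "snd z \<in> {-K<..<K}" if "z \<in> strip L" for z using that by (auto simp: strip_def K_def)
  \<comment> \<open>A single predicate for all properties lets the axiom of choice be applied to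
    \<open>P\<close>, \<open>p\<close> and \<open>R\<close> in turn.\<close>
  define approx where "approx n P p R \<longleftrightarrow> smooth_line p \<and> (\<forall>x. (P has_vector_derivative p x) (at x)) \<and> P 0 = f 0 \<and>
    (\<forall>x. x \<notin> {-R..R} \<longrightarrow> P x = 0) \<and> line_norm (\<lambda>x. P x - f x) < inverse (real (Suc n)) \<and>
    line_norm (\<lambda>x. p x - h x) < inverse (real (Suc n))" for n P p and R :: real
  have "\<forall>n. \<exists>P p R. approx n P p R"
  proof
    fix n
    show "\<exists>P p R. approx n P p R"
    proof (rule H1_line_approximation[OF fh, of "inverse (real (Suc n))"])
      fix P p :: "real \<Rightarrow> complex" and R :: real
      assume "smooth_line p" "\<And>x. (P has_vector_derivative p x) (at x)" "P 0 = f 0"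
        "\<And>x. x \<notin> {-R..R} \<Longrightarrow> P x = 0" "line_norm (\<lambda>x. P x - f x) < inverse (real (Suc n))"
        "line_norm (\<lambda>x. p x - h x) < inverse (real (Suc n))"
      then show ?thesis unfolding approx_def by (intro exI conjI allI impI)
    qed simp
  qed
  from choice[OF this] obtain P where "\<forall>n. \<exists>p R. approx n (P n) p R" by (elim exE)
  from choice[OF this] obtain p where "\<forall>n. \<exists>R. approx n (P n) (p n) R" by (elim exE)
  from choice[OF this] obtain R where approx: "\<forall>n. approx n (P n) (p n) (R n)" by (elim exE)
  have Pp: "smooth_line (p n)" "(P n has_vector_derivative p n x) (at x)" "P n 0 = f 0"
    "x \<notin> {-R n..R n} \<Longrightarrow> P n x = 0" "line_norm (\<lambda>x. P n x - f x) < inverse (real (Suc n))"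
    "line_norm (\<lambda>x. p n x - h x) < inverse (real (Suc n))" for n x
    using approx unfolding approx_def by blast+
  have sP: "smooth_line (P n)" for n by (rule smooth_line_antiderivative[OF Pp(1,2)])
  define \<phi> where "\<phi> n z = P n (fst z) * B (snd z)" for n z
  have \<phi>: "\<phi> n \<in> test_functions UNIV" for n
    unfolding \<phi>_def
  proof (rule test_functions_product[OF sP sB])
    show "P n x = 0" if "x \<notin> {-R n..R n}" for x using Pp(4)[OF that] .
    show "B y = 0" if "y \<notin> {-2 * K..2 * K}" for y
    proof -
      have "inverse K * y + 0 \<notin> {-2<..<2}" using that K by (auto simp: field_simps)
      then show ?thesis using \<eta>(3) by (simp add: B_def)
    qed
  qed simp
  have p\<phi>: "partial (1, 0) (\<phi> n) z = p n (fst z) * B (snd z)" "partial (0, 1) (\<phi> n) z = P n (fst z) * B' (snd z)" for n z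
    unfolding \<phi>_def using partial_product[of "P n" "p n (fst z)" z B "B' (snd z)"] Pp(2) B' by auto
  have lim: "(\<lambda>n. strip_norm L (\<lambda>z. (Q n (fst z) - q (fst z)) * c (snd z))) \<longlonglongrightarrow> 0"
    if Q: "\<And>n. Q n \<in> line_L2" "q \<in> line_L2" "continuous_on UNIV c"
      "\<And>n. line_norm (\<lambda>x. Q n x - q x) < inverse (real (Suc n))" for Q q c
  proof -
    have "(\<lambda>n. line_norm (\<lambda>x. Q n x - q x)) \<longlonglongrightarrow> 0"
    proof (rule Lim_null_comparison[OF _ LIMSEQ_inverse_real_of_nat], intro always_eventually allI)
      show "norm (line_norm (\<lambda>x. Q n x - q x)) \<le> inverse (real (Suc n))" for n
        using less_imp_le[OF Q(4)[of n]] by simp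
    qed
    from tendsto_mult_right[OF this, of "L2_norm (lebesgue_on {0..L}) c"]
    show ?thesis by (simp add: L2_strip_product(2)[OF L2_space_diff[OF Q(1,2)] Q(3)])
  qed
  have cs: "P n \<in> line_L2" "p n \<in> line_L2" for n
  proof -
    show "P n \<in> line_L2"
      by (rule L2_compact_support(1)[of _ "{-R n..R n}" "{}"]) (use Pp(4) sP in \<open>auto intro!: smooth_line_continuous\<close>)
    have "p n x = 0" if "x \<notin> {-R n..R n}" for x
    proof -
      have "(P n has_vector_derivative 0) (at x)"
        by (rule has_vector_derivative_transform_within_open[of "\<lambda>x. 0" _ _ "- {-R n..R n}"])
          (use that Pp(4) in \<open>auto intro!: open_Compl\<close>)
      then show ?thesis using Pp(2)[of n x] vector_derivative_unique_at by blast
    qed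
    then show "p n \<in> line_L2"
      by (intro L2_compact_support(1)[of _ "{-R n..R n}" "{}"]) (use Pp(1) in \<open>auto intro!: smooth_line_continuous\<close>)
  qed
  note pr = L2_strip_product(1)[of _ _ L]
  have fb: "(\<lambda>z. f (fst z) * b (snd z)) \<in> strip_L2 L" by (rule pr[OF f bc])
  show uL2: "u \<in> strip_L2 L"
    by (rule L2_space_cong_AE[OF fb _ u(1)]) (use u(2) in eventually_elim, simp)
  have hb: "(\<lambda>z. h (fst z) * b (snd z)) \<in> strip_L2 L" by (rule pr[OF h bc])
  have fb': "(\<lambda>z. f (fst z) * b' (snd z)) \<in> strip_L2 L" by (rule pr[OF f b'c])
  have tL2: "(\<lambda>y. f 0 * b y) \<in> L2_space (lebesgue_on {0..L})"
  proof (rule L2_space_cmult)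
    have bm: "b \<in> borel_measurable borel" by (rule borel_measurable_continuous_onI[OF bc])
    show "b \<in> L2_space (lebesgue_on {0..L})"
      by (subst L2_restrict_Icc(1)[OF bm]) (rule continuous_L2_Icc[OF bc])
  qed
  have l1: "(\<lambda>n. strip_norm L (\<lambda>z. \<phi> n z - u z)) \<longlonglongrightarrow> 0"
  proof -
    have "strip_norm L (\<lambda>z. \<phi> n z - u z) = strip_norm L (\<lambda>z. (P n (fst z) - f (fst z)) * b (snd z))" for n
    proof (rule L2_norm_eqI)
      show "AE z in strip_measure L. cmod (\<phi> n z - u z) = cmod ((P n (fst z) - f (fst z)) * b (snd z))"
        using u(2) AE_space
      proof eventually_elim
        case (elim z)
        then show ?case using B_eq[OF strip_K[of z]] by (simp add: \<phi>_def left_diff_distrib)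
      qed
      show "(\<lambda>z. \<phi> n z - u z) \<in> borel_measurable (strip_measure L)"
        using L2_spaceD(1)[OF L2_space_diff[OF test_functions_L2[OF \<phi>] uL2]] .
      show "(\<lambda>z. (P n (fst z) - f (fst z)) * b (snd z)) \<in> borel_measurable (strip_measure L)"
        using L2_spaceD(1)[OF pr[OF L2_space_diff[OF cs(1) f] bc]] .
    qed
    then show ?thesis using lim[OF cs(1) f bc Pp(5)] by simp
  qed
  have l2: "(\<lambda>n. strip_norm L (\<lambda>z. partial (1, 0) (\<phi> n) z - h (fst z) * b (snd z))) \<longlonglongrightarrow> 0"
  proof -
    have "strip_norm L (\<lambda>z. partial (1, 0) (\<phi> n) z - h (fst z) * b (snd z))
        = strip_norm L (\<lambda>z. (p n (fst z) - h (fst z)) * b (snd z))" for n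
      unfolding L2_norm_def using B_eq[OF strip_K]
      by (intro arg_cong[where f = sqrt] Bochner_Integration.integral_cong refl) (simp add: p\<phi> left_diff_distrib)
    then show ?thesis using lim[OF cs(2) h bc Pp(6)] by simp
  qed
  have l3: "(\<lambda>n. strip_norm L (\<lambda>z. partial (0, 1) (\<phi> n) z - f (fst z) * b' (snd z))) \<longlonglongrightarrow> 0"
  proof -
    have "strip_norm L (\<lambda>z. partial (0, 1) (\<phi> n) z - f (fst z) * b' (snd z))
        = strip_norm L (\<lambda>z. (P n (fst z) - f (fst z)) * b' (snd z))" for n
      unfolding L2_norm_def using B'_eq[OF strip_K]
      by (intro arg_cong[where f = sqrt] Bochner_Integration.integral_cong refl) (simp add: p\<phi> left_diff_distrib)
    then show ?thesis using lim[OF cs(1) f b'c Pp(5)] by simp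
  qed
  have l4: "(\<lambda>n. L2_norm (lebesgue_on {0..L}) (\<lambda>y. \<phi> n (0, y) - f 0 * b y)) \<longlonglongrightarrow> 0"
  proof -
    have "L2_norm (lebesgue_on {0..L}) (\<lambda>y. \<phi> n (0, y) - f 0 * b y) = L2_norm (lebesgue_on {0..L}) (\<lambda>y. 0)" for n
      unfolding L2_norm_def using Pp(3)
      by (intro arg_cong[where f = sqrt] Bochner_Integration.integral_cong refl)
        (auto simp: \<phi>_def K_def intro!: B_eq)
    then show ?thesis by simp
  qed
  show "is_weak_partial L (1, 0) u (\<lambda>z. h (fst z) * b (snd z))"
    "is_weak_partial L (0, 1) u (\<lambda>z. f (fst z) * b' (snd z))" "is_trace L u (\<lambda>y. f 0 * b y)"
    using trace_limit[OF \<phi> uL2 hb fb' tL2 l1 l2 l3 l4] by blast+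
qed


section \<open>Sobolev functions depending on x alone\<close>

text \<open>Integrating out y multiplies the profile by \<open>L\<close>, which is nonzero.\<close>

lemma integrable_strip_fst:
  fixes F :: "real \<Rightarrow> real"
  assumes F: "F \<in> borel_measurable borel" and i: "integrable (strip_measure L) (\<lambda>z. F (fst z))" and "0 < L"
  shows "integrable lborel F"
proof -
  have m: "(\<lambda>z. F (fst z)) \<in> borel_measurable (borel :: (real \<times> real) measure)"
    using F unfolding borel_prod[symmetric] by measurable
  have "integrable (lborel \<Otimes>\<^sub>M lborel) (\<lambda>z. indicator (strip L) z *\<^sub>R F (fst z))"
    using i m sets_strip by (simp add: integral_lebesgue_on_borel lborel_prod set_integrable_def)
  from lborel_pair.integrable_fst'[OF this]
  have "integrable lborel (\<lambda>x. \<integral>y. indicator {0..L} y * F x \<partial>lborel)"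
    by (simp add: indicator_strip)
  then have "integrable lborel (\<lambda>x. L * F x)" using \<open>0 < L\<close> by simp
  then show ?thesis using \<open>0 < L\<close> by simp
qed

text \<open>The candidate \<open>h\<close> is the average of \<open>g\<close> in y against a bump of
  integral 1 supported inside the open strip. Testing with the product of \<open>\<psi>\<close> and
  this bump reduces the weak identity to one variable. A plain average would correspond to a factor
  that does not vanish near the boundary.\<close>

lemma weak_partial_x_function_of_x:
  assumes L: "0 < L" and f: "f \<in> line_L2"
    and u: "u \<in> strip_L2 L" "AE z in strip_measure L. u z = f (fst z)"
    and g: "is_weak_partial L (1, 0) u g"
  shows "\<exists>h\<in>line_L2. \<forall>\<psi> p R. smooth_line p \<longrightarrow> (\<forall>x. (\<psi> has_vector_derivative p x) (at x)) \<longrightarrow> 0 < R \<longrightarrow>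
      (\<forall>x. x \<notin> {-R..R} \<longrightarrow> \<psi> x = 0) \<longrightarrow> (\<forall>x. x \<notin> {-R..R} \<longrightarrow> p x = 0) \<longrightarrow>
      (\<integral>x. f x * p x \<partial>lborel) = - (\<integral>x. h x * \<psi> x \<partial>lborel)"
proof -
  have fm: "f \<in> borel_measurable borel" using L2_spaceD(1)[OF f] by simp
  have gL2: "g \<in> strip_L2 L" using g by (simp add: is_weak_partial_def)
  obtain k where k: "k \<in> borel_measurable borel" and gk: "AE z in strip_measure L. g z = k z"
    using borel_version[OF L2_spaceD(1)[OF gL2] sets_strip] by blast
  have kL2: "k \<in> strip_L2 L"
    by (rule L2_space_cong_AE[OF gL2 gk borel_imp_lebesgue_on[OF k]])
  have [measurable]: "k \<in> borel_measurable (borel \<Otimes>\<^sub>M borel)" using k by (simp add: borel_prod)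
  define A where "A = (LINT y:{L / 3..2 * L / 3}|lborel. bump (L / 3) (2 * L / 3) y)"
  have A: "A \<noteq> 0" using L bump_integral_nonzero[of "L / 3" "2 * L / 3"] by (simp add: A_def)
  define \<eta> where "\<eta> y = bump (L / 3) (2 * L / 3) y * inverse A" for y
  have s\<eta>: "smooth_line \<eta>" unfolding \<eta>_def by (intro smooth_line_mult smooth_line_bump smooth_line_const)
  have \<eta>m [measurable]: "\<eta> \<in> borel_measurable borel"
    by (intro borel_measurable_continuous_onI smooth_line_continuous s\<eta>)
  have \<eta>_out: "\<eta> y = 0" if "y \<notin> {L / 3..2 * L / 3}" for y
    using that bump_eq_0[of y "L / 3" "2 * L / 3"] by (auto simp: \<eta>_def)
  have \<eta>_out': "\<eta> y = 0" if "y \<notin> {0..L}" for y by (rule \<eta>_out) (use that L in auto)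
  have \<eta>L2: "\<eta> \<in> line_L2"
    by (rule L2_compact_support(1)[of _ "{L / 3..2 * L / 3}" "{}"])
      (use \<eta>_out s\<eta> in \<open>auto intro!: smooth_line_continuous\<close>)
  have \<eta>1: "(LINT y:{0..L}|lborel. \<eta> y) = 1"
  proof -
    have "(LINT y:{0..L}|lborel. \<eta> y) = (LINT y:{L / 3..2 * L / 3}|lborel. \<eta> y)"
      unfolding set_lebesgue_integral_def
    proof (intro Bochner_Integration.integral_cong refl)
      fix y show "indicator {0..L} y *\<^sub>R \<eta> y = indicator {L / 3..2 * L / 3} y *\<^sub>R \<eta> y"
        using \<eta>_out[of y] \<eta>_out'[of y] by (cases "y \<in> {0..L}"; cases "y \<in> {L / 3..2 * L / 3}") auto
    qed
    also have "\<dots> = A * inverse A" unfolding \<eta>_def A_def by (rule set_integral_mult_left)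
    finally show ?thesis using A by simp
  qed
  let ?S = "\<lambda>z. indicator (strip L) z * (cmod (k z))\<^sup>2"
  have S_int: "integrable (lborel \<Otimes>\<^sub>M lborel) ?S"
    using L2_spaceD(2)[OF kL2] k sets_strip
    by (simp add: integral_lebesgue_on_borel lborel_prod set_integrable_def)
  define h where "h x = (\<integral>y. k (x, y) * \<eta> y \<partial>lborel)" for x
  have hm: "h \<in> borel_measurable borel"
    unfolding h_def by measurable
  \<comment> \<open>For almost every x the slice of \<open>k\<close> is square-integrable and the
    Cauchy-Schwarz inequality in y applies; at the remaining points there is no control.\<close>
  have h_bound: "AE x in lborel. (cmod (h x))\<^sup>2 \<le> (line_norm \<eta>)\<^sup>2 * (\<integral>y. ?S (x, y) \<partial>lborel)"
    using lborel_pair.AE_integrable_fst'[OF S_int]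
  proof eventually_elim
    case (elim x)
    let ?k = "\<lambda>y. of_real (indicator {0..L} y) * k (x, y)"
    have eq: "(cmod (?k y))\<^sup>2 = ?S (x, y)" for y
      by (simp add: norm_mult power_mult_distrib strip_def indicator_def)
    have km: "?k \<in> borel_measurable lborel" by measurable
    have kx: "?k \<in> line_L2" 
    proof (rule L2_spaceI[OF km])
      show "integrable lborel (\<lambda>y. (cmod (?k y))\<^sup>2)" unfolding eq by (rule elim)
    qed
    have k\<eta>: "?k y * \<eta> y = k (x, y) * \<eta> y" for y using \<eta>_out'[of y] by (cases "y \<in> {0..L}") auto
    have "cmod (h x) \<le> line_norm ?k * line_norm \<eta>"
      using norm_integral_mult_le[OF kx \<eta>L2] unfolding k\<eta> h_def .
    then have "(cmod (h x))\<^sup>2 \<le> (line_norm ?k * line_norm \<eta>)\<^sup>2" by (rule power_mono) simp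
    also have "\<dots> = (line_norm \<eta>)\<^sup>2 * (line_norm ?k)\<^sup>2" by (simp add: power_mult_distrib)
    also have "(line_norm ?k)\<^sup>2 = (\<integral>y. ?S (x, y) \<partial>lborel)" unfolding L2_norm_power2 eq ..
    finally show ?case .
  qed
  have h: "h \<in> line_L2"
  proof (rule L2_spaceI)
    show "integrable lborel (\<lambda>x. (cmod (h x))\<^sup>2)"
    proof (rule Bochner_Integration.integrable_bound)
      show "integrable lborel (\<lambda>x. (line_norm \<eta>)\<^sup>2 * (\<integral>y. ?S (x, y) \<partial>lborel))"
        by (intro integrable_mult_right lborel_pair.integrable_fst'[OF S_int])
      show "AE x in lborel. norm ((cmod (h x))\<^sup>2) \<le> norm ((line_norm \<eta>)\<^sup>2 * (\<integral>y. ?S (x, y) \<partial>lborel))"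
        using h_bound by eventually_elim simp
    qed (use hm in simp)
  qed (use hm in simp)
  have "(\<integral>x. f x * p x \<partial>lborel) = - (\<integral>x. h x * \<psi> x \<partial>lborel)"
    if p: "smooth_line p" "\<And>x. (\<psi> has_vector_derivative p x) (at x)" and R: "0 < R"
      and out: "\<And>x. x \<notin> {-R..R} \<Longrightarrow> \<psi> x = 0" "\<And>x. x \<notin> {-R..R} \<Longrightarrow> p x = 0" for \<psi> p and R :: real
  proof -
    have s\<psi>: "smooth_line \<psi>" by (rule smooth_line_antiderivative[OF p])
    let ?\<phi> = "\<lambda>z. \<psi> (fst z) * \<eta> (snd z)"
    have \<phi>: "?\<phi> \<in> test_functions (interior (strip L))"
    proof (rule test_functions_product[OF s\<psi> s\<eta>])
      show "\<psi> x = 0" if "x \<notin> {-R..R}" for x by (rule out(1)[OF that])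
      show "\<eta> y = 0" if "y \<notin> {L / 3..2 * L / 3}" for y by (rule \<eta>_out[OF that])
      show "{-R..R} \<times> {L / 3..2 * L / 3} \<subseteq> interior (strip L)" using L by (auto simp: interior_strip)
    qed
    have p\<phi>: "partial (1, 0) ?\<phi> = (\<lambda>z. p (fst z) * \<eta> (snd z))"
      using partial_product(1)[OF p(2) smooth_line_has_derivative[OF s\<eta>]] by blast
    have pL2: "p \<in> line_L2"
      by (rule L2_compact_support(1)[of _ "{-R..R}" "{}"]) (use p out in \<open>auto intro!: smooth_line_continuous\<close>)
    have \<phi>m: "?\<phi> \<in> borel_measurable borel" "(\<lambda>z. p (fst z) * \<eta> (snd z)) \<in> borel_measurable borel"
      by (intro borel_measurable_continuous_onI smooth_continuous smooth_product p s\<psi> s\<eta>)+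
    have fm2: "(\<lambda>z. f (fst z)) \<in> borel_measurable (borel :: (real \<times> real) measure)"
      using fm unfolding borel_prod[symmetric] by measurable
    have "(\<integral>z. u z * partial (1, 0) ?\<phi> z \<partial>strip_measure L) = (\<integral>z. (f (fst z) * p (fst z)) * \<eta> (snd z) \<partial>strip_measure L)"
    proof (rule integral_cong_AE)
      show "(\<lambda>z. u z * partial (1, 0) ?\<phi> z) \<in> borel_measurable (strip_measure L)"
        unfolding p\<phi> by (intro borel_measurable_times L2_spaceD(1)[OF u(1)] borel_imp_lebesgue_on[OF \<phi>m(2)])
      show "(\<lambda>z. (f (fst z) * p (fst z)) * \<eta> (snd z)) \<in> borel_measurable (strip_measure L)"
        unfolding mult.assoc by (intro borel_measurable_times borel_imp_lebesgue_on[OF \<phi>m(2)] borel_imp_lebesgue_on[OF fm2])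
      show "AE z in strip_measure L. u z * partial (1, 0) ?\<phi> z = (f (fst z) * p (fst z)) * \<eta> (snd z)"
        unfolding p\<phi> using u(2) by eventually_elim (simp only: mult.assoc)
    qed
    also have "\<dots> = (\<integral>x. f x * p x \<partial>lborel) * (LINT y:{0..L}|lborel. \<eta> y)"
      by (rule integral_strip_product(2)[OF L2_mult_integrable(1)[OF f pL2] _ \<eta>m])
        (intro borel_integrable_atLeastAtMost' smooth_line_continuous s\<eta>)
    finally have 1: "(\<integral>z. u z * partial (1, 0) ?\<phi> z \<partial>strip_measure L) = (\<integral>x. f x * p x \<partial>lborel)"
      by (simp add: \<eta>1)
    have "(\<integral>z. g z * ?\<phi> z \<partial>strip_measure L) = (\<integral>z. k z * ?\<phi> z \<partial>strip_measure L)"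
    proof (rule integral_cong_AE)
      show "(\<lambda>z. g z * ?\<phi> z) \<in> borel_measurable (strip_measure L)"
        by (intro borel_measurable_times L2_spaceD(1)[OF gL2] borel_imp_lebesgue_on[OF \<phi>m(1)])
      show "(\<lambda>z. k z * ?\<phi> z) \<in> borel_measurable (strip_measure L)"
        by (intro borel_measurable_times borel_imp_lebesgue_on k borel_imp_lebesgue_on[OF \<phi>m(1)])
      show "AE z in strip_measure L. g z * ?\<phi> z = k z * ?\<phi> z" using gk by eventually_elim simp
    qed
    also have "\<dots> = (\<integral>z. k z * ?\<phi> z \<partial>(lborel \<Otimes>\<^sub>M lborel))"
      unfolding lborel_prod
    proof (rule integral_strip_eq_lborel)
      show "(\<lambda>z. k z * ?\<phi> z) \<in> borel_measurable borel" by (intro borel_measurable_times k \<phi>m)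
      show "k z * ?\<phi> z = 0" if "z \<notin> strip L" for z
        using that \<eta>_out'[of "snd z"] by (cases z) (auto simp: strip_def)
    qed
    also have "\<dots> = (\<integral>x. (\<integral>y. k (x, y) * ?\<phi> (x, y) \<partial>lborel) \<partial>lborel)"
    proof (rule lborel_pair.integral_fst'[symmetric])
      have "integrable (strip_measure L) (\<lambda>z. k z * ?\<phi> z)"
        by (rule L2_mult_integrable(1)[OF kL2 test_functions_L2[OF \<phi>]])
      then have "integrable lborel (\<lambda>z. indicator (strip L) z *\<^sub>R (k z * ?\<phi> z))"
        using k \<phi>m sets_strip by (subst (asm) integral_lebesgue_on_borel(2)) (auto simp: set_integrable_def)
      moreover have "indicator (strip L) z *\<^sub>R (k z * ?\<phi> z) = k z * ?\<phi> z" for z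
        using \<eta>_out'[of "snd z"] by (cases "z \<in> strip L"; cases z) (auto simp: strip_def)
      ultimately show "integrable (lborel \<Otimes>\<^sub>M lborel) (\<lambda>z. k z * ?\<phi> z)" by (simp only: lborel_prod)
    qed
    also have "\<dots> = (\<integral>x. h x * \<psi> x \<partial>lborel)"
    proof (intro Bochner_Integration.integral_cong refl)
      fix x
      have "(\<integral>y. k (x, y) * ?\<phi> (x, y) \<partial>lborel) = (\<integral>y. (k (x, y) * \<eta> y) * \<psi> x \<partial>lborel)"
        by (simp add: mult_ac)
      also have "\<dots> = h x * \<psi> x" unfolding h_def by (rule integral_mult_left_zero)
      finally show "(\<integral>y. k (x, y) * ?\<phi> (x, y) \<partial>lborel) = h x * \<psi> x" .
    qed
    finally show ?thesis using 1 g \<phi> by (simp add: is_weak_partial_def)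
  qed
  with h show ?thesis by blast
qed

text \<open>The profile given by the hypothesis may fail to be measurable. It is replaced by the
  y-average of a Borel representative, which agrees with it for almost every x, and that in turn by
  its continuous representative.\<close>

lemma H1_function_of_x_alone:
  assumes L: "0 < L" and u: "u \<in> H1 L" and x: "function_of_x_alone L u"
  shows "\<exists>f h. H1_line f h \<and> (AE z in strip_measure L. u z = f (fst z))"
proof -
  have uL2: "u \<in> strip_L2 L" using u by (simp add: H1_def)
  obtain f0 where f0: "AE z in strip_measure L. u z = f0 (fst z)" using x by (auto simp: function_of_x_alone_def)
  obtain v where v: "v \<in> borel_measurable borel" and uv: "AE z in strip_measure L. u z = v z"
    using borel_version[OF L2_spaceD(1)[OF uL2] sets_strip] by blast
  have [measurable]: "v \<in> borel_measurable (borel \<Otimes>\<^sub>M borel)" using v by (simp add: borel_prod)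
  have strip_leb: "strip L \<inter> space lebesgue \<in> sets lebesgue" using sets_strip by auto
  have "AE z in strip_measure L. v z = f0 (fst z)" using f0 uv by eventually_elim simp
  then have "AE z in lborel \<Otimes>\<^sub>M lborel. z \<in> strip L \<longrightarrow> v z = f0 (fst z)"
    by (simp only: AE_restrict_space_iff[OF strip_leb] AE_completion_iff lborel_prod)
  from lborel_pair.AE_pair[OF this]
  have slice: "AE x in lborel. AE y in lborel. (x, y) \<in> strip L \<longrightarrow> v (x, y) = f0 x" by simp
  define f where "f x = inverse (of_real L) * (\<integral>y. indicator {0..L} y *\<^sub>R v (x, y) \<partial>lborel)" for x
  have fm [measurable]: "f \<in> borel_measurable borel" unfolding f_def by measurable
  have "AE x in lborel. AE y in lborel. (x, y) \<in> strip L \<longrightarrow> v (x, y) = f (fst (x, y))"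
    using slice
  proof eventually_elim
    case (elim x)
    have "(\<integral>y. indicator {0..L} y *\<^sub>R v (x, y) \<partial>lborel) = (\<integral>y. indicator {0..L} y *\<^sub>R f0 x \<partial>lborel)"
    proof (rule integral_cong_AE)
      show "AE y in lborel. indicator {0..L} y *\<^sub>R v (x, y) = indicator {0..L} y *\<^sub>R f0 x"
        using elim by eventually_elim (auto simp: strip_def indicator_def)
    qed measurable
    also have "\<dots> = of_real L * f0 x" using L by (simp add: scaleR_conv_of_real)
    finally have "f x = f0 x" using L by (simp add: f_def)
    then show ?case using elim by simp
  qed
  then have "AE z in lborel \<Otimes>\<^sub>M lborel. z \<in> strip L \<longrightarrow> v z = f (fst z)"
  proof (rule lborel_pair.AE_pair_measure[rotated])
    have "strip L \<in> sets (borel \<Otimes>\<^sub>M borel)" unfolding borel_prod by (rule sets_strip)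
    then show "{z \<in> space (lborel \<Otimes>\<^sub>M lborel). z \<in> strip L \<longrightarrow> v z = f (fst z)} \<in> sets (lborel \<Otimes>\<^sub>M lborel)"
      by measurable
  qed
  then have "AE z in lborel. z \<in> strip L \<longrightarrow> v z = f (fst z)" by (simp only: lborel_prod)
  then have "AE z in strip_measure L. v z = f (fst z)" by (rule AE_lebesgue_on_borel[OF _ sets_strip])
  with uv have uf: "AE z in strip_measure L. u z = f (fst z)" by eventually_elim simp
  have fm2: "(\<lambda>z. f (fst z)) \<in> borel_measurable (borel :: (real \<times> real) measure)"
    unfolding borel_prod[symmetric] by measurable
  have "(\<lambda>z. f (fst z)) \<in> strip_L2 L"
    by (rule L2_space_cong_AE[OF uL2 uf borel_imp_lebesgue_on[OF fm2]])
  then have "integrable lborel (\<lambda>x. (cmod (f x))\<^sup>2)"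
    by (intro integrable_strip_fst[OF _ _ L]) (auto dest: L2_spaceD(2))
  then have f: "f \<in> line_L2" by (intro L2_spaceI) auto
  obtain g where g: "is_weak_partial L (1, 0) u g" using u by (auto simp: H1_def)
  from weak_partial_x_function_of_x[OF L f uL2 uf g]
  obtain h where h: "h \<in> line_L2" and weak: "\<And>\<psi> p R. smooth_line p \<Longrightarrow> (\<And>x. (\<psi> has_vector_derivative p x) (at x)) \<Longrightarrow> 0 < R \<Longrightarrow>
      (\<And>x. x \<notin> {-R..R} \<Longrightarrow> \<psi> x = 0) \<Longrightarrow> (\<And>x. x \<notin> {-R..R} \<Longrightarrow> p x = 0) \<Longrightarrow>
      (\<integral>x. f x * p x \<partial>lborel) = - (\<integral>x. h x * \<psi> x \<partial>lborel)"
    by blast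
  have "\<exists>f1. H1_line f1 h \<and> (AE x in lborel. f x = f1 x)"
    by (rule weak_derivative_imp_H1_line[OF f h]) (rule weak)
  then obtain f1 where f1: "H1_line f1 h" "AE x in lborel. f x = f1 x" by blast
  have "f1 \<in> borel_measurable borel" using f1(1) by (auto simp: H1_line_def dest: L2_spaceD)
  then have "{z \<in> space (lborel \<Otimes>\<^sub>M lborel). f (fst z) = f1 (fst z)} \<in> sets (lborel \<Otimes>\<^sub>M lborel)"
    by measurable
  then have "AE z in lborel \<Otimes>\<^sub>M lborel. f (fst z) = f1 (fst z)"
    by (rule lborel_pair.AE_pair_measure) (use f1(2) in \<open>auto elim: eventually_mono\<close>)
  then have "AE z in lborel. f (fst z) = f1 (fst z)" by (simp only: lborel_prod)
  then have "AE z in lborel. z \<in> strip L \<longrightarrow> f (fst z) = f1 (fst z)" by eventually_elim simp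
  then have "AE z in strip_measure L. f (fst z) = f1 (fst z)" by (rule AE_lebesgue_on_borel[OF _ sets_strip])
  with uf have "AE z in strip_measure L. u z = f1 (fst z)" by eventually_elim simp
  with f1(1) show ?thesis by blast
qed


section \<open>Competitors for the minimization problem\<close>

text \<open>The weight enters the mass and the quadratic terms only through the norms of
  \<open>b\<close> and \<open>b'\<close>. The minimizer and the exponential use the weight 1, the
  other competitor a linear weight. The last claim is the trace bound with parameter
  \<open>k\<close>, multiplied by \<open>k\<close> to match the trace term of the energy.\<close>

lemma mass_energy_product:
  assumes fh: "H1_line f h" and b: "smooth_line b" "\<And>y. (b has_vector_derivative b' y) (at y)"
    and u: "u \<in> borel_measurable (strip_measure L)" "AE z in strip_measure L. u z = f (fst z) * b (snd z)"
  shows "u \<in> H1 L"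
    and "mass L u = (line_norm f * L2_norm (lebesgue_on {0..L}) b)\<^sup>2"
    and "energy \<gamma> p L u = 1 / 2 * ((line_norm h * L2_norm (lebesgue_on {0..L}) b)\<^sup>2
        + (line_norm f * L2_norm (lebesgue_on {0..L}) b')\<^sup>2)
      + \<gamma> / 2 * (cmod (f 0) * L2_norm (lebesgue_on {0..L}) b)\<^sup>2
      - 1 / (p + 1) * (\<integral>z. cmod (u z) powr (p + 1) \<partial>strip_measure L)"
    and "0 < k \<Longrightarrow> k * (cmod (f 0) * L2_norm (lebesgue_on {0..L}) b)\<^sup>2
      \<le> k\<^sup>2 / 2 * mass L u + 1 / 2 * (line_norm h * L2_norm (lebesgue_on {0..L}) b)\<^sup>2"
proof -
  note tr = product_trace[OF assms]
  have f: "f \<in> line_L2" and h: "h \<in> line_L2" using fh by (auto simp: H1_line_def)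
  have bc: "continuous_on UNIV b" by (rule smooth_line_continuous[OF b(1)])
  have "b' = (\<lambda>y. vector_derivative b (at y))" by (intro ext vector_derivative_at[symmetric] b(2))
  then have b'c: "continuous_on UNIV b'"
    using smooth_line_continuous[OF smooth_line_vector_derivative[OF b(1)]] by simp
  show "u \<in> H1 L" using tr(3) by (simp add: is_trace_def)
  have "strip_norm L u = strip_norm L (\<lambda>z. f (fst z) * b (snd z))"
  proof (rule L2_norm_eqI)
    show "AE z in strip_measure L. cmod (u z) = cmod (f (fst z) * b (snd z))"
      using u(2) by eventually_elim simp
  qed (use u(1) L2_spaceD(1)[OF L2_strip_product(1)[OF f bc]] in auto)
  then show mass: "mass L u = (line_norm f * L2_norm (lebesgue_on {0..L}) b)\<^sup>2"
    by (simp add: mass_def L2_strip_product(2)[OF f bc])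
  note norms = L2_strip_product(2)[OF h bc] L2_strip_product(2)[OF f b'c] L2_norm_cmult
  show "energy \<gamma> p L u = 1 / 2 * ((line_norm h * L2_norm (lebesgue_on {0..L}) b)\<^sup>2
        + (line_norm f * L2_norm (lebesgue_on {0..L}) b')\<^sup>2)
      + \<gamma> / 2 * (cmod (f 0) * L2_norm (lebesgue_on {0..L}) b)\<^sup>2
      - 1 / (p + 1) * (\<integral>z. cmod (u z) powr (p + 1) \<partial>strip_measure L)"
    using energy_eq[OF tr(3,1,2)] by (simp only: norms)
  show "k * (cmod (f 0) * L2_norm (lebesgue_on {0..L}) b)\<^sup>2
      \<le> k\<^sup>2 / 2 * mass L u + 1 / 2 * (line_norm h * L2_norm (lebesgue_on {0..L}) b)\<^sup>2" if "0 < k"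
  proof -
    have "(cmod (f 0) * L2_norm (lebesgue_on {0..L}) b)\<^sup>2
      \<le> k / 2 * mass L u + 1 / (2 * k) * (line_norm h * L2_norm (lebesgue_on {0..L}) b)\<^sup>2"
      using trace_bound[OF tr(3,1) that] by (simp only: norms mass_def)
    from mult_left_mono[OF this less_imp_le[OF that]] show ?thesis
      using that by (simp add: algebra_simps power2_eq_square)
  qed
qed

section \<open>Explicit integrals for constant, linear and exponential factors\<close>

lemma L2_norm_Icc_const:
  assumes "0 < L"
  shows "L2_norm (lebesgue_on {0..L}) (\<lambda>y. c) = cmod c * sqrt L"
proof -
  have "(\<integral>y. (cmod c)\<^sup>2 \<partial>lebesgue_on {0..L}) = (cmod c)\<^sup>2 * L"
    using assms by (subst integral_lebesgue_on_borel(1)) (simp_all add: set_lebesgue_integral_def)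
  then show ?thesis unfolding L2_norm_def by (simp only: real_sqrt_mult real_sqrt_abs abs_norm_cancel)
qed

lemma set_integral_powr:
  fixes L a :: real
  assumes "0 < L" "0 < a"
  shows "set_integrable lborel {0..L} (\<lambda>y. y powr a)" "(LINT y:{0..L}|lborel. y powr a) = L powr (a + 1) / (a + 1)"
proof -
  show i: "set_integrable lborel {0..L} (\<lambda>y. y powr a)"
    using assms by (intro borel_integrable_atLeastAtMost' continuous_on_powr' continuous_intros) auto
  have "((\<lambda>y. y powr a) has_integral (L powr (a + 1) / (a + 1))) {0..L}"
    using assms by (intro has_integral_powr_from_0) auto
  then show "(LINT y:{0..L}|lborel. y powr a) = L powr (a + 1) / (a + 1)"
    using set_borel_integral_eq_integral(2)[OF i] by (simp add: integral_unique)
qed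

lemma L2_norm_Icc_linear:
  assumes "0 < L"
  shows "L2_norm (lebesgue_on {0..L}) (\<lambda>y. of_real (c * y)) = \<bar>c\<bar> * sqrt (L ^ 3 / 3)"
proof -
  have "(\<integral>y. (cmod (of_real (c * y)))\<^sup>2 \<partial>lebesgue_on {0..L}) = (LINT y:{0..L}|lborel. c\<^sup>2 * y powr 2)"
    by (subst integral_lebesgue_on_borel(1))
      (auto intro!: set_lebesgue_integral_cong simp: norm_mult power_mult_distrib powr_numeral)
  also have "\<dots> = c\<^sup>2 * (L ^ 3 / 3)"
    using assms set_integral_powr(2)[OF assms, of 2] by (simp add: set_integral_mult_right powr_numeral)
  finally show ?thesis unfolding L2_norm_def by (simp only: real_sqrt_mult real_sqrt_abs)
qed

lemma exp_abs_integral: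
  fixes a :: real
  assumes a: "0 < a"
  shows "integrable lborel (\<lambda>x. exp (- a * \<bar>x\<bar>))" "(\<integral>x. exp (- a * \<bar>x\<bar>) \<partial>lborel) = 2 / a"
proof -
  define E where "E x = (if x \<in> {0..} then exp (- a * x) else 0)" for x
  have Em: "E \<in> borel_measurable borel" 
  proof -
    have "E = (\<lambda>x. indicator {0..} x * exp (- a * x))" by (auto simp: E_def)
    then show ?thesis
      by (simp only:) (intro borel_measurable_times borel_measurable_indicator
        borel_measurable_continuous_onI, auto intro!: continuous_intros)
  qed
  have "(E has_integral 1 / a) UNIV"
    using has_integral_exp_minus_to_infinity[OF a, of 0]
    unfolding E_def[abs_def] has_integral_restrict_UNIV by simp
  moreover have "0 \<le> E x" for x by (simp add: E_def)
  ultimately have nn: "(\<integral>\<^sup>+x. ennreal (E x) \<partial>lborel) = ennreal (1 / a)"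
    by (intro nn_integral_has_integral_lborel Em)
  have E: "integrable lborel E" "(\<integral>x. E x \<partial>lborel) = 1 / a"
  proof -
    show "integrable lborel E"
      by (rule integrableI_nonneg) (use Em nn in \<open>auto simp: E_def\<close>)
    show "(\<integral>x. E x \<partial>lborel) = 1 / a"
      using a Em nn by (subst integral_eq_nn_integral) (auto simp: E_def)
  qed
  have E': "integrable lborel (\<lambda>x. E (- x))" "(\<integral>x. E (- x) \<partial>lborel) = 1 / a"
    using lborel_integrable_real_affine[OF E(1), of "- 1" 0] lborel_integral_real_affine[of "- 1" E 0] E(2) by auto
  \<comment> \<open>Both half-lines contain 0, where the sum is 2 instead of 1; a single point is
    negligible.\<close>
  have AE: "AE x in lborel. E x + E (- x) = exp (- a * \<bar>x\<bar>)"
    using AE_lborel_singleton[of 0] by eventually_elim (auto simp: E_def)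
  have m: "(\<lambda>x. E x + E (- x)) \<in> borel_measurable lborel" "(\<lambda>x. exp (- a * \<bar>x\<bar>)) \<in> borel_measurable lborel"
    using Em by measurable
  show "integrable lborel (\<lambda>x. exp (- a * \<bar>x\<bar>))"
    using integrable_cong_AE[OF m AE] E(1) E'(1) by simp
  show "(\<integral>x. exp (- a * \<bar>x\<bar>) \<partial>lborel) = 2 / a"
    using integral_cong_AE[OF m AE] E E' by simp
qed

lemma has_real_derivative_abs:
  fixes x :: real
  assumes "x \<noteq> 0"
  shows "((\<lambda>x. \<bar>x\<bar>) has_real_derivative sgn x) (at x)"
proof (cases "0 < x")
  case True
  have "((\<lambda>x. x) has_real_derivative sgn x) (at x)" using True by (auto intro!: derivative_eq_intros)
  then show ?thesis
    by (rule has_field_derivative_transform_within_open[where S = "{0<..}"]) (use True in auto)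
next
  case False
  have "((\<lambda>x. - x) has_real_derivative sgn x) (at x)"
    using False assms by (auto intro!: derivative_eq_intros)
  then show ?thesis
    by (rule has_field_derivative_transform_within_open[where S = "{..<0}"]) (use False assms in auto)
qed

text \<open>The ground state of the one-dimensional operator with an attractive delta interaction at 0.\<close>

definition delta_state :: "real \<Rightarrow> real \<Rightarrow> real \<Rightarrow> complex" where
  "delta_state k c x = of_real (c * exp (- k * \<bar>x\<bar>))"

text \<open>Away from 0 the derivative is \<open>- k * sgn x\<close> times the state, so its norm is
  k times that of the state. The kink at 0 is the exceptional point allowed in the fundamental
  theorem of calculus.\<close>

lemma delta_state:
  assumes k: "0 < k" and c: "0 < c"
  shows "H1_line (delta_state k c) (\<lambda>x. of_real (- k * sgn x) * delta_state k c x)"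
    and "(line_norm (delta_state k c))\<^sup>2 = c\<^sup>2 / k"
    and "(line_norm (\<lambda>x. of_real (- k * sgn x) * delta_state k c x))\<^sup>2 = k * c\<^sup>2"
    and "0 < q \<Longrightarrow> integrable lborel (\<lambda>x. cmod (delta_state k c x) powr q)"
    and "0 < q \<Longrightarrow> 0 < (\<integral>x. cmod (delta_state k c x) powr q \<partial>lborel)"
proof -
  let ?g = "delta_state k c" and ?h = "\<lambda>x. of_real (- k * sgn x) * delta_state k c x"
  have norm_g: "cmod (?g x) = c * exp (- k * \<bar>x\<bar>)" for x
    unfolding delta_state_def norm_of_real using c by simp
  have gm [measurable]: "?g \<in> borel_measurable borel" unfolding delta_state_def by measurable
  have hm [measurable]: "?h \<in> borel_measurable borel" by measurable
  have g2: "(cmod (?g x))\<^sup>2 = c\<^sup>2 * exp (- (2 * k) * \<bar>x\<bar>)" for x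
    unfolding norm_g by (simp add: power_mult_distrib exp_double[symmetric] mult_ac)
  note e2 = exp_abs_integral[of "2 * k"]
  have gi: "integrable lborel (\<lambda>x. (cmod (?g x))\<^sup>2)" unfolding g2 using e2 k by simp
  have gL2: "?g \<in> line_L2" by (intro L2_spaceI gi) simp
  show g_norm: "(line_norm ?g)\<^sup>2 = c\<^sup>2 / k"
    unfolding L2_norm_power2 g2 using e2 k by simp
  have h_norm: "AE x in lborel. cmod (?h x) = cmod (of_real k * ?g x)"
    using AE_lborel_singleton[of 0] by eventually_elim (use k in \<open>simp add: norm_mult abs_mult\<close>)
  have hL2: "?h \<in> line_L2"
    by (rule L2_space_bound[OF gL2, where C = k]) (use h_norm k in \<open>auto simp: norm_mult elim!: eventually_mono\<close>)
  have "line_norm ?h = line_norm (\<lambda>x. of_real k * ?g x)"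
    by (rule L2_norm_eqI[OF h_norm]) auto
  then have "(line_norm ?h)\<^sup>2 = k\<^sup>2 * (c\<^sup>2 / k)"
    by (simp only: L2_norm_cmult power_mult_distrib g_norm norm_of_real power2_abs)
  then show "(line_norm ?h)\<^sup>2 = k * c\<^sup>2" using k by (simp only:) (simp add: power2_eq_square)
  have "is_primitive ?g ?h"
    unfolding is_primitive_def
  proof (intro allI impI)
    fix a b :: real assume ab: "a \<le> b"
    have FTC: "(?h has_integral (?g b - ?g a)) {a..b}"
    proof (rule fundamental_theorem_of_calculus_strong[of "{0}", OF _ ab])
      show "continuous_on {a..b} ?g" unfolding delta_state_def by (intro continuous_intros)
      fix x :: real assume "x \<in> {a..b} - {0}"
      then have "((\<lambda>x. \<bar>x\<bar>) has_real_derivative sgn x) (at x)" by (intro has_real_derivative_abs) simp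
      then have "((\<lambda>x. c * exp (- k * \<bar>x\<bar>)) has_real_derivative (- k * sgn x * (c * exp (- k * \<bar>x\<bar>)))) (at x)"
        by (auto intro!: derivative_eq_intros simp del: abs_sgn)
      then have "((\<lambda>x. of_real (c * exp (- k * \<bar>x\<bar>))) has_vector_derivative
          of_real (- k * sgn x * (c * exp (- k * \<bar>x\<bar>)))) (at x)"
        by (intro has_vector_derivative_of_real) (simp add: has_real_derivative_iff_has_vector_derivative)
      then show "(?g has_vector_derivative ?h x) (at x)"
        unfolding delta_state_def by (simp only: of_real_mult)
    qed simp
    show "?g b - ?g a = (LINT t:{a..b}|lborel. ?h t)"
      unfolding set_borel_integral_eq_integral(2)[OF L2_set_integral_Icc(1)[OF hL2 ab]]
      by (rule integral_unique[OF FTC, symmetric])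
  qed
  then show "H1_line ?g ?h" using gL2 hL2 by (simp add: H1_line_def)
  assume q: "0 < q"
  have gq: "cmod (?g x) powr q = c powr q * exp (- (k * q) * \<bar>x\<bar>)" for x
    unfolding norm_g using c by (simp add: powr_mult exp_powr_real mult_ac)
  note eq = exp_abs_integral[of "k * q"]
  show "integrable lborel (\<lambda>x. cmod (?g x) powr q)" unfolding gq using eq k q by simp
  show "0 < (\<integral>x. cmod (?g x) powr q \<partial>lborel)" unfolding gq using eq k q c by simp
qed

text \<open>Since ln 3 \<ge> 1, the convexity bound for exp gives 3^(q - 1) \<ge> 1 + (q - 1) = q.
  Hence 3^q \<ge> 3 q, and strictness comes from 3 q > 1 + 2 q.\<close>

lemma Bernoulli_3_strict:
  assumes "1 < (q::real)"
  shows "1 + 2 * q < 3 powr q"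
proof -
  have "1 \<le> ln (3::real)" using exp_le by (subst ln_ge_iff) auto
  then have "(q - 1) * 1 \<le> (q - 1) * ln 3" using assms by (intro mult_left_mono) auto
  then have "1 + (q - 1) \<le> 1 + (q - 1) * ln 3" by simp
  also have "\<dots> \<le> exp ((q - 1) * ln 3)" by (rule exp_ge_add_one_self)
  also have "\<dots> = 3 powr (q - 1)" by (simp add: powr_def)
  finally have "3 * q \<le> 3 * 3 powr (q - 1)" by simp
  also have "\<dots> = 3 powr q" by (simp add: powr_diff)
  finally show ?thesis using assms by simp
qed

lemma strip_powr_product:
  assumes f: "f \<in> borel_measurable borel" "integrable lborel (\<lambda>x. cmod (f x) powr q)"
    and b: "continuous_on UNIV b" "b \<in> borel_measurable borel" and "0 < q"
  shows "integrable (strip_measure L) (\<lambda>z. cmod (f (fst z) * b (snd z)) powr q)"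
    and "(\<integral>z. cmod (f (fst z) * b (snd z)) powr q \<partial>strip_measure L)
      = (\<integral>x. cmod (f x) powr q \<partial>lborel) * (LINT y:{0..L}|lborel. cmod (b y) powr q)"
proof -
  have i: "set_integrable lborel {0..L} (\<lambda>y. cmod (b y) powr q)"
    using assms(5) by (intro borel_integrable_atLeastAtMost' continuous_on_powr' continuous_intros
      continuous_on_subset[OF b(1)]) auto
  have m: "(\<lambda>y. cmod (b y) powr q) \<in> borel_measurable borel" using b(2) by measurable
  have eq: "cmod (f (fst z) * b (snd z)) powr q = cmod (f (fst z)) powr q * cmod (b (snd z)) powr q"
    for z :: "real \<times> real" by (simp add: norm_mult powr_mult)
  show "integrable (strip_measure L) (\<lambda>z. cmod (f (fst z) * b (snd z)) powr q)"
    and "(\<integral>z. cmod (f (fst z) * b (snd z)) powr q \<partial>strip_measure L)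
      = (\<integral>x. cmod (f x) powr q \<partial>lborel) * (LINT y:{0..L}|lborel. cmod (b y) powr q)"
    unfolding eq using integral_strip_product[OF f(2) i m] by auto
qed

section \<open>Comparison of energies on wide strips\<close>

theorem theorem1p5:
  fixes \<gamma> p :: real
  assumes "\<gamma> < 0" and "1 < p" and "p < 3"
  shows "\<forall>m'>0. \<exists>L0>0. \<forall>L>L0. \<forall>u.
           is_minimizer \<gamma> p L (m' * L) u \<and> real_positive L u \<longrightarrow> \<not> function_of_x_alone L u"
proof (intro allI impI)
  fix m' :: real assume m: "0 < m'"
  \<comment> \<open>With this \<open>k\<close> the trace term of the energy is -k |f(0)|^2 per unit
    length, which the trace inequality with parameter \<open>k\<close> bounds.\<close>
  define k where "k = - \<gamma> / 2"
  have k: "0 < k" "\<gamma> = - 2 * k" using assms(1) by (auto simp: k_def)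
  \<comment> \<open>The exponential with amplitude \<open>c\<close> has squared norm
    \<open>c\<^sup>2 / k\<close>, which this choice makes equal to \<open>m'\<close>.\<close>
  define c where "c = sqrt (k * m')"
  have c: "0 < c" "c\<^sup>2 = k * m'" using k m by (auto simp: c_def)
  define g where "g = delta_state k c"
  define N where "N = (\<integral>x. cmod (g x) powr (p + 1) \<partial>lborel)"
  have N: "0 < N" unfolding N_def g_def using assms(2) by (intro delta_state(5)[OF k(1) c(1)]) simp
  \<comment> \<open>\<open>1 + d\<close> is the mean over \<open>{0..L}\<close> of the power p + 1
    of sqrt 3 y / L, which does not depend on \<open>L\<close>; p + 2 is 2 q + 1 for q = (p + 1) /
    2.\<close>
  define d where "d = 3 powr ((p + 1) / 2) / (p + 2) - 1"
  have d: "0 < d" using Bernoulli_3_strict[of "(p + 1) / 2"] assms(2) by (simp add: d_def field_simps)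
  \<comment> \<open>The width at which \<open>2 * d * N * L\<^sup>2 = 3 * m' * (p + 1)\<close>, the
    equality case of the final estimate.\<close>
  define L0 where "L0 = sqrt (3 * m' * (p + 1) / (2 * d * N))"
  have L0: "0 < L0" using m d N assms(2) by (simp add: L0_def)
  show "\<exists>L0>0. \<forall>L>L0. \<forall>u. is_minimizer \<gamma> p L (m' * L) u \<and> real_positive L u \<longrightarrow> \<not> function_of_x_alone L u"
  proof (intro exI conjI allI impI notI, rule L0)
    fix L u
    assume "L0 < L" and "is_minimizer \<gamma> p L (m' * L) u \<and> real_positive L u" and x: "function_of_x_alone L u"
    then have L: "0 < L" and min: "u \<in> H1 L" "mass L u = m' * L"
      "ereal (energy \<gamma> p L u) = min_energy \<gamma> p L (m' * L)"
      using L0 by (auto simp: is_minimizer_def)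
    have le: "energy \<gamma> p L u \<le> energy \<gamma> p L v" if "v \<in> H1 L" "mass L v = m' * L" for v
    proof -
      have "min_energy \<gamma> p L (m' * L) \<le> ereal (energy \<gamma> p L v)"
        unfolding min_energy_def by (rule INF_lower) (use that in simp)
      then show ?thesis by (simp add: min(3)[symmetric])
    qed
    obtain f h where fh: "H1_line f h" and uf: "AE z in strip_measure L. u z = f (fst z)"
      using H1_function_of_x_alone[OF L min(1) x] by blast
    have f: "f \<in> borel_measurable borel" using fh by (auto simp: H1_line_def dest: L2_spaceD)
    have fst_m: "(\<lambda>z. F (fst z)) \<in> borel_measurable (strip_measure L)"
      if "F \<in> borel_measurable borel" for F :: "real \<Rightarrow> 'b::topological_space"
    proof (rule borel_imp_lebesgue_on)
      show "(\<lambda>z. F (fst z)) \<in> borel_measurable (borel :: (real \<times> real) measure)"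
        using that unfolding borel_prod[symmetric] by measurable
    qed
    have um: "u \<in> borel_measurable (strip_measure L)" using min(1) by (auto simp: H1_def dest: L2_spaceD)
    define one :: "real \<Rightarrow> complex" where "one = (\<lambda>y. 1)"
    have one: "smooth_line one" "\<And>y. (one has_vector_derivative 0) (at y)"
      "continuous_on UNIV one" "one \<in> borel_measurable borel" by (auto simp: one_def)
    have one_norm: "(L2_norm (lebesgue_on {0..L}) one)\<^sup>2 = L"
      using L by (simp add: one_def L2_norm_Icc_const)
    have one_powr: "(LINT y:{0..L}|lborel. cmod (one y) powr (p + 1)) = L"
      using L by (simp add: one_def set_lebesgue_integral_def)
    note u_energy = mass_energy_product[OF fh one(1,2) um, unfolded one_def mult_1_right, OF uf, folded one_def]
    define F where "F = (\<integral>z. cmod (u z) powr (p + 1) \<partial>strip_measure L)"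
    define a t where "a = (line_norm h)\<^sup>2" and "t = (cmod (f 0))\<^sup>2"
    have f_norm: "(line_norm f)\<^sup>2 = m'"
      using u_energy(2) min(2) L by (simp add: power_mult_distrib one_norm)
    have Eu: "energy \<gamma> p L u = 1 / 2 * a * L - k * t * L - F / (p + 1)"
      using u_energy(3)[of \<gamma> p] by (simp add: power_mult_distrib one_norm F_def k(2) a_def t_def)
    \<comment> \<open>The trace inequality absorbs the unknown \<open>a\<close> and
      \<open>t\<close>, so the lower bound depends on \<open>u\<close> only through its mass and
      \<open>F\<close>.\<close>
    have "k * t * L \<le> k\<^sup>2 / 2 * (m' * L) + 1 / 2 * a * L"
      using u_energy(4)[OF k(1)] by (simp add: power_mult_distrib one_norm min(2) a_def t_def)
    with Eu have lower: "- (k\<^sup>2 / 2 * m' * L) - F / (p + 1) \<le> energy \<gamma> p L u" by simp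

    let ?v = "\<lambda>z. g (fst z) * one (snd z)"
    note g = delta_state(1-4)[OF k(1) c(1), folded g_def]
    have gm: "g \<in> borel_measurable borel" using g(1) by (auto simp: H1_line_def dest: L2_spaceD)
    have vm: "?v \<in> borel_measurable (strip_measure L)"
      using fst_m[OF gm] by (simp add: one_def)
    note v_energy = mass_energy_product[OF g(1) one(1,2) vm AE_I2, OF refl]
    have "mass L ?v = m' * L"
      using v_energy(2) g(2) c(2) k(1) by (simp add: power_mult_distrib one_norm)
    with le[OF v_energy(1)] have "energy \<gamma> p L u \<le> energy \<gamma> p L ?v" by simp
    also have "\<dots> = 1 / 2 * (k * c\<^sup>2) * L - k * c\<^sup>2 * L - N * L / (p + 1)"
    proof -
      have "cmod (g 0) = c" using c(1) by (simp add: g_def delta_state_def)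
      moreover have "(\<integral>z. cmod (?v z) powr (p + 1) \<partial>strip_measure L) = N * L"
        using strip_powr_product(2)[where L = L and q = "p + 1", OF gm g(4) one(3,4)] assms(2) by (simp add: one_powr N_def)
      ultimately show ?thesis
        using v_energy(3)[of \<gamma> p] g(3) by (simp add: power_mult_distrib one_norm k(2))
    qed
    \<comment> \<open>The exponential attains equality in the trace inequality, so its quadratic
      part is the one in \<open>lower\<close> and only the nonlinear terms remain to be
      compared.\<close>
    also have "\<dots> = - (k\<^sup>2 / 2 * m' * L) - N * L / (p + 1)"
      unfolding c(2) by (simp add: power2_eq_square)
    finally have "N * L / (p + 1) \<le> F / (p + 1)" using lower by linarith
    then have F: "N * L \<le> F" using assms(2) by (simp add: divide_le_cancel)
    \<comment> \<open>The Bochner integral of a non-integrable function is 0 by convention.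
      Positivity of \<open>F\<close> excludes this default, so the power of the profile is
      integrable.\<close>
    then have F_pos: "0 < F" using N L by (smt (verit) mult_pos_pos)
    then have "integrable (strip_measure L) (\<lambda>z. cmod (u z) powr (p + 1))"
      using not_integrable_integral_eq unfolding F_def by fastforce
    moreover have AE_powr: "AE z in strip_measure L. cmod (u z) powr (p + 1) = cmod (f (fst z)) powr (p + 1)"
      using uf by eventually_elim simp
    moreover have fp: "(\<lambda>x. cmod (f x) powr (p + 1)) \<in> borel_measurable borel" using f by measurable
    moreover have up: "(\<lambda>z. cmod (u z) powr (p + 1)) \<in> borel_measurable (strip_measure L)" using um by measurable
    ultimately have "integrable (strip_measure L) (\<lambda>z. cmod (f (fst z)) powr (p + 1))"
      using integrable_cong_AE[OF up fst_m[OF fp] AE_powr] by blast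
    from integrable_strip_fst[OF fp this L]
    have fi: "integrable lborel (\<lambda>x. cmod (f x) powr (p + 1))" .
    define I where "I = (\<integral>x. cmod (f x) powr (p + 1) \<partial>lborel)"
    have "F = (\<integral>z. cmod (f (fst z) * one (snd z)) powr (p + 1) \<partial>strip_measure L)"
      unfolding F_def using integral_cong_AE[OF up fst_m[OF fp] AE_powr] by (simp add: one_def)
    also have "\<dots> = I * L"
      using strip_powr_product(2)[OF f fi one(3,4), of L] assms(2) by (simp add: one_powr I_def)
    finally have FI: "F = I * L" .
    have I: "N \<le> I" using F L by (simp add: FI)

    \<comment> \<open>The slope for which the squared norm \<open>s\<^sup>2 * (L ^ 3 / 3)\<close> of
      the weight equals \<open>L\<close>, the squared norm of the constant 1.\<close>
    define s where "s = sqrt 3 / L"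
    define b :: "real \<Rightarrow> complex" where "b y = of_real (s * y)" for y
    have b_der: "(b has_vector_derivative of_real s) (at y)" for y
      unfolding b_def
      by (intro has_vector_derivative_of_real)
        (auto intro!: derivative_eq_intros simp: has_real_derivative_iff_has_vector_derivative[symmetric])
    have sb: "smooth_line b" by (rule smooth_line_antiderivative[OF smooth_line_const b_der])
    have bc: "continuous_on UNIV b" by (rule smooth_line_continuous[OF sb])
    have bm: "b \<in> borel_measurable borel" by (rule borel_measurable_continuous_onI[OF bc])
    let ?w = "\<lambda>z. f (fst z) * b (snd z)"
    have wm: "?w \<in> borel_measurable (strip_measure L)"
      using fh bc by (auto simp: H1_line_def intro!: L2_spaceD(1)[OF L2_strip_product(1)])
    note w_energy = mass_energy_product[OF fh sb b_der wm AE_I2, OF refl]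
    have s2: "s\<^sup>2 = 3 / L\<^sup>2" by (simp add: s_def power_divide)
    have "L2_norm (lebesgue_on {0..L}) b = \<bar>s\<bar> * sqrt (L ^ 3 / 3)"
      using L2_norm_Icc_linear[OF L, of s] by (simp only: b_def[abs_def])
    then have "(L2_norm (lebesgue_on {0..L}) b)\<^sup>2 = s\<^sup>2 * (L ^ 3 / 3)" using L by (simp add: power_mult_distrib)
    then have b_norm: "(L2_norm (lebesgue_on {0..L}) b)\<^sup>2 = L"
      using L unfolding s2 by (simp add: power2_eq_square power3_eq_cube)
    have "(L2_norm (lebesgue_on {0..L}) (\<lambda>y. of_real s))\<^sup>2 = s\<^sup>2 * L"
      using L by (simp add: L2_norm_Icc_const power_mult_distrib)
    then have b'_norm: "(L2_norm (lebesgue_on {0..L}) (\<lambda>y. of_real s))\<^sup>2 = 3 / L"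
      using L unfolding s2 by (simp add: power2_eq_square)
    have b_powr: "(LINT y:{0..L}|lborel. cmod (b y) powr (p + 1)) = (1 + d) * L"
    proof -
      have s_pos: "0 < s" using L by (simp add: s_def)
      have "(LINT y:{0..L}|lborel. cmod (b y) powr (p + 1)) = (LINT y:{0..L}|lborel. s powr (p + 1) * y powr (p + 1))"
        using s_pos by (intro set_lebesgue_integral_cong) (auto simp: b_def norm_mult powr_mult simp del: of_real_mult)
      also have "\<dots> = s powr (p + 1) * (L powr (p + 2) / (p + 2))"
        using set_integral_powr(2)[OF L, of "p + 1"] assms(2)
        by (simp add: set_integral_mult_right add.commute)
      also have "s powr (p + 1) = 3 powr ((p + 1) / 2) / L powr (p + 1)"
        using L by (simp add: s_def powr_divide powr_half_sqrt[symmetric] powr_powr)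
      also have "L powr (p + 2) = L powr (p + 1) * L"
        using L powr_add[of L "p + 1" 1] by (simp add: add.commute)
      finally show ?thesis using L by (simp add: d_def)
    qed
    have "mass L ?w = m' * L" using w_energy(2) f_norm by (simp add: power_mult_distrib b_norm)
    with le[OF w_energy(1)] have "energy \<gamma> p L u \<le> energy \<gamma> p L ?w" by simp
    also have "\<dots> = 1 / 2 * (a * L + m' * (3 / L)) - k * t * L - I * ((1 + d) * L) / (p + 1)"
      using w_energy(3)[of \<gamma> p] strip_powr_product(2)[OF f fi bc bm, of L] assms(2)
      by (simp add: power_mult_distrib b_norm b'_norm f_norm b_powr I_def a_def t_def k(2))
    \<comment> \<open>The terms in \<open>a\<close> and \<open>t\<close> are the same for both
      functions and cancel, which leaves the nonlinear gain against the cost of the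
      y-derivative.\<close>
    finally have "I * d * L / (p + 1) \<le> 3 * m' / (2 * L)"
      unfolding Eu FI by (simp add: algebra_simps add_divide_distrib)
    then have "2 * d * I * L\<^sup>2 \<le> 3 * m' * (p + 1)"
      using L assms(2) by (simp add: field_simps power2_eq_square)
    moreover have "2 * d * N * L\<^sup>2 \<le> 2 * d * I * L\<^sup>2" using I d by (intro mult_right_mono mult_left_mono) auto
    ultimately have "L\<^sup>2 * (2 * d * N) \<le> 3 * m' * (p + 1)" by (simp only: mult.commute[of "L\<^sup>2"])
    then have "L\<^sup>2 \<le> 3 * m' * (p + 1) / (2 * d * N)" using d N by (simp only: pos_le_divide_eq mult_pos_pos zero_less_numeral)
    then have "L \<le> L0" unfolding L0_def using L by (intro real_le_rsqrt)
    with \<open>L0 < L\<close> show False by simp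
  qed
qed

end
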